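(* Assume that all of the following hold. (1) There exists $\gamma>0$ such that $p(n)=O(n^\gamma)$ as $n\to\infty$. (2) For all $n\in\mathbb{N}$ and $a\in\Gamma(n)$, $\mathrm{Var}(X_a)=1$; and there exists $v^2>0$ such that $\mathrm{Var}(X_a\mid X_{\Gamma(n)\setminus\{a\}})\ge v^2$ for all $n\in\mathbb{N}$ and $a\in\Gamma(n)$. (3) There exists $0\le\kappa<1$ such that $\max_{a\in\Gamma(n)}|\mathrm{ne}_a|=O(n^\kappa)$ as $n\to\infty$. (4) There exists $\vartheta<\infty$ such that for all $n\in\mathbb{N}$ and all neighboring nodes $a,b\in\Gamma(n)$, $\|\theta^{a,\mathrm{ne}_b\setminus\{a\}}\|_1\le\vartheta$. (5) There exist $\delta>0$ and $\xi>\kappa$ (with $\kappa$ as in (3)) such that for all $n\in\mathbb{N}$ and every $(a,b)\in E$, $|\pi_{ab}|\ge\delta n^{-(1-\xi)/2}$. (6) There exists $\delta'<1$ such that for all $n\in\mathbb{N}$ and all $a,b\in\Gamma(n)$ with $b\ne a$ and $b\notin\mathrm{ne}_a$, $|S_a(b)|<\delta'$. Let the penalty parameter $\lambda=\lambda_n$ satisfy $\lambda_n\sim d\,n^{-(1-\varepsilon)/2}$ with some $\kappa<\varepsilon<\xi$ and $d>0$. Then there exists $c>0$ such that, for all $a\in\Gamma(n)$, $$P(\hat{\mathrm{ne}}_a^{\lambda}\subseteq\mathrm{ne}_a)=1-O(\exp(-cn^\varepsilon))\qquad\text{as }n\to\infty.$$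
   Context: For each $n\in\mathbb{N}$ let $\Gamma(n)=\{1,\dots,p(n)\}$ be a finite set of nodes and let $X=(X_k)_{k\in\Gamma(n)}\sim\mathcal{N}(0,\Sigma(n))$ with $\Sigma(n)$ nonsingular; write $K=\Sigma^{-1}(n)$. The dependence on $n$ of the objects below is suppressed. $\mathbf{X}$ is the $n\times p(n)$ random matrix whose rows are $n$ independent observations of $X$; $\mathbf{X}_a\in\mathbb{R}^n$ is its column for node $a$; $\|\cdot\|_2$ is the Euclidean norm on $\mathbb{R}^n$, and $\|\theta\|_1=\sum_{b\in\Gamma(n)}|\theta_b|$. Graph: the edge set $E\subseteq\Gamma(n)\times\Gamma(n)$ consists of the pairs $(a,b)$, $a\ne b$, such that $X_a$ and $X_b$ are conditionally dependent given all remaining variables (equivalently $K_{ab}\neq0$). The neighborhood of $a$ is $\mathrm{ne}_a=\{b\in\Gamma(n)\setminus\{a\}:(a,b)\in E\}$; $a,b$ are neighboring if $b\in\mathrm{ne}_a$. The partial correlation is $\pi_{ab}=-K_{ab}/\sqrt{K_{aa}K_{bb}}$, the correlation of $X_a$ and $X_b$ after eliminating the linear effects of all remaining variables. Optimal prediction: for $\mathcal{A}\subseteq\Gamma(n)\setminus\{a\}$, $\theta^{a,\mathcal{A}}=\arg\min\{E(X_a-\sum_{k\in\Gamma(n)}\theta_kX_k)^2:\theta\in\mathbb{R}^{p(n)},\ \theta_k=0\ \forall k\notin\mathcal{A}\}$. For $a,b\in\Gamma(n)$ with $b\notin\mathrm{ne}_a\cup\{a\}$, $S_a(b)=\sum_{k\in\mathrm{ne}_a}\mathrm{sign}(\theta_k^{a,\mathrm{ne}_a})\,\theta_k^{b,\mathrm{ne}_a}$.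 Lasso: $\hat\theta^{a,\lambda}$ is any minimizer of $n^{-1}\|\mathbf{X}_a-\mathbf{X}\theta\|_2^2+\lambda\|\theta\|_1$ over $\theta\in\mathbb{R}^{p(n)}$ with $\theta_a=0$ (if it is not unique, the result is for any solution), and $\hat{\mathrm{ne}}_a^{\lambda}=\{b\in\Gamma(n):\hat\theta_b^{a,\lambda}\ne0\}$. $\lambda_n\sim d\,n^{-(1-\varepsilon)/2}$ means that the ratio tends to $1$. The $O(\cdot)$ bound is understood uniformly over $a\in\Gamma(n)$.
   Formalization: The condition ε ≤ 1 is added; it is automatic if edges exist for infinitely many n. For ε > 1 the graph is eventually empty and the claim fails, e.g. Σ = I, p(n) = 2, κ = 0, ξ = 4, ε = 3, λ_n = n. *)

theory Defs
  imports
    "HOL-Probability.Probability"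
    "HOL-Library.Landau_Symbols"
    "Jordan_Normal_Form.Gauss_Jordan_Elimination"
    "Jordan_Normal_Form.Determinant"
begin

text \<open>
  The nodes of a graph with \<open>p\<close> nodes are \<open>0, \<dots>, p - 1\<close>, matching the index
  convention of the matrix library. A random vector on a probability space \<open>M\<close> is a family
  \<open>X\<close> of real functions on \<open>M\<close>, of which only \<open>X a\<close> with \<open>a < p\<close> matters.
\<close>

definition rvec :: "nat set \<Rightarrow> (nat \<Rightarrow> 'w \<Rightarrow> real) \<Rightarrow> 'w \<Rightarrow> (nat \<Rightarrow> real)" where
  "rvec J X = (\<lambda>\<omega>. \<lambda>k\<in>J. X k \<omega>)"

definition precision :: "real mat \<Rightarrow> real mat" where
  "precision S = the (mat_inverse S)"

definition normal_vec_density :: "nat \<Rightarrow> real mat \<Rightarrow> (nat \<Rightarrow> real) \<Rightarrow> real" where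
  "normal_vec_density p S x =
     exp (- (\<Sum>a<p. \<Sum>b<p. x a * precision S $$ (a, b) * x b) / 2)
       / sqrt ((2 * pi) ^ p * Determinant.det S)"

text \<open>
  The centred normal law with nonsingular covariance matrix \<open>S\<close>. A nonsingular
  covariance matrix is the same as a symmetric positive definite one, and the law then has a
  Lebesgue density.
\<close>

definition normal_vec :: "'w measure \<Rightarrow> nat \<Rightarrow> (nat \<Rightarrow> 'w \<Rightarrow> real) \<Rightarrow> real mat \<Rightarrow> bool" where
  "normal_vec M p X S \<longleftrightarrow>
     S \<in> carrier_mat p p \<and> transpose_mat S = S \<and>
     (\<forall>v \<in> carrier_vec p. v \<noteq> 0\<^sub>v p \<longrightarrow> 0 < scalar_prod v (mult_mat_vec S v)) \<and>
     distributed M (\<Pi>\<^sub>M k\<in>{..<p}. lborel) (rvec {..<p} X)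
       (\<lambda>x. ennreal (normal_vec_density p S x))"

definition sigma_gen_by :: "'w measure \<Rightarrow> (nat \<Rightarrow> 'w \<Rightarrow> real) \<Rightarrow> nat set \<Rightarrow> 'w measure" where
  "sigma_gen_by M X J = vimage_algebra (space M) (rvec J X) (\<Pi>\<^sub>M k\<in>J. borel)"

definition cond_variance :: "'w measure \<Rightarrow> 'w measure \<Rightarrow> ('w \<Rightarrow> real) \<Rightarrow> 'w \<Rightarrow> real" where
  "cond_variance M F f =
     real_cond_exp M F (\<lambda>\<omega>. (f \<omega> - real_cond_exp M F f \<omega>)\<^sup>2)"

definition cond_indep :: "'w measure \<Rightarrow> 'w measure \<Rightarrow> ('w \<Rightarrow> real) \<Rightarrow> ('w \<Rightarrow> real) \<Rightarrow> bool" where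
  "cond_indep M F f g \<longleftrightarrow>
     (\<forall>A \<in> sets borel. \<forall>B \<in> sets borel. AE \<omega> in M.
        real_cond_exp M F (\<lambda>\<omega>. indicator A (f \<omega>) * indicator B (g \<omega>)) \<omega> =
        real_cond_exp M F (\<lambda>\<omega>. indicator A (f \<omega>)) \<omega> *
        real_cond_exp M F (\<lambda>\<omega>. indicator B (g \<omega>)) \<omega>)"

definition edges :: "'w measure \<Rightarrow> nat \<Rightarrow> (nat \<Rightarrow> 'w \<Rightarrow> real) \<Rightarrow> (nat \<times> nat) set" where
  "edges M p X =
     {(a, b). a < p \<and> b < p \<and> a \<noteq> b \<and>
        \<not> cond_indep M (sigma_gen_by M X ({..<p} - {a, b})) (X a) (X b)}"

definition ne :: "'w measure \<Rightarrow> nat \<Rightarrow> (nat \<Rightarrow> 'w \<Rightarrow> real) \<Rightarrow> nat \<Rightarrow> nat set" where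
  "ne M p X a = {b \<in> {..<p} - {a}. (a, b) \<in> edges M p X}"

definition partial_corr :: "real mat \<Rightarrow> nat \<Rightarrow> nat \<Rightarrow> real" where
  "partial_corr S a b =
     - (precision S $$ (a, b)) / sqrt (precision S $$ (a, a) * precision S $$ (b, b))"

text \<open>
  Parameter vectors are functions on \<open>nat\<close> that vanish outside \<open>{..<p}\<close>. The minimizer
  below is unique when \<open>A \<subseteq> {..<p} - {a}\<close> and the covariance matrix is nonsingular.
\<close>

definition opt_pred ::
  "'w measure \<Rightarrow> nat \<Rightarrow> (nat \<Rightarrow> 'w \<Rightarrow> real) \<Rightarrow> nat \<Rightarrow> nat set \<Rightarrow> nat \<Rightarrow> real" where
  "opt_pred M p X a A =
     arg_min (\<lambda>\<theta>. integral\<^sup>L M (\<lambda>\<omega>. (X a \<omega> - (\<Sum>k<p. \<theta> k * X k \<omega>))\<^sup>2))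
       (\<lambda>\<theta>. \<forall>k. k \<notin> A \<longrightarrow> \<theta> k = 0)"

definition l1_norm :: "nat \<Rightarrow> (nat \<Rightarrow> real) \<Rightarrow> real" where
  "l1_norm p \<theta> = (\<Sum>k<p. \<bar>\<theta> k\<bar>)"

definition S_stat :: "'w measure \<Rightarrow> nat \<Rightarrow> (nat \<Rightarrow> 'w \<Rightarrow> real) \<Rightarrow> nat \<Rightarrow> nat \<Rightarrow> real" where
  "S_stat M p X a b =
     (\<Sum>k \<in> ne M p X a. sgn (opt_pred M p X a (ne M p X a) k) * opt_pred M p X b (ne M p X a) k)"

text \<open>\<open>D i k\<close> is the entry of the \<open>n \<times> p\<close> data matrix in row \<open>i\<close> and column \<open>k\<close>.\<close>

definition lasso_objective ::
  "nat \<Rightarrow> nat \<Rightarrow> (nat \<Rightarrow> nat \<Rightarrow> real) \<Rightarrow> nat \<Rightarrow> real \<Rightarrow> (nat \<Rightarrow> real) \<Rightarrow> real" where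
  "lasso_objective n p D a lam \<theta> =
     (\<Sum>i<n. (D i a - (\<Sum>k<p. D i k * \<theta> k))\<^sup>2) / real n + lam * l1_norm p \<theta>"

definition lasso_solution ::
  "nat \<Rightarrow> nat \<Rightarrow> (nat \<Rightarrow> nat \<Rightarrow> real) \<Rightarrow> nat \<Rightarrow> real \<Rightarrow> (nat \<Rightarrow> real) \<Rightarrow> bool" where
  "lasso_solution n p D a lam =
     is_arg_min (lasso_objective n p D a lam) (\<lambda>\<theta>. \<theta> a = 0 \<and> (\<forall>k\<ge>p. \<theta> k = 0))"

definition ne_hat :: "nat \<Rightarrow> (nat \<Rightarrow> real) \<Rightarrow> nat set" where
  "ne_hat p \<theta> = {b \<in> {..<p}. \<theta> b \<noteq> 0}"

end

theory Submission
  imports Defs "HOL-Real_Asymp.Real_Asymp"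
begin

text \<open>
  Fix a target node \<open>a\<close> with neighborhood \<open>J\<close>, and let \<open>\<theta>\<close> minimize the lasso
  objective among the coefficient vectors supported in \<open>J\<close>. By convexity \<open>\<theta>\<close> is a
  global minimizer, and every other lasso solution is supported in \<open>J\<close> too, once the residual
  \<open>R\<close> of \<open>\<theta>\<close> satisfies \<open>\<bar>2 \<langle>R, x\<^sub>b\<rangle> / n\<bar> < \<lambda>\<close> for the column \<open>x\<^sub>b\<close> of every node
  \<open>b\<close> outside \<open>J\<close> and \<open>a\<close> (\<open>dual_certificate\<close>). The proof shows that this holds outside
  an event of probability \<open>O (exp (- c n\<^sup>\<epsilon>))\<close>.

  For \<open>b\<close> outside \<open>J\<close>, split \<open>x\<^sub>b\<close> into its optimal prediction from the columns in \<open>J\<close> and a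
  residual \<open>V\<^sub>b\<close>. By stationarity of \<open>\<theta>\<close> on \<open>J\<close>, the prediction contributes
  \<open>\<lambda> S\<^sub>a(b)\<close>, which is at most \<open>\<delta>' \<lambda>\<close> with \<open>\<delta>' < 1\<close>, provided that each \<open>\<theta>\<^sub>k\<close> is nonzero
  and has the sign of the optimal coefficient \<open>\<alpha>\<^sub>k\<close>. The rest is \<open>2 \<langle>R, V\<^sub>b\<rangle> / n\<close>. Here \<open>R\<close>
  lies in the span of the columns in \<open>J\<close> and of \<open>x\<^sub>a\<close>, and \<open>V\<^sub>b\<close> is independent of these columns,
  so the inner product is small (\<open>score_off_neighborhood\<close>).

  For the signs, let \<open>b \<in> J\<close> and let \<open>W\<^sub>b\<close> be the residual of the optimal prediction of \<open>x\<^sub>b\<close> from the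
  columns in \<open>J - {b}\<close>. The bound \<open>T\<close> on the \<open>\<ell>\<^sub>1\<close> norm of its coefficients and stationarity give
  \<open>\<bar>\<langle>R, W\<^sub>b\<rangle>\<bar> \<le> (1 + T) \<lambda> n / 2\<close>. On the other hand \<open>R\<close> is \<open>(\<alpha>\<^sub>b - \<theta>\<^sub>b) W\<^sub>b\<close> plus terms that
  are nearly orthogonal to \<open>W\<^sub>b\<close>. As the squared length of \<open>W\<^sub>b\<close> is of order \<open>n\<close>, this gives
  \<open>\<bar>\<alpha>\<^sub>b - \<theta>\<^sub>b\<bar> = O (\<lambda>)\<close> (\<open>coefficient_deviation\<close>), which is below \<open>\<bar>\<alpha>\<^sub>b\<bar>\<close> because \<open>\<epsilon> < \<xi>\<close>.

  All near-orthogonality comes from one estimate. A vector of \<open>n\<close> independent standard normal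
  variables that is independent of \<open>q\<close> given columns has a projection onto their span whose squared
  length is chi-square with at most \<open>q\<close> degrees of freedom, so it exceeds \<open>\<eta>\<^sup>2\<close> with
  probability at most \<open>2\<^bsup>q/2\<^esup> exp (- \<eta>\<^sup>2 / 4)\<close> (\<open>projection_event\<close>). With \<open>\<eta>\<^sup>2\<close> a small
  multiple of \<open>n\<^sup>\<epsilon>\<close> and \<open>q = O (n\<^sup>\<kappa>)\<close>, where \<open>\<kappa> < \<epsilon>\<close>, this is \<open>exp (- c n\<^sup>\<epsilon>)\<close>, and it
  absorbs the polynomial number of nodes. The threshold \<open>\<eta> \<surd>n\<close> for inner products is of the order
  of \<open>\<lambda> n\<close>, which is why \<open>\<lambda>\<close> decays like \<open>n\<^bsup>-(1-\<epsilon>)/2\<^esup>\<close>.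

  The facts about Gaussian vectors all follow from the translation identity
  \<open>tilt_eq_shift\<close>: it yields the independence of uncorrelated linear functionals
  (\<open>row_independence\<close>), the identity of \<open>1 / K\<^sub>a\<^sub>a\<close> with the conditional variance, and the fact that
  conditional independence of \<open>X\<^sub>a\<close> and \<open>X\<^sub>b\<close> forces \<open>K\<^sub>a\<^sub>b = 0\<close>.
\<close>

section \<open>Bilinear forms and Gaussian vectors under translation\<close>

text \<open>
  Vectors are functions on \<open>nat\<close> of which the values below \<open>p\<close> matter. This keeps supports and
  restrictions to sets of nodes elementary, and a coefficient vector \<open>c\<close> can be read both as the linear
  functional \<open>lin p c\<close> and as an element of the space with inner product \<open>bil p S\<close>, where \<open>S\<close> is the
  covariance matrix: \<open>bil p S c d\<close> is the covariance of \<open>c \<bullet> X\<close> and \<open>d \<bullet> X\<close>, and \<open>mv p S c k\<close> is the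
  covariance of \<open>c \<bullet> X\<close> with \<open>X\<^sub>k\<close>.
\<close>

definition bil :: "nat \<Rightarrow> (nat \<Rightarrow> nat \<Rightarrow> real) \<Rightarrow> (nat \<Rightarrow> real) \<Rightarrow> (nat \<Rightarrow> real) \<Rightarrow> real" where
  "bil p A u v = (\<Sum>j<p. \<Sum>k<p. u j * A j k * v k)"

definition mv :: "nat \<Rightarrow> (nat \<Rightarrow> nat \<Rightarrow> real) \<Rightarrow> (nat \<Rightarrow> real) \<Rightarrow> nat \<Rightarrow> real" where
  "mv p A u j = (\<Sum>k<p. A j k * u k)"

definition lin :: "nat \<Rightarrow> (nat \<Rightarrow> real) \<Rightarrow> (nat \<Rightarrow> real) \<Rightarrow> real" where
  "lin p c x = (\<Sum>k<p. c k * x k)"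

definition unit_v :: "nat \<Rightarrow> nat \<Rightarrow> real" where
  "unit_v a k = (if k = a then 1 else 0)"

definition std_normal :: "real measure" where
  "std_normal = density lborel std_normal_density"

lemma bil_mv: "bil p A u v = (\<Sum>j<p. u j * mv p A v j)"
  by (simp add: bil_def mv_def sum_distrib_left mult.assoc)

lemma bil_cong: "(\<And>k. k < p \<Longrightarrow> u k = u' k) \<Longrightarrow> (\<And>k. k < p \<Longrightarrow> v k = v' k) \<Longrightarrow> bil p A u v = bil p A u' v'"
  by (simp add: bil_def)

lemma bil_add_left: "bil p A (\<lambda>k. u k + v k) w = bil p A u w + bil p A v w"
  by (simp add: bil_def algebra_simps sum.distrib)

lemma bil_diff_left: "bil p A (\<lambda>k. u k - v k) w = bil p A u w - bil p A v w"
  by (simp add: bil_def algebra_simps sum_subtractf)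

lemma bil_scale_left: "bil p A (\<lambda>k. r * u k) w = r * bil p A u w"
  by (simp add: bil_def algebra_simps sum_distrib_left)

lemma bil_add_right: "bil p A w (\<lambda>k. u k + v k) = bil p A w u + bil p A w v"
  by (simp add: bil_def algebra_simps sum.distrib)

lemma bil_diff_right: "bil p A w (\<lambda>k. u k - v k) = bil p A w u - bil p A w v"
  by (simp add: bil_def algebra_simps sum_subtractf)

lemma bil_scale_right: "bil p A w (\<lambda>k. r * u k) = r * bil p A w u"
  by (simp add: bil_def algebra_simps sum_distrib_left)

lemmas bil_linear = bil_add_left bil_diff_left bil_scale_left bil_add_right bil_diff_right bil_scale_right

lemma bil_unit_left: "a < p \<Longrightarrow> bil p A (unit_v a) v = mv p A v a"
  by (simp add: bil_mv unit_v_def if_distrib[of "\<lambda>x. x * _"] cong: if_cong)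

lemma mv_unit: "a < p \<Longrightarrow> mv p A (unit_v a) j = A j a"
  by (simp add: mv_def unit_v_def if_distrib[of "\<lambda>x. _ * x"] cong: if_cong)

lemma mv_diff: "mv p A (\<lambda>k. u k - v k) j = mv p A u j - mv p A v j"
  by (simp add: mv_def algebra_simps sum_subtractf)

lemma mv_scale: "mv p A (\<lambda>k. r * u k) j = r * mv p A u j"
  by (simp add: mv_def algebra_simps sum_distrib_left)

lemma lin_add: "lin p (\<lambda>k. u k + v k) x = lin p u x + lin p v x"
  by (simp add: lin_def algebra_simps sum.distrib)

lemma lin_diff: "lin p (\<lambda>k. u k - v k) x = lin p u x - lin p v x"
  by (simp add: lin_def algebra_simps sum_subtractf)

lemma lin_scale: "lin p (\<lambda>k. r * u k) x = r * lin p u x"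
  by (simp add: lin_def algebra_simps sum_distrib_left)

lemma lin_unit: "a < p \<Longrightarrow> lin p (unit_v a) x = x a"
  by (simp add: lin_def unit_v_def if_distrib[of "\<lambda>x. x * _"] cong: if_cong)

lemma lin_measurable [measurable]:
  "lin p c \<in> borel_measurable (\<Pi>\<^sub>M k\<in>{..<p}. borel)"
  unfolding lin_def by measurable

text \<open>
  By Fubini, translating one coordinate at a time.
\<close>

lemma nn_integral_PiM_lborel_translate:
  fixes h :: "'i \<Rightarrow> real"
  assumes "finite I" "f \<in> borel_measurable (\<Pi>\<^sub>M k\<in>I. lborel)"
  shows "(\<integral>\<^sup>+x. f (\<lambda>k\<in>I. x k + h k) \<partial>(\<Pi>\<^sub>M k\<in>I. lborel)) = (\<integral>\<^sup>+x. f x \<partial>(\<Pi>\<^sub>M k\<in>I. lborel))"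
  using assms
proof (induction I arbitrary: f rule: finite_induct)
  case empty
  then show ?case
    by (intro nn_integral_cong) (auto simp: space_PiM)
next
  case (insert i I)
  note insert.prems[measurable]
  interpret product_sigma_finite "\<lambda>_::'i. lborel :: real measure"
    by (simp add: product_sigma_finite_def sigma_finite_lborel)
  have upd: "(\<lambda>k\<in>insert i I. (x(i := y)) k + h k) = (\<lambda>k\<in>I. x k + h k)(i := y + h i)" for x y
    using insert.hyps(2) by (auto simp: fun_eq_iff)
  have meas1: "(\<lambda>x. f (\<lambda>k\<in>insert i I. x k + h k)) \<in> borel_measurable (\<Pi>\<^sub>M k\<in>insert i I. lborel)"
    by measurable
  have shift: "(\<integral>\<^sup>+y. f (x(i := y + h i)) \<partial>lborel) = (\<integral>\<^sup>+y. f (x(i := y)) \<partial>lborel)"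
    if x: "x \<in> space (\<Pi>\<^sub>M k\<in>I. lborel)" for x
  proof -
    have "(\<lambda>y. f (x(i := y))) \<in> borel_measurable lborel"
      using x by measurable
    then show ?thesis
      using nn_integral_real_affine[of "\<lambda>y. f (x(i := y))" 1 "h i"] by (simp add: add.commute)
  qed
  have "(\<integral>\<^sup>+x. f (\<lambda>k\<in>insert i I. x k + h k) \<partial>(\<Pi>\<^sub>M k\<in>insert i I. lborel)) =
      (\<integral>\<^sup>+x. (\<integral>\<^sup>+y. f ((\<lambda>k\<in>I. x k + h k)(i := y + h i)) \<partial>lborel) \<partial>(\<Pi>\<^sub>M k\<in>I. lborel))"
    by (subst product_nn_integral_insert[OF insert.hyps(1,2) meas1]) (simp only: upd)
  also have "\<dots> = (\<integral>\<^sup>+x. (\<integral>\<^sup>+y. f ((\<lambda>k\<in>I. x k + h k)(i := y)) \<partial>lborel) \<partial>(\<Pi>\<^sub>M k\<in>I. lborel))"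
    by (intro nn_integral_cong shift) (simp add: space_PiM)
  also have "\<dots> = (\<integral>\<^sup>+x. (\<integral>\<^sup>+y. f (x(i := y)) \<partial>lborel) \<partial>(\<Pi>\<^sub>M k\<in>I. lborel))"
    by (rule insert.IH) measurable
  also have "\<dots> = (\<integral>\<^sup>+x. f x \<partial>(\<Pi>\<^sub>M k\<in>insert i I. lborel))"
    by (subst product_nn_integral_insert[OF insert.hyps(1,2) insert.prems]) simp
  finally show ?case .
qed

text \<open>
  A covariance matrix \<open>S\<close> with inverse \<open>K\<close>. Both are entry functions, so that sums over subsets of
  the index set need no change of dimension.
\<close>

locale cov_matrix =
  fixes p :: nat and S K :: "nat \<Rightarrow> nat \<Rightarrow> real"
  assumes S_sym: "j < p \<Longrightarrow> k < p \<Longrightarrow> S j k = S k j"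
    and S_pos: "k < p \<Longrightarrow> u k \<noteq> 0 \<Longrightarrow> 0 < bil p S u u"
    and K_sym: "j < p \<Longrightarrow> k < p \<Longrightarrow> K j k = K k j"
    and SK: "j < p \<Longrightarrow> l < p \<Longrightarrow> (\<Sum>k<p. S j k * K k l) = (if j = l then 1 else 0)"
begin

lemma cov_sym: "bil p S u v = bil p S v u"
  unfolding bil_def by (subst sum.swap) (auto intro!: sum.cong simp: S_sym ac_simps)

lemma bilK_sym: "bil p K u v = bil p K v u"
  unfolding bil_def by (subst sum.swap) (auto intro!: sum.cong simp: K_sym ac_simps)

lemma cov_nonneg: "0 \<le> bil p S u u"
proof (cases "\<exists>k<p. u k \<noteq> 0")
  case True
  then show ?thesis using S_pos by (meson less_imp_le)
next
  case False
  then show ?thesis by (simp add: bil_def)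
qed

lemma mv_K_mv_S: "j < p \<Longrightarrow> mv p K (mv p S c) j = c j"
proof -
  assume j: "j < p"
  have "mv p K (mv p S c) j = (\<Sum>k<p. \<Sum>l<p. K j k * (S k l * c l))"
    by (simp add: mv_def sum_distrib_left)
  also have "\<dots> = (\<Sum>l<p. c l * (\<Sum>k<p. S l k * K k j))"
    by (subst sum.swap) (auto intro!: sum.cong simp: sum_distrib_left S_sym K_sym[of j] j ac_simps)
  also have "\<dots> = (\<Sum>l<p. if l = j then c l else 0)"
    by (intro sum.cong) (auto simp: SK j)
  also have "\<dots> = c j"
    using j by simp
  finally show ?thesis .
qed

lemma mv_S_K: "j < p \<Longrightarrow> a < p \<Longrightarrow> mv p S (\<lambda>k. K k a) j = unit_v a j"
  by (simp add: mv_def SK unit_v_def)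

text \<open>
  Column \<open>a\<close> of \<open>K\<close> represents evaluation at \<open>a\<close> in the inner product given by \<open>S\<close>. Hence
  \<open>(K e\<^sub>a) \<bullet> X\<close> is uncorrelated with every \<open>X\<^sub>j\<close> for \<open>j \<noteq> a\<close>; this is the residual of \<open>X\<^sub>a\<close> given
  all other variables, up to the factor \<open>K\<^sub>a\<^sub>a\<close>.
\<close>

lemma cov_K: "a < p \<Longrightarrow> bil p S u (\<lambda>k. K k a) = u a"
  by (simp add: bil_mv mv_S_K unit_v_def if_distrib[of "\<lambda>x. _ * x"] cong: if_cong)

lemma K_diag_pos: 
  assumes "a < p"
  shows "0 < K a a"
proof -
  have "\<exists>k<p. K k a \<noteq> 0"
  proof (rule ccontr)
    assume "\<not> ?thesis"
    then have "(\<Sum>k<p. S a k * K k a) = 0" by simp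
    then show False using SK[OF assms assms] by simp
  qed
  then obtain k where k: "k < p" "K k a \<noteq> 0" by auto
  from S_pos[of k "\<lambda>k. K k a", OF k] have "0 < bil p S (\<lambda>k. K k a) (\<lambda>k. K k a)" .
  then show ?thesis by (simp add: cov_K assms)
qed

lemma bilK_shift:
  "bil p K (\<lambda>k. x k - s * mv p S c k) (\<lambda>k. x k - s * mv p S c k) =
     bil p K x x - 2 * s * lin p c x + s\<^sup>2 * bil p S c c"
proof -
  have 1: "bil p K x (mv p S c) = lin p c x"
    by (simp add: bil_mv mv_K_mv_S lin_def mult.commute)
  have 2: "bil p K (mv p S c) (mv p S c) = bil p S c c"
    by (simp add: bil_mv mv_K_mv_S) (simp add: mult.commute)
  show ?thesis
    by (simp add: bil_linear 1 2 bilK_sym[of "mv p S c" x] power2_eq_square algebra_simps)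
qed

end

text \<open>
  The law of a centred Gaussian vector. The normalizing constant \<open>Z\<close> is left open, since comparing the density
  with its translates only involves the exponent.
\<close>

locale gauss_row = cov_matrix +
  fixes \<mu> :: "(nat \<Rightarrow> real) measure" and Z :: real
  assumes prob_row: "prob_space \<mu>"
    and sets_row [measurable_cong]: "sets \<mu> = sets (\<Pi>\<^sub>M k\<in>{..<p}. borel)"
    and dens_row: "f \<in> borel_measurable (\<Pi>\<^sub>M k\<in>{..<p}. borel) \<Longrightarrow>
      (\<integral>\<^sup>+x. f x \<partial>\<mu>) = (\<integral>\<^sup>+x. ennreal (exp (- bil p K x x / 2) / Z) * f x \<partial>(\<Pi>\<^sub>M k\<in>{..<p}. lborel))"
begin

sublocale row: prob_space \<mu> by (rule prob_row)

lemma space_row: "space \<mu> = space (\<Pi>\<^sub>M k\<in>{..<p}. borel)"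
  using sets_row by (rule sets_eq_imp_space_eq)

text \<open>
  The Cameron--Martin formula in finite dimension: as \<open>K S = 1\<close>, translating by \<open>s S c\<close> changes the exponent
  \<open>- x\<^sup>T K x / 2\<close> by \<open>s (c \<bullet> x) - s\<^sup>2 c\<^sup>T S c / 2\<close>, and Lebesgue measure is invariant. A
  function of coordinates that are uncorrelated with \<open>c \<bullet> x\<close> does not see the translation; this is how
  independence enters below.
\<close>

lemma tilt_eq_shift:
  assumes f [measurable]: "f \<in> borel_measurable (\<Pi>\<^sub>M k\<in>{..<p}. borel)"
  shows "(\<integral>\<^sup>+x. f x * ennreal (exp (s * lin p c x - s\<^sup>2 * bil p S c c / 2)) \<partial>\<mu>) =
    (\<integral>\<^sup>+x. f (\<lambda>k\<in>{..<p}. x k + s * mv p S c k) \<partial>\<mu>)"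
proof -
  have sets_eq [measurable_cong]:
    "sets (\<Pi>\<^sub>M k\<in>{..<p}. lborel) = sets (\<Pi>\<^sub>M k\<in>{..<p}. (borel :: real measure))"
    by (intro sets_PiM_cong) auto
  have bilK [measurable]: "(\<lambda>x. bil p K x x) \<in> borel_measurable (\<Pi>\<^sub>M k\<in>{..<p}. borel)"
    unfolding bil_def by measurable
  let ?h = "\<lambda>k. s * mv p S c k"
  let ?T = "\<lambda>x. \<lambda>k\<in>{..<p}. x k + ?h k"
  let ?g = "\<lambda>x. ennreal (exp (- bil p K x x / 2) / Z) * 
     (f x * ennreal (exp (s * lin p c x - s\<^sup>2 * bil p S c c / 2)))"
  have gT: "?g (?T x) = ennreal (exp (- bil p K x x / 2) / Z) * f (?T x)" for x
  proof -
    have "bil p K x x = bil p K (\<lambda>k. ?T x k - ?h k) (\<lambda>k. ?T x k - ?h k)"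
      by (rule bil_cong) auto
    also have "\<dots> = bil p K (?T x) (?T x) - 2 * s * lin p c (?T x) + s\<^sup>2 * bil p S c c"
      by (rule bilK_shift)
    finally have "exp (- bil p K x x / 2) = exp (- bil p K (?T x) (?T x) / 2) * 
        exp (s * lin p c (?T x) - s\<^sup>2 * bil p S c c / 2)"
      unfolding exp_add[symmetric] by (simp add: field_simps)
    then have "ennreal (exp (- bil p K x x / 2) / Z) =
        ennreal (exp (- bil p K (?T x) (?T x) / 2) / Z) * 
        ennreal (exp (s * lin p c (?T x) - s\<^sup>2 * bil p S c c / 2))"
      by (subst ennreal_mult''[symmetric]) (auto simp: field_simps)
    then show ?thesis by (simp add: ac_simps)
  qed
  have "(\<integral>\<^sup>+x. f x * ennreal (exp (s * lin p c x - s\<^sup>2 * bil p S c c / 2)) \<partial>\<mu>) =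
    (\<integral>\<^sup>+x. ?g x \<partial>(\<Pi>\<^sub>M k\<in>{..<p}. lborel))"
    by (rule dens_row) measurable
  also have "\<dots> = (\<integral>\<^sup>+x. ?g (?T x) \<partial>(\<Pi>\<^sub>M k\<in>{..<p}. lborel))"
    by (rule nn_integral_PiM_lborel_translate[symmetric]) (simp, measurable)
  also have "\<dots> = (\<integral>\<^sup>+x. f (?T x) \<partial>\<mu>)"
    unfolding gT by (rule dens_row[symmetric]) measurable
  finally show ?thesis .
qed

lemma lin_shift: "lin p c (\<lambda>k\<in>{..<p}. x k + s * mv p S c k) = lin p c x + s * bil p S c c"
  by (simp add: lin_def bil_mv algebra_simps sum.distrib sum_distrib_left)

end

lemma std_normal_shift_integral: "(\<integral>\<^sup>+s. ennreal (std_normal_density (w - s)) \<partial>lborel) = 1"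
proof -
  have "std_normal_density (w - s) = normal_density w 1 s" for s
    by (simp add: normal_density_def power2_commute)
  then show ?thesis
    using prob_space.emeasure_space_1[OF prob_space_normal_density[of 1 w]]
    by (simp add: emeasure_density)
qed

lemma sets_std_normal [measurable_cong]: "sets std_normal = sets borel"
  by (simp add: std_normal_def)

lemma prob_std_normal: "prob_space std_normal"
  unfolding std_normal_def by (rule prob_space_normal_density) simp

lemma nn_integral_std_normal:
  "f \<in> borel_measurable borel \<Longrightarrow>
    (\<integral>\<^sup>+s. f s \<partial>std_normal) = (\<integral>\<^sup>+s. ennreal (std_normal_density s) * f s \<partial>lborel)"
  unfolding std_normal_def by (subst nn_integral_density) auto

context gauss_row
begin

text \<open>
  A normalized functional \<open>c \<bullet> x\<close> is standard normal and independent of the coordinates in \<open>J\<close> that are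
  uncorrelated with it. Insert \<open>1 = \<integral> \<phi> (c \<bullet> x - s) ds\<close> for the standard normal density \<open>\<phi>\<close>. Since
  \<open>\<phi> (w - s) = \<phi> w exp (s w - s\<^sup>2 / 2)\<close>, the translation identity moves \<open>s\<close> into the argument of \<open>F\<close>,
  where only \<open>c \<bullet> x\<close> notices it, and a substitution in \<open>s\<close> decouples the two arguments of \<open>F\<close>.
\<close>

lemma row_independence:
  assumes F [measurable]: "(\<lambda>(s, x). F s x) \<in> borel_measurable (borel \<Otimes>\<^sub>M (\<Pi>\<^sub>M k\<in>{..<p}. borel))"
    and unit: "bil p S c c = 1"
    and orth: "\<And>k. k \<in> J \<Longrightarrow> k < p \<and> mv p S c k = 0"
    and dep: "\<And>s x y. (\<And>k. k \<in> J \<Longrightarrow> x k = y k) \<Longrightarrow> F s x = F s y"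
  shows "(\<integral>\<^sup>+x. F (lin p c x) x \<partial>\<mu>) = (\<integral>\<^sup>+s. (\<integral>\<^sup>+x. F s x \<partial>\<mu>) \<partial>std_normal)"
proof -
  let ?\<phi> = "\<lambda>s. ennreal (std_normal_density s)"
  let ?T = "\<lambda>s x. \<lambda>k\<in>{..<p}. x k + s * mv p S c k"
  interpret P: pair_sigma_finite lborel \<mu>
    by (simp add: pair_sigma_finite_def sigma_finite_lborel row.sigma_finite_measure_axioms)
  have [measurable]: "(\<lambda>s. (\<integral>\<^sup>+x. F s x \<partial>\<mu>)) \<in> borel_measurable borel"
    by measurable
  have Fm: "(\<lambda>x. F (lin p c x) x) \<in> borel_measurable (\<Pi>\<^sub>M k\<in>{..<p}. borel)"
    using measurable_compose[OF _ F, of "\<lambda>x. (lin p c x, x)" "\<Pi>\<^sub>M k\<in>{..<p}. borel"] by simp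
  note [measurable] = Fm
  \<comment> \<open>\<open>\<phi> (w - s)\<close> integrates to one in \<open>s\<close> as well, for every \<open>w\<close>\<close>
  have "(\<integral>\<^sup>+x. F (lin p c x) x \<partial>\<mu>) =
      (\<integral>\<^sup>+x. (\<integral>\<^sup>+s. F (lin p c x) x * ?\<phi> (lin p c x - s) \<partial>lborel) \<partial>\<mu>)"
    by (simp add: nn_integral_cmult std_normal_shift_integral)
  also have "\<dots> = (\<integral>\<^sup>+s. (\<integral>\<^sup>+x. F (lin p c x) x * ?\<phi> (lin p c x - s) \<partial>\<mu>) \<partial>lborel)"
    by (rule P.Fubini') measurable
  also have "\<dots> = (\<integral>\<^sup>+s. (\<integral>\<^sup>+x. F (lin p c x + s) x * ?\<phi> (lin p c x + s) \<partial>\<mu>) \<partial>lborel)"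
  proof (rule nn_integral_cong)
    fix s :: real
    have dep': "F r (?T s x) = F r x" for r x
      by (rule dep) (use orth in auto)
    have "?\<phi> (w - s) = ?\<phi> w * ennreal (exp (s * w - s\<^sup>2 * bil p S c c / 2))" for w
      by (subst ennreal_mult''[symmetric], simp) 
        (simp add: std_normal_density_def unit exp_add[symmetric] exp_diff[symmetric] power2_eq_square field_simps flip: exp_add)
    then have "(\<integral>\<^sup>+x. F (lin p c x) x * ?\<phi> (lin p c x - s) \<partial>\<mu>) =
       (\<integral>\<^sup>+x. (F (lin p c x) x * ?\<phi> (lin p c x)) * ennreal (exp (s * lin p c x - s\<^sup>2 * bil p S c c / 2)) \<partial>\<mu>)"
      by (simp add: ac_simps)
    also have "\<dots> = (\<integral>\<^sup>+x. F (lin p c (?T s x)) (?T s x) * ?\<phi> (lin p c (?T s x)) \<partial>\<mu>)"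
      by (rule tilt_eq_shift) measurable
    also have "\<dots> = (\<integral>\<^sup>+x. F (lin p c x + s) x * ?\<phi> (lin p c x + s) \<partial>\<mu>)"
      unfolding lin_shift unit by (simp add: dep')
    finally show "(\<integral>\<^sup>+x. F (lin p c x) x * ?\<phi> (lin p c x - s) \<partial>\<mu>) =
       (\<integral>\<^sup>+x. F (lin p c x + s) x * ?\<phi> (lin p c x + s) \<partial>\<mu>)" .
  qed
  also have "\<dots> = (\<integral>\<^sup>+x. (\<integral>\<^sup>+s. F (lin p c x + s) x * ?\<phi> (lin p c x + s) \<partial>lborel) \<partial>\<mu>)"
    by (rule P.Fubini'[symmetric]) measurable
  also have "\<dots> = (\<integral>\<^sup>+x. (\<integral>\<^sup>+s. F s x * ?\<phi> s \<partial>lborel) \<partial>\<mu>)"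
  proof (rule nn_integral_cong)
    fix x assume x: "x \<in> space \<mu>"
    have [measurable]: "(\<lambda>s. F s x) \<in> borel_measurable borel"
      using measurable_compose[OF measurable_Pair2'[OF x[unfolded space_row]] F] by simp
    have "(\<lambda>s. F s x * ?\<phi> s) \<in> borel_measurable borel"
      by (intro borel_measurable_times_ennreal) measurable
    then show "(\<integral>\<^sup>+s. F (lin p c x + s) x * ?\<phi> (lin p c x + s) \<partial>lborel) = (\<integral>\<^sup>+s. F s x * ?\<phi> s \<partial>lborel)"
      using nn_integral_real_affine[of "\<lambda>s. F s x * ?\<phi> s" 1 "lin p c x"] by simp
  qed
  also have "\<dots> = (\<integral>\<^sup>+s. (\<integral>\<^sup>+x. F s x * ?\<phi> s \<partial>\<mu>) \<partial>lborel)"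
    by (rule P.Fubini') measurable
  also have "\<dots> = (\<integral>\<^sup>+s. ?\<phi> s * (\<integral>\<^sup>+x. F s x \<partial>\<mu>) \<partial>lborel)"
  proof (rule nn_integral_cong)
    fix s :: real
    have "F s \<in> borel_measurable \<mu>" by measurable
    then show "(\<integral>\<^sup>+x. F s x * ?\<phi> s \<partial>\<mu>) = ?\<phi> s * (\<integral>\<^sup>+x. F s x \<partial>\<mu>)"
      by (subst nn_integral_multc) (auto simp: mult.commute)
  qed
  also have "\<dots> = (\<integral>\<^sup>+s. (\<integral>\<^sup>+x. F s x \<partial>\<mu>) \<partial>std_normal)"
    by (subst nn_integral_std_normal) simp_all
  finally show ?thesis .
qed

end

section \<open>Independence of the rows of a data matrix and a linear functional\<close>

context gauss_row
begin

abbreviation row_space :: "(nat \<Rightarrow> real) measure" where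
  "row_space \<equiv> (\<Pi>\<^sub>M k\<in>{..<p}. borel)"

text \<open>
  The preceding lemma applied to one row after the other. The values of \<open>c\<close> on the rows become a vector of
  independent standard normal variables, independent of all columns in \<open>J\<close>.
\<close>

lemma data_independence:
  fixes I :: "'i set"
  assumes "finite I"
    and F: "(\<lambda>(s, D). F s D) \<in> borel_measurable ((\<Pi>\<^sub>M i\<in>I. borel) \<Otimes>\<^sub>M (\<Pi>\<^sub>M i\<in>I. row_space))"
    and unit: "bil p S c c = 1"
    and orth: "\<And>k. k \<in> J \<Longrightarrow> k < p \<and> mv p S c k = 0"
    and dep: "\<And>s D D'. (\<And>i k. i \<in> I \<Longrightarrow> k \<in> J \<Longrightarrow> D i k = D' i k) \<Longrightarrow> F s D = F s D'"
  shows "(\<integral>\<^sup>+D. F (\<lambda>i\<in>I. lin p c (D i)) D \<partial>(\<Pi>\<^sub>M i\<in>I. \<mu>)) =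
    (\<integral>\<^sup>+s. (\<integral>\<^sup>+D. F s D \<partial>(\<Pi>\<^sub>M i\<in>I. \<mu>)) \<partial>(\<Pi>\<^sub>M i\<in>I. std_normal))"
  using assms(1,2,5)
proof (induction I arbitrary: F rule: finite_induct)
  case empty
  have eq: "F s = F (\<lambda>i. undefined)" if "s \<in> space (\<Pi>\<^sub>M i\<in>{}. std_normal)" for s
    using that by (simp add: space_PiM)
  interpret N0: prob_space "\<Pi>\<^sub>M i\<in>{}::'i set. std_normal"
    by (rule prob_space_PiM) (rule prob_std_normal)
  have "(\<integral>\<^sup>+s. (\<integral>\<^sup>+D. F s D \<partial>(\<Pi>\<^sub>M i\<in>{}. \<mu>)) \<partial>(\<Pi>\<^sub>M i\<in>{}::'i set. std_normal)) = 
    (\<integral>\<^sup>+s. (\<integral>\<^sup>+D. F (\<lambda>i. undefined) D \<partial>(\<Pi>\<^sub>M i\<in>{}. \<mu>)) \<partial>(\<Pi>\<^sub>M i\<in>{}::'i set. std_normal))"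
    by (rule nn_integral_cong) (simp only: eq)
  then show ?case
    by (simp add: restrict_def N0.emeasure_space_1)
next
  case (insert i I)
  note F = insert.prems(1)
  interpret MU: product_sigma_finite "\<lambda>_::'i. \<mu>"
    by (simp add: product_sigma_finite_def row.sigma_finite_measure_axioms)
  interpret N: product_sigma_finite "\<lambda>_::'i. std_normal"
    by (simp add: product_sigma_finite_def prob_std_normal prob_space_imp_sigma_finite)
  interpret MUI: sigma_finite_measure "\<Pi>\<^sub>M i\<in>I. \<mu>"
    by (rule MU.sigma_finite) fact
  interpret NI: sigma_finite_measure "\<Pi>\<^sub>M i\<in>I. std_normal"
    by (rule N.sigma_finite) fact
  interpret NM: pair_sigma_finite "\<Pi>\<^sub>M i\<in>I. std_normal" \<mu>
    by (simp add: pair_sigma_finite_def row.sigma_finite_measure_axioms NI.sigma_finite_measure_axioms)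
  have setsM [measurable_cong]: "sets (\<Pi>\<^sub>M i\<in>L. \<mu>) = sets (\<Pi>\<^sub>M i\<in>L. row_space)" for L :: "'i set"
    by (intro sets_PiM_cong) (simp_all add: sets_row)
  have setsN [measurable_cong]: "sets (\<Pi>\<^sub>M i\<in>L. std_normal) = sets (\<Pi>\<^sub>M i\<in>L. (borel :: real measure))" for L :: "'i set"
    by (intro sets_PiM_cong) (simp_all add: sets_std_normal)
  have Fm: "(\<lambda>x. F (f x) (g x)) \<in> borel_measurable A"
    if "f \<in> measurable A (\<Pi>\<^sub>M i\<in>insert i I. borel)" "g \<in> measurable A (\<Pi>\<^sub>M i\<in>insert i I. row_space)"
    for f g and A :: "'z measure"
    using measurable_compose[OF measurable_Pair[OF that] F] by simp
  let ?FI = "\<lambda>s r D x. F (s(i := r)) (D(i := x))"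
  have FIm: "(\<lambda>w. ?FI (fs w) (fr w) (fD w) (fx w)) \<in> borel_measurable A"
    if [measurable]: "fs \<in> measurable A (\<Pi>\<^sub>M i\<in>I. borel)" "fr \<in> measurable A borel"
      "fD \<in> measurable A (\<Pi>\<^sub>M i\<in>I. row_space)" "fx \<in> measurable A row_space"
    for fs fr fD fx and A :: "'z measure"
    by (rule Fm; measurable)
  have upd: "(\<lambda>j\<in>insert i I. lin p c ((D(i := x)) j)) = (\<lambda>j\<in>I. lin p c (D j))(i := lin p c x)" for D x
    using insert.hyps(2) by (auto simp: fun_eq_iff)
  have "(\<integral>\<^sup>+D. F (\<lambda>j\<in>insert i I. lin p c (D j)) D \<partial>(\<Pi>\<^sub>M i\<in>insert i I. \<mu>)) =
     (\<integral>\<^sup>+x. (\<integral>\<^sup>+D. ?FI (\<lambda>j\<in>I. lin p c (D j)) (lin p c x) D x \<partial>(\<Pi>\<^sub>M i\<in>I. \<mu>)) \<partial>\<mu>)"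
    by (subst MU.product_nn_integral_insert_rev[OF insert.hyps(1,2)])
       (rule Fm, measurable, simp only: upd)
  also have "\<dots> = (\<integral>\<^sup>+x. (\<integral>\<^sup>+s. (\<integral>\<^sup>+D. ?FI s (lin p c x) D x \<partial>(\<Pi>\<^sub>M i\<in>I. \<mu>)) \<partial>(\<Pi>\<^sub>M i\<in>I. std_normal)) \<partial>\<mu>)"
  proof (rule nn_integral_cong)
    fix x assume "x \<in> space \<mu>"
    then have x: "x \<in> space row_space" by (simp add: space_row)
    show "(\<integral>\<^sup>+D. ?FI (\<lambda>j\<in>I. lin p c (D j)) (lin p c x) D x \<partial>(\<Pi>\<^sub>M i\<in>I. \<mu>)) =
      (\<integral>\<^sup>+s. (\<integral>\<^sup>+D. ?FI s (lin p c x) D x \<partial>(\<Pi>\<^sub>M i\<in>I. \<mu>)) \<partial>(\<Pi>\<^sub>M i\<in>I. std_normal))"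
    proof (rule insert.IH)
      have "(\<lambda>w. ?FI (fst w) (lin p c x) (snd w) x) \<in> 
         borel_measurable ((\<Pi>\<^sub>M i\<in>I. borel) \<Otimes>\<^sub>M (\<Pi>\<^sub>M i\<in>I. row_space))"
        by (rule FIm) (use x in simp_all)
      then show "(\<lambda>(s, D). ?FI s (lin p c x) D x) \<in> 
         borel_measurable ((\<Pi>\<^sub>M i\<in>I. borel) \<Otimes>\<^sub>M (\<Pi>\<^sub>M i\<in>I. row_space))"
        by (simp add: case_prod_unfold)
      show "?FI s (lin p c x) D x = ?FI s (lin p c x) D' x"
        if "\<And>i k. i \<in> I \<Longrightarrow> k \<in> J \<Longrightarrow> D i k = D' i k" for s D D'
        by (rule insert.prems(2)) (use that in auto)
    qed
  qed
  also have "\<dots> = (\<integral>\<^sup>+s. (\<integral>\<^sup>+x. (\<integral>\<^sup>+D. ?FI s (lin p c x) D x \<partial>(\<Pi>\<^sub>M i\<in>I. \<mu>)) \<partial>\<mu>) \<partial>(\<Pi>\<^sub>M i\<in>I. std_normal))"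
  proof (rule NM.Fubini'[where f = "\<lambda>s x. \<integral>\<^sup>+D. ?FI s (lin p c x) D x \<partial>(\<Pi>\<^sub>M i\<in>I. \<mu>)"])
    have "(\<lambda>w. ?FI (fst (fst w)) (lin p c (snd (fst w))) (snd w) (snd (fst w)))
        \<in> borel_measurable (((\<Pi>\<^sub>M i\<in>I. borel) \<Otimes>\<^sub>M row_space) \<Otimes>\<^sub>M (\<Pi>\<^sub>M i\<in>I. row_space))"
      by (rule FIm) measurable
    then have "(\<lambda>(w, D). ?FI (fst w) (lin p c (snd w)) D (snd w))
        \<in> borel_measurable (((\<Pi>\<^sub>M i\<in>I. std_normal) \<Otimes>\<^sub>M \<mu>) \<Otimes>\<^sub>M (\<Pi>\<^sub>M i\<in>I. \<mu>))"
      by (simp add: case_prod_unfold cong: measurable_cong_sets sets_pair_measure_cong)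
        (measurable)
    then show "(\<lambda>(s, x). \<integral>\<^sup>+D. ?FI s (lin p c x) D x \<partial>(\<Pi>\<^sub>M i\<in>I. \<mu>)) \<in> borel_measurable ((\<Pi>\<^sub>M i\<in>I. std_normal) \<Otimes>\<^sub>M \<mu>)"
      using MUI.borel_measurable_nn_integral by (fastforce simp: case_prod_unfold)
  qed
  also have "\<dots> = (\<integral>\<^sup>+s. (\<integral>\<^sup>+r. (\<integral>\<^sup>+x. (\<integral>\<^sup>+D. ?FI s r D x \<partial>(\<Pi>\<^sub>M i\<in>I. \<mu>)) \<partial>\<mu>) \<partial>std_normal) \<partial>(\<Pi>\<^sub>M i\<in>I. std_normal))"
  proof (rule nn_integral_cong)
    fix s assume "s \<in> space (\<Pi>\<^sub>M i\<in>I. std_normal)"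
    then have s: "s \<in> space (\<Pi>\<^sub>M i\<in>I. borel)" by (simp add: space_PiM std_normal_def)
    show "(\<integral>\<^sup>+x. (\<integral>\<^sup>+D. ?FI s (lin p c x) D x \<partial>(\<Pi>\<^sub>M i\<in>I. \<mu>)) \<partial>\<mu>) =
      (\<integral>\<^sup>+r. (\<integral>\<^sup>+x. (\<integral>\<^sup>+D. ?FI s r D x \<partial>(\<Pi>\<^sub>M i\<in>I. \<mu>)) \<partial>\<mu>) \<partial>std_normal)"
    proof (rule row_independence[where F = "\<lambda>r x. \<integral>\<^sup>+D. ?FI s r D x \<partial>(\<Pi>\<^sub>M i\<in>I. \<mu>)", OF _ unit orth])
      have "(\<lambda>w. ?FI s (fst (fst w)) (snd w) (snd (fst w)))
          \<in> borel_measurable ((borel \<Otimes>\<^sub>M row_space) \<Otimes>\<^sub>M (\<Pi>\<^sub>M i\<in>I. row_space))"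
        by (rule FIm) (use s in \<open>simp_all\<close>)
      then have "(\<lambda>(w, D). ?FI s (fst w) D (snd w))
          \<in> borel_measurable ((borel \<Otimes>\<^sub>M row_space) \<Otimes>\<^sub>M (\<Pi>\<^sub>M i\<in>I. \<mu>))"
        by (simp add: case_prod_unfold) measurable
      then show "(\<lambda>(r, x). \<integral>\<^sup>+D. ?FI s r D x \<partial>(\<Pi>\<^sub>M i\<in>I. \<mu>)) \<in> borel_measurable (borel \<Otimes>\<^sub>M row_space)"
        using MUI.borel_measurable_nn_integral by (fastforce simp: case_prod_unfold)
      show "(\<integral>\<^sup>+D. ?FI s r D x \<partial>(\<Pi>\<^sub>M i\<in>I. \<mu>)) = (\<integral>\<^sup>+D. ?FI s r D y \<partial>(\<Pi>\<^sub>M i\<in>I. \<mu>))"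
        if "\<And>k. k \<in> J \<Longrightarrow> x k = y k" for r x y
        by (intro nn_integral_cong insert.prems(2)) (use that in auto)
    qed auto
  qed
  also have "\<dots> = (\<integral>\<^sup>+s. (\<integral>\<^sup>+r. (\<integral>\<^sup>+D. F (s(i := r)) D \<partial>(\<Pi>\<^sub>M i\<in>insert i I. \<mu>)) \<partial>std_normal) \<partial>(\<Pi>\<^sub>M i\<in>I. std_normal))"
  proof (rule nn_integral_cong, rule nn_integral_cong)
    fix s r assume "s \<in> space (\<Pi>\<^sub>M i\<in>I. std_normal)"
    then have s: "s \<in> space (\<Pi>\<^sub>M i\<in>I. borel)" by (simp add: space_PiM std_normal_def)
    have "(\<lambda>D. F (s(i := r)) D) \<in> borel_measurable (\<Pi>\<^sub>M i\<in>insert i I. \<mu>)"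
      by (rule Fm) (use s in \<open>auto simp: space_PiM PiE_def extensional_def\<close>)
    then show "(\<integral>\<^sup>+x. (\<integral>\<^sup>+D. ?FI s r D x \<partial>(\<Pi>\<^sub>M i\<in>I. \<mu>)) \<partial>\<mu>) = (\<integral>\<^sup>+D. F (s(i := r)) D \<partial>(\<Pi>\<^sub>M i\<in>insert i I. \<mu>))"
      by (subst MU.product_nn_integral_insert_rev[OF insert.hyps(1,2)]) auto
  qed
  also have "\<dots> = (\<integral>\<^sup>+s. (\<integral>\<^sup>+D. F s D \<partial>(\<Pi>\<^sub>M i\<in>insert i I. \<mu>)) \<partial>(\<Pi>\<^sub>M i\<in>insert i I. std_normal))"
  proof (rule N.product_nn_integral_insert[OF insert.hyps(1,2), symmetric])
    interpret MUiI: sigma_finite_measure "\<Pi>\<^sub>M i\<in>insert i I. \<mu>"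
      by (rule MU.sigma_finite) (use insert.hyps in simp)
    have "(\<lambda>w. F (fst w) (snd w)) \<in> borel_measurable ((\<Pi>\<^sub>M i\<in>insert i I. std_normal) \<Otimes>\<^sub>M (\<Pi>\<^sub>M i\<in>insert i I. \<mu>))"
      by (rule Fm) measurable
    then show "(\<lambda>s. \<integral>\<^sup>+D. F s D \<partial>(\<Pi>\<^sub>M i\<in>insert i I. \<mu>)) \<in> borel_measurable (\<Pi>\<^sub>M i\<in>insert i I. std_normal)"
      using MUiI.borel_measurable_nn_integral by (fastforce simp: case_prod_unfold)
  qed
  finally show ?case .
qed

end

section \<open>Self-normalized chi-square bounds\<close>

definition ip :: "nat \<Rightarrow> (nat \<Rightarrow> real) \<Rightarrow> (nat \<Rightarrow> real) \<Rightarrow> real" where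
  "ip n u v = (\<Sum>i<n. u i * v i)"

lemma ip_commute: "ip n u v = ip n v u"
  by (simp add: ip_def mult.commute)

lemma ip_add_left: "ip n (\<lambda>i. u i + v i) w = ip n u w + ip n v w"
  by (simp add: ip_def algebra_simps sum.distrib)

lemma ip_diff_left: "ip n (\<lambda>i. u i - v i) w = ip n u w - ip n v w"
  by (simp add: ip_def algebra_simps sum_subtractf)

lemma ip_scale_left: "ip n (\<lambda>i. r * u i) w = r * ip n u w"
  by (simp add: ip_def algebra_simps sum_distrib_left)

lemma ip_sum_left: "ip n (\<lambda>i. \<Sum>k\<in>A. f k i) w = (\<Sum>k\<in>A. ip n (f k) w)"
  by (simp add: ip_def sum_distrib_right) (rule sum.swap)

lemma ip_add_right: "ip n w (\<lambda>i. u i + v i) = ip n w u + ip n w v"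
  by (simp add: ip_def algebra_simps sum.distrib)

lemma ip_diff_right: "ip n w (\<lambda>i. u i - v i) = ip n w u - ip n w v"
  by (simp add: ip_def algebra_simps sum_subtractf)

lemma ip_scale_right: "ip n w (\<lambda>i. r * u i) = r * ip n w u"
  by (simp add: ip_def algebra_simps sum_distrib_left)

lemma ip_sum_right: "ip n w (\<lambda>i. \<Sum>k\<in>A. f k i) = (\<Sum>k\<in>A. ip n w (f k))"
  by (subst (1 2) ip_commute) (rule ip_sum_left)

lemmas ip_linear = ip_add_left ip_diff_left ip_scale_left ip_sum_left
  ip_add_right ip_diff_right ip_scale_right ip_sum_right

lemma ip_nonneg: "0 \<le> ip n u u"
  by (simp add: ip_def sum_nonneg)

lemma ip_self_eq_0: "ip n u u = 0 \<Longrightarrow> i < n \<Longrightarrow> u i = 0"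
  by (simp add: ip_def sum_nonneg_eq_0_iff)

lemma ip_cong: "(\<And>i. i < n \<Longrightarrow> u i = u' i) \<Longrightarrow> (\<And>i. i < n \<Longrightarrow> v i = v' i) \<Longrightarrow> ip n u v = ip n u' v'"
  by (simp add: ip_def)

lemma ip_Cauchy_Schwarz: "(ip n u v)\<^sup>2 \<le> ip n u u * ip n v v"
  using Cauchy_Schwarz_ineq_sum[of u v "{..<n}"] by (simp add: ip_def power2_eq_square)

text \<open>
  Gram--Schmidt, with an explicit expansion instead of a span, and with the number of basis vectors bounded by the
  number of given vectors; linear dependence among these is allowed.
\<close>

lemma orthonormal_basis_of_span:
  fixes z :: "nat \<Rightarrow> nat \<Rightarrow> real"
  assumes "finite J"
  shows "\<exists>r u. r \<le> card J \<and> (\<forall>i<r. \<forall>j<r. ip n (u i) (u j) = (if i = j then 1 else 0)) \<and>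
     (\<forall>k\<in>J. \<forall>t<n. z k t = (\<Sum>j<r. ip n (z k) (u j) * u j t))"
  using assms
proof (induction J rule: finite_induct)
  case empty
  show ?case by (intro exI[of _ 0]) simp
next
  case (insert k J)
  then obtain r u where r: "r \<le> card J"
    and on: "\<And>i j. i < r \<Longrightarrow> j < r \<Longrightarrow> ip n (u i) (u j) = (if i = j then 1 else 0)"
    and span: "\<And>k t. k \<in> J \<Longrightarrow> t < n \<Longrightarrow> z k t = (\<Sum>j<r. ip n (z k) (u j) * u j t)"
    by blast
  define q where "q = (\<lambda>t. \<Sum>j<r. ip n (z k) (u j) * u j t)"
  define y where "y = (\<lambda>t. z k t - q t)"
  have qu: "ip n q (u j) = ip n (z k) (u j)" if "j < r" for j
    unfolding q_def by (simp add: ip_linear on that if_distrib[of "\<lambda>x. _ * x"] cong: if_cong)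
  have yu: "ip n y (u j) = 0" if "j < r" for j
    by (simp add: y_def ip_linear qu that)
  have yq: "ip n y q = 0"
    unfolding q_def by (simp add: ip_linear yu)
  have zy: "ip n (z k) y = ip n y y"
    using yq by (subst (2) y_def) (simp add: ip_diff_left ip_commute[of _ q y])
  show ?case
  proof (cases "ip n y y = 0")
    case True
    then have "z k t = (\<Sum>j<r. ip n (z k) (u j) * u j t)" if "t < n" for t
      using ip_self_eq_0[OF True that] by (simp add: y_def q_def)
    then show ?thesis
      using r on span insert.hyps by (intro exI[of _ r] exI[of _ u]) auto
  next
    case nz: False
    define N where "N = sqrt (ip n y y)"
    have N: "0 < N" "N * N = ip n y y"
      using nz ip_nonneg[of n y] by (auto simp: N_def)
    define u' where "u' = u(r := (\<lambda>t. (1 / N) * y t))"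
    have u'_lt: "u' j = u j" if "j < r" for j
      using that by (simp add: u'_def)
    have u'_r: "u' r = (\<lambda>t. (1 / N) * y t)"
      by (simp add: u'_def)
    have u'u: "ip n (u' r) (u j) = 0" if "j < r" for j
      by (simp only: u'_r ip_scale_left yu[OF that] mult_zero_right)
    have on': "ip n (u' i) (u' j) = (if i = j then 1 else 0)" if ij: "i < Suc r" "j < Suc r" for i j
    proof -
      consider "i < r" "j < r" | "i = r" "j < r" | "i < r" "j = r" | "i = r" "j = r"
        using ij by linarith
      then show ?thesis
      proof cases
        case 4
        have "ip n y y / (N * N) = 1" using N nz by simp
        moreover have "ip n (u' r) (u' r) = (1 / N) * ((1 / N) * ip n y y)"
          by (simp only: u'_r ip_scale_left ip_scale_right)
        ultimately show ?thesis
          using 4 nz by simp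
      qed (auto simp: u'_lt on u'u ip_commute[of n _ "u' r"])
    qed
    have span': "z l t = (\<Sum>j<Suc r. ip n (z l) (u' j) * u' j t)" if l: "l \<in> insert k J" and t: "t < n" for l t
    proof (cases "l = k")
      case True
      have "ip n (z k) (u' r) * u' r t = ((1 / N) * ip n (z k) y) * ((1 / N) * y t)"
        by (simp only: u'_r ip_scale_right)
      also have "\<dots> = ip n y y / (N * N) * y t"
        by (simp add: zy)
      also have "\<dots> = y t" using N nz by simp
      finally show ?thesis
        using True by (simp add: u'_lt) (simp add: y_def q_def)
    next
      case False
      then have lJ: "l \<in> J" using l by simp
      have "ip n (z l) y = ip n (\<lambda>t. \<Sum>j<r. ip n (z l) (u j) * u j t) y"
        using span[OF lJ] by (intro ip_cong) auto
      also have "\<dots> = 0"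
        by (simp add: ip_sum_left ip_scale_left ip_commute[of n _ y] yu)
      finally have "ip n (z l) (u' r) = 0"
        by (simp only: u'_r ip_scale_right mult_zero_right)
      then show ?thesis
        using span[OF lJ t] by (simp add: u'_lt)
    qed
    show ?thesis
      using r on' span' insert.hyps by (intro exI[of _ "Suc r"] exI[of _ u']) auto
  qed
qed

lemma nn_integral_exp_std_normal:
  "(\<integral>\<^sup>+s. ennreal (exp (a * s)) \<partial>std_normal) = ennreal (exp (a\<^sup>2 / 2))"
proof -
  have "ennreal (std_normal_density s) * ennreal (exp (a * s)) =
      ennreal (exp (a\<^sup>2 / 2)) * ennreal (std_normal_density (a - s))" for s
    by (subst (1 2) ennreal_mult''[symmetric], simp, simp)
      (simp add: std_normal_density_def power2_eq_square field_simps flip: exp_add)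
  then show ?thesis
    by (simp add: nn_integral_std_normal nn_integral_cmult std_normal_shift_integral)
qed

lemma nn_integral_exp_square_std_normal:
  assumes "t < 1 / 2"
  shows "(\<integral>\<^sup>+s. ennreal (exp (t * s\<^sup>2)) \<partial>std_normal) = ennreal (1 / sqrt (1 - 2 * t))"
proof -
  define \<sigma> where "\<sigma> = 1 / sqrt (1 - 2 * t)"
  have \<sigma>: "0 < \<sigma>" "\<sigma>\<^sup>2 = 1 / (1 - 2 * t)"
    using assms by (simp_all add: \<sigma>_def power_divide)
  have "ennreal (std_normal_density s) * ennreal (exp (t * s\<^sup>2)) =
      ennreal \<sigma> * ennreal (normal_density 0 \<sigma> s)" for s
  proof -
    have "sqrt (2 * pi * \<sigma>\<^sup>2) = sqrt (2 * pi) * \<sigma>"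
      using \<sigma>(1) by (simp add: real_sqrt_mult)
    moreover have "- s\<^sup>2 / (2 * \<sigma>\<^sup>2) = - s\<^sup>2 / 2 + t * s\<^sup>2"
      unfolding \<sigma>(2) using assms by (simp add: field_simps)
    ultimately have "std_normal_density s * exp (t * s\<^sup>2) = \<sigma> * normal_density 0 \<sigma> s"
      using \<sigma>(1) by (simp add: normal_density_def mult_exp_exp)
    then show ?thesis
      using \<sigma>(1) by (simp flip: ennreal_mult'')
  qed
  then have "(\<integral>\<^sup>+s. ennreal (exp (t * s\<^sup>2)) \<partial>std_normal) =
      ennreal \<sigma> * (\<integral>\<^sup>+s. ennreal (normal_density 0 \<sigma> s) \<partial>lborel)"
    by (simp add: nn_integral_std_normal nn_integral_cmult)
  also have "(\<integral>\<^sup>+s. ennreal (normal_density 0 \<sigma> s) \<partial>lborel) = 1"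
    using prob_space.emeasure_space_1[OF prob_space_normal_density[OF \<sigma>(1), of 0]]
    by (simp add: emeasure_density)
  finally show ?thesis by (simp add: \<sigma>_def)
qed

abbreviation std_normal_vec :: "nat \<Rightarrow> (nat \<Rightarrow> real) measure" where
  "std_normal_vec n \<equiv> (\<Pi>\<^sub>M i\<in>{..<n}. std_normal)"

lemma sets_std_normal_vec [measurable_cong]:
  "sets (std_normal_vec n) = sets (\<Pi>\<^sub>M i\<in>{..<n}. borel)"
  by (intro sets_PiM_cong) (simp_all add: sets_std_normal)

lemma product_std_normal: "product_sigma_finite (\<lambda>_::'i. std_normal)"
  by (simp add: product_sigma_finite_def prob_std_normal prob_space_imp_sigma_finite)

lemma prob_std_normal_vec: "prob_space (std_normal_vec n)"
  by (rule prob_space_PiM) (rule prob_std_normal)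

lemma nn_integral_prod_std_normal:
  assumes "\<And>i. i < n \<Longrightarrow> f i \<in> borel_measurable borel" "\<And>i s. i < n \<Longrightarrow> 0 \<le> f i s"
  shows "(\<integral>\<^sup>+s. ennreal (\<Prod>i<n. f i (s i)) \<partial>std_normal_vec n) = (\<Prod>i<n. \<integral>\<^sup>+s. ennreal (f i s) \<partial>std_normal)"
proof -
  have "(\<integral>\<^sup>+s. (\<Prod>i<n. ennreal (f i (s i))) \<partial>std_normal_vec n) = (\<Prod>i<n. \<integral>\<^sup>+s. ennreal (f i s) \<partial>std_normal)"
    by (rule product_sigma_finite.product_nn_integral_prod[OF product_std_normal])
      (use assms(1) in \<open>auto intro!: measurable_compose[OF _ measurable_ennreal] simp: measurable_cong_sets[OF sets_std_normal refl]\<close>)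
  then show ?thesis
    by (subst prod_ennreal[symmetric]) (use assms(2) in auto)
qed

lemma nn_integral_exp_norm2_std_normal_vec:
  assumes "t < 1 / 2"
  shows "(\<integral>\<^sup>+s. ennreal (exp (t * ip n s s)) \<partial>std_normal_vec n) = ennreal ((1 / sqrt (1 - 2 * t)) ^ n)"
proof -
  have "exp (t * ip n s s) = (\<Prod>i<n. exp (t * (s i)\<^sup>2))" for s
    by (simp add: ip_def sum_distrib_left exp_sum power2_eq_square)
  then show ?thesis
    using nn_integral_prod_std_normal[of n "\<lambda>_ s. exp (t * s\<^sup>2)"]
      nn_integral_exp_square_std_normal[OF assms] assms
    by (simp add: ennreal_power)
qed

lemma nn_integral_exp_ip_std_normal_vec:
  "(\<integral>\<^sup>+s. ennreal (exp (ip n a s)) \<partial>std_normal_vec n) = ennreal (exp (ip n a a / 2))"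
proof -
  have "exp (ip n a s) = (\<Prod>i<n. exp (a i * s i))" for s
    by (simp add: ip_def exp_sum)
  moreover have "(\<Prod>i<n. ennreal (exp ((a i)\<^sup>2 / 2))) = ennreal (exp (ip n a a / 2))"
    by (subst prod_ennreal) (simp_all add: ip_def exp_sum[symmetric] sum_divide_distrib power2_eq_square)
  ultimately show ?thesis
    using nn_integral_prod_std_normal[of n "\<lambda>i s. exp (a i * s)"]
    by (simp add: nn_integral_exp_std_normal)
qed

text \<open>
  The exponential moment of a chi-square variable with \<open>r\<close> degrees of freedom, without rotating the Gaussian
  vector: write \<open>exp (x\<^sup>2 / 4)\<close> as the expectation of \<open>exp (g x / \<surd>2)\<close> over an independent standard normal
  \<open>g\<close>, once for each basis vector. The exponent is then linear in \<open>s\<close>, and integrating \<open>s\<close> out first leaves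
  \<open>exp (\<bar>g\<bar>\<^sup>2 / 4)\<close> by orthonormality.
\<close>

lemma chi_square_projection_mgf:
  assumes on: "\<And>i j. i < r \<Longrightarrow> j < r \<Longrightarrow> ip n (u i) (u j) = (if i = j then 1 else 0)"
  shows "(\<integral>\<^sup>+s. ennreal (exp ((\<Sum>j<r. (ip n (u j) s)\<^sup>2) / 4)) \<partial>std_normal_vec n) = ennreal (sqrt 2 ^ r)"
proof -
  interpret P: pair_sigma_finite "std_normal_vec n" "std_normal_vec r"
    by (simp add: pair_sigma_finite_def prob_std_normal_vec prob_space_imp_sigma_finite)
  let ?b = "\<lambda>s j. ip n (u j) s / sqrt 2"
  let ?a = "\<lambda>g i. (\<Sum>j<r. g j * u j i) / sqrt 2"
  \<comment> \<open>the double integral is the same Gaussian moment read in two ways\<close>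
  have swap: "ip r (?b s) g = ip n (?a g) s" for s g
    unfolding ip_def by (simp add: sum_divide_distrib sum_distrib_right sum_distrib_left)
      (subst sum.swap, simp add: ac_simps)
  have norm_a: "ip n (?a g) (?a g) / 2 = ip r g g / 4" for g
  proof -
    have "ip n (?a g) (?a g) = ip n (\<lambda>i. (1 / sqrt 2) * (\<Sum>j<r. g j * u j i)) (\<lambda>i. (1 / sqrt 2) * (\<Sum>j<r. g j * u j i))"
      by simp
    also have "\<dots> = ip n (\<lambda>i. \<Sum>j<r. g j * u j i) (\<lambda>i. \<Sum>j<r. g j * u j i) / 2"
      by (simp only: ip_scale_left ip_scale_right) simp
    also have "ip n (\<lambda>i. \<Sum>j<r. g j * u j i) (\<lambda>i. \<Sum>j<r. g j * u j i) = ip r g g"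
      by (simp add: ip_sum_left ip_sum_right ip_scale_left ip_scale_right on
          if_distrib[of "\<lambda>x. _ * x"] cong: if_cong) (simp add: ip_def)
    finally show ?thesis by simp
  qed
  have norm_b: "ip r (?b s) (?b s) / 2 = (\<Sum>j<r. (ip n (u j) s)\<^sup>2) / 4" for s
    by (simp add: ip_def[of r] sum_divide_distrib power2_eq_square)
  have [measurable]: "(\<lambda>(s, g). ennreal (exp (ip r (?b s) g))) \<in> 
      borel_measurable (std_normal_vec n \<Otimes>\<^sub>M std_normal_vec r)"
    unfolding ip_def by measurable
  have "(\<integral>\<^sup>+s. ennreal (exp ((\<Sum>j<r. (ip n (u j) s)\<^sup>2) / 4)) \<partial>std_normal_vec n) =
    (\<integral>\<^sup>+s. (\<integral>\<^sup>+g. ennreal (exp (ip r (?b s) g)) \<partial>std_normal_vec r) \<partial>std_normal_vec n)"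
    by (simp only: nn_integral_exp_ip_std_normal_vec norm_b)
  also have "\<dots> = (\<integral>\<^sup>+g. (\<integral>\<^sup>+s. ennreal (exp (ip r (?b s) g)) \<partial>std_normal_vec n) \<partial>std_normal_vec r)"
    by (rule P.Fubini'[symmetric]) measurable
  also have "\<dots> = (\<integral>\<^sup>+g. ennreal (exp (1 / 4 * ip r g g)) \<partial>std_normal_vec r)"
    by (simp only: swap nn_integral_exp_ip_std_normal_vec norm_a) simp
  also have "\<dots> = ennreal ((1 / sqrt (1 - 2 * (1 / 4))) ^ r)"
    by (rule nn_integral_exp_norm2_std_normal_vec) simp
  also have "1 / sqrt (1 - 2 * (1 / 4)) = sqrt 2"
    by (simp add: real_sqrt_divide)
  finally show ?thesis .
qed

definition comb :: "nat set \<Rightarrow> (nat \<Rightarrow> nat \<Rightarrow> real) \<Rightarrow> (nat \<Rightarrow> real) \<Rightarrow> nat \<Rightarrow> real" where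
  "comb A D \<gamma> i = (\<Sum>k\<in>A. \<gamma> k * D i k)"

text \<open>
  Equivalently, the projection of \<open>w\<close> onto the span of the columns of \<open>D\<close> in \<open>A\<close> has length at most \<open>\<eta>\<close>.
  Quantifying over the combinations of columns avoids choosing a basis that depends measurably on \<open>D\<close>.
\<close>

definition nearly_orthogonal :: "nat \<Rightarrow> real \<Rightarrow> nat set \<Rightarrow> (nat \<Rightarrow> nat \<Rightarrow> real) \<Rightarrow> (nat \<Rightarrow> real) \<Rightarrow> bool" where
  "nearly_orthogonal n \<eta> A D w \<longleftrightarrow>
     (\<forall>\<gamma>. (ip n w (comb A D \<gamma>))\<^sup>2 \<le> \<eta>\<^sup>2 * ip n (comb A D \<gamma>) (comb A D \<gamma>))"

text \<open>
  For a fixed design, Cauchy--Schwarz in an orthonormal basis bounds every normalized inner product by the length of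
  the projection, and Markov's inequality applies to its exponential moment. The bound depends on the design
  only through the number of columns, so it survives integration over a random design.
\<close>

lemma self_normalized_fixed_design:
  fixes D :: "nat \<Rightarrow> nat \<Rightarrow> real"
  assumes "finite J"
  defines "y \<equiv> comb J D"
  shows "(\<integral>\<^sup>+s. indicator {s. \<exists>\<theta>\<in>T. \<eta>\<^sup>2 * ip n (y \<theta>) (y \<theta>) < (ip n s (y \<theta>))\<^sup>2} s \<partial>std_normal_vec n)
     \<le> ennreal (sqrt 2 ^ card J * exp (- \<eta>\<^sup>2 / 4))"
proof -
  obtain r u where r: "r \<le> card J"
    and on: "\<And>i j. i < r \<Longrightarrow> j < r \<Longrightarrow> ip n (u i) (u j) = (if i = j then 1 else 0)"
    and span: "\<And>k t. k \<in> J \<Longrightarrow> t < n \<Longrightarrow> D t k = (\<Sum>j<r. ip n (\<lambda>i. D i k) (u j) * u j t)"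
    using orthonormal_basis_of_span[OF assms(1), of n "\<lambda>k i. D i k"] by blast
  let ?Q = "\<lambda>s. \<Sum>j<r. (ip n (u j) s)\<^sup>2"
  have bound: "(ip n s (y \<theta>))\<^sup>2 \<le> ip n (y \<theta>) (y \<theta>) * ?Q s" for s \<theta>
  proof -
    define a where "a j = ip n (y \<theta>) (u j)" for j
    have ya: "y \<theta> i = (\<Sum>j<r. a j * u j i)" if "i < n" for i
      unfolding y_def a_def comb_def[abs_def] ip_sum_left ip_scale_left
      by (simp add: span that sum_distrib_left sum_distrib_right mult.assoc) (rule sum.swap)
    have 1: "ip n s (y \<theta>) = ip r a (\<lambda>j. ip n (u j) s)"
    proof -
      have "ip n s (y \<theta>) = ip n s (\<lambda>i. \<Sum>j<r. a j * u j i)"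
        by (intro ip_cong) (auto simp: ya)
      then show ?thesis
        by (simp add: ip_sum_right ip_scale_right ip_commute[of n s]) (simp add: ip_def[of r])
    qed
    have 2: "ip n (y \<theta>) (y \<theta>) = ip r a a"
    proof -
      have "ip n (y \<theta>) (y \<theta>) = ip n (y \<theta>) (\<lambda>i. \<Sum>j<r. a j * u j i)"
        by (intro ip_cong) (auto simp: ya)
      then show ?thesis
        by (simp add: ip_sum_right ip_scale_right) (simp add: ip_def[of r] a_def)
    qed
    show ?thesis
      using ip_Cauchy_Schwarz[of r a "\<lambda>j. ip n (u j) s"] unfolding 1 2
      by (simp add: ip_def[of r "\<lambda>j. ip n (u j) s"] power2_eq_square)
  qed
  have [measurable]: "(\<lambda>s. ennreal (exp (?Q s / 4))) \<in> borel_measurable (std_normal_vec n)"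
    unfolding ip_def by measurable
  have "(\<integral>\<^sup>+s. indicator {s. \<exists>\<theta>\<in>T. \<eta>\<^sup>2 * ip n (y \<theta>) (y \<theta>) < (ip n s (y \<theta>))\<^sup>2} s \<partial>std_normal_vec n) \<le>
     (\<integral>\<^sup>+s. ennreal (exp (- \<eta>\<^sup>2 / 4)) * ennreal (exp (?Q s / 4)) \<partial>std_normal_vec n)"
  proof (rule nn_integral_mono)
    fix s
    have "1 \<le> exp (- \<eta>\<^sup>2 / 4) * exp (?Q s / 4)" 
      if "\<eta>\<^sup>2 * ip n (y \<theta>) (y \<theta>) < (ip n s (y \<theta>))\<^sup>2" for \<theta>
    proof -
      have "ip n (y \<theta>) (y \<theta>) * \<eta>\<^sup>2 < ip n (y \<theta>) (y \<theta>) * ?Q s"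
        using that bound[of s \<theta>] by (simp add: mult.commute)
      then have "\<eta>\<^sup>2 < ?Q s"
        using ip_nonneg[of n "y \<theta>"] by (simp add: mult_less_cancel_left)
      then show ?thesis by (simp flip: exp_add)
    qed
    then show "indicator {s. \<exists>\<theta>\<in>T. \<eta>\<^sup>2 * ip n (y \<theta>) (y \<theta>) < (ip n s (y \<theta>))\<^sup>2} s \<le>
       ennreal (exp (- \<eta>\<^sup>2 / 4)) * ennreal (exp (?Q s / 4))"
      by (auto simp: indicator_def ennreal_mult''[symmetric] simp flip: ennreal_1 intro!: ennreal_leI)
  qed
  also have "\<dots> = ennreal (exp (- \<eta>\<^sup>2 / 4)) * ennreal (sqrt 2 ^ r)"
    by (subst nn_integral_cmult, measurable) (simp only: chi_square_projection_mgf[of r n u, OF on])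
  also have "\<dots> \<le> ennreal (sqrt 2 ^ card J * exp (- \<eta>\<^sup>2 / 4))"
    using power_increasing[OF r, of "sqrt 2"]
    by (subst ennreal_mult''[symmetric]) (auto intro!: ennreal_leI simp: mult.commute)
  finally show ?thesis .
qed

section \<open>Exceptional events for a Gaussian data matrix\<close>

text \<open>
  A countable dense set of coefficients. It turns the condition \<open>nearly_orthogonal\<close>, which quantifies over
  all coefficients, into a countable intersection, so that its failure is an event.
\<close>

lemma countable_test_set_for_le:
  "\<exists>T :: (nat \<Rightarrow> real) set. countable T \<and>
    (\<forall>f g :: (nat \<Rightarrow> real) \<Rightarrow> real. continuous_on UNIV f \<longrightarrow> continuous_on UNIV g \<longrightarrow>
      (\<forall>\<theta>\<in>T. f \<theta> \<le> g \<theta>) \<longrightarrow> (\<forall>\<theta>. f \<theta> \<le> g \<theta>))"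
proof -
  obtain T :: "(nat \<Rightarrow> real) set" where T: "countable T" "\<And>X. open X \<Longrightarrow> X \<noteq> {} \<Longrightarrow> \<exists>d\<in>T. d \<in> X"
    using countable_dense_exists by blast
  have "f \<theta> \<le> g \<theta>" if "continuous_on UNIV f" "continuous_on UNIV g" "\<forall>\<theta>\<in>T. f \<theta> \<le> g \<theta>"
    for f g :: "(nat \<Rightarrow> real) \<Rightarrow> real" and \<theta>
  proof (rule ccontr)
    assume "\<not> f \<theta> \<le> g \<theta>"
    then have "{\<theta>. g \<theta> < f \<theta>} \<noteq> {}"
      by (auto simp: not_le)
    from T(2)[OF open_Collect_less[OF that(2,1)] this] that(3) show False
      by (auto simp: not_le[symmetric])
  qed
  with T(1) show ?thesis by blast
qed

context gauss_row
begin

abbreviation data :: "nat \<Rightarrow> (nat \<Rightarrow> nat \<Rightarrow> real) measure" where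
  "data n \<equiv> (\<Pi>\<^sub>M i\<in>{..<n}. \<mu>)"

abbreviation data_space :: "nat \<Rightarrow> (nat \<Rightarrow> nat \<Rightarrow> real) measure" where
  "data_space n \<equiv> (\<Pi>\<^sub>M i\<in>{..<n}. row_space)"

abbreviation pair_space :: "nat \<Rightarrow> ((nat \<Rightarrow> real) \<times> (nat \<Rightarrow> nat \<Rightarrow> real)) measure" where
  "pair_space n \<equiv> (\<Pi>\<^sub>M i\<in>{..<n}. borel) \<Otimes>\<^sub>M data_space n"

lemma sets_data [measurable_cong]: "sets (data n) = sets (data_space n)"
  by (intro sets_PiM_cong) (simp_all add: sets_row)

lemma prob_data: "prob_space (data n)"
  by (rule prob_space_PiM) (rule prob_row)

lemma normalize_lin:
  assumes "0 < bil p S c c"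
  defines "c' \<equiv> \<lambda>k. (1 / sqrt (bil p S c c)) * c k"
  shows "bil p S c' c' = 1" "\<And>k. mv p S c k = 0 \<Longrightarrow> mv p S c' k = 0"
    "\<And>x. lin p c x = sqrt (bil p S c c) * lin p c' x"
  unfolding c'_def bil_scale_left bil_scale_right mv_scale lin_scale
  using assms by (simp_all add: field_simps)

text \<open>
  Bounding a probability conditionally on the columns in \<open>J\<close>: it suffices to estimate the integral over fresh
  standard normal entries for each fixed data matrix.
\<close>

lemma emeasure_data_le:
  assumes F: "(\<lambda>(s, D). F s D) \<in> borel_measurable (pair_space n)"
    and unit: "bil p S c c = 1"
    and orth: "\<And>k. k \<in> J \<Longrightarrow> k < p \<and> mv p S c k = 0"
    and dep: "\<And>s D D'. (\<And>i k. i < n \<Longrightarrow> k \<in> J \<Longrightarrow> D i k = D' i k) \<Longrightarrow> F s D = F s D'"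
    and bound: "\<And>D. (\<integral>\<^sup>+s. F s D \<partial>std_normal_vec n) \<le> C"
    and B: "B \<in> sets (data n)"
      "\<And>D. D \<in> B \<Longrightarrow> 1 \<le> F (\<lambda>i\<in>{..<n}. lin p c (D i)) D"
  shows "emeasure (data n) B \<le> C"
proof -
  interpret D: prob_space "data n" by (rule prob_data)
  interpret P: pair_sigma_finite "std_normal_vec n" "data n"
    by (simp add: pair_sigma_finite_def prob_std_normal_vec prob_space_imp_sigma_finite D.sigma_finite_measure_axioms)
  have F': "(\<lambda>(s, D). F s D) \<in> borel_measurable (std_normal_vec n \<Otimes>\<^sub>M data n)"
    using F by (simp cong: measurable_cong_sets sets_pair_measure_cong add: sets_data sets_std_normal_vec)
  have "emeasure (data n) B = (\<integral>\<^sup>+D. indicator B D \<partial>data n)"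
    using B(1) by simp
  also have "\<dots> \<le> (\<integral>\<^sup>+D. F (\<lambda>i\<in>{..<n}. lin p c (D i)) D \<partial>data n)"
    by (rule nn_integral_mono) (use B(2) in \<open>auto simp: indicator_def\<close>)
  also have "\<dots> = (\<integral>\<^sup>+s. (\<integral>\<^sup>+D. F s D \<partial>data n) \<partial>std_normal_vec n)"
    by (rule data_independence[OF _ F unit orth dep]) auto
  also have "\<dots> = (\<integral>\<^sup>+D. (\<integral>\<^sup>+s. F s D \<partial>std_normal_vec n) \<partial>data n)"
    by (rule P.Fubini'[OF F', symmetric])
  also have "\<dots> \<le> (\<integral>\<^sup>+D. C \<partial>data n)"
    by (rule nn_integral_mono) (rule bound)
  also have "\<dots> = C" by (simp add: D.emeasure_space_1)
  finally show ?thesis .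
qed

text \<open>
  The values of \<open>c\<close> on the rows, where \<open>c\<close> is uncorrelated with the coordinates in \<open>J\<close>, are nearly orthogonal to
  the span of these columns. The functional has variance at most \<open>1\<close>, and normalizing it to
  variance \<open>1\<close> only enlarges the inner products.
\<close>

lemma projection_event:
  assumes J: "J \<subseteq> {..<p}" and orth: "\<And>k. k \<in> J \<Longrightarrow> mv p S c k = 0"
    and pos: "0 < bil p S c c" and le1: "bil p S c c \<le> 1"
  shows "\<exists>B\<in>sets (data n). emeasure (data n) B \<le> ennreal (sqrt 2 ^ card J * exp (- \<eta>\<^sup>2 / 4)) \<and>
    (\<forall>D\<in>space (data n) - B. nearly_orthogonal n \<eta> J D (\<lambda>i. lin p c (D i)))"
proof -
  from countable_test_set_for_le obtain T :: "(nat \<Rightarrow> real) set" where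
    T': "countable T \<and> (\<forall>f g :: (nat \<Rightarrow> real) \<Rightarrow> real. continuous_on UNIV f \<longrightarrow> continuous_on UNIV g \<longrightarrow>
      (\<forall>\<theta>\<in>T. f \<theta> \<le> g \<theta>) \<longrightarrow> (\<forall>\<theta>. f \<theta> \<le> g \<theta>))" ..
  have T: "countable T" using T' by (rule conjunct1)
  have dense_le: "f \<theta>' \<le> g \<theta>'" if "continuous_on UNIV f" "continuous_on UNIV g" "\<And>\<theta>. \<theta> \<in> T \<Longrightarrow> f \<theta> \<le> g \<theta>"
    for f g :: "(nat \<Rightarrow> real) \<Rightarrow> real" and \<theta>'
    using conjunct2[OF T', rule_format, of f g \<theta>'] that by simp
  have finJ: "finite J" using J finite_subset by blast
  define Bad where "Bad s D \<longleftrightarrow> (\<exists>\<theta>\<in>T. \<eta>\<^sup>2 * ip n (comb J D \<theta>) (comb J D \<theta>) < (ip n s (comb J D \<theta>))\<^sup>2)" for s D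
  define c' where "c' = (\<lambda>k. (1 / sqrt (bil p S c c)) * c k)"
  note c' = normalize_lin[OF pos, folded c'_def]
  have comp [measurable]: "(\<lambda>D. D i k) \<in> borel_measurable (data_space n)" if "i < n" "k \<in> J" for i k
    by (rule measurable_compose[OF measurable_component_singleton[of i] measurable_component_singleton]) (use that J in auto)
  have [measurable]: "Measurable.pred (pair_space n) (\<lambda>w. Bad (fst w) (snd w))"
  proof -
    have m1: "(\<lambda>w. snd w i k) \<in> borel_measurable (pair_space n)"
      if "i < n" "k \<in> J" for i k
      by (rule measurable_compose[OF measurable_snd comp[OF that]])
    have m2: "(\<lambda>w. fst w i) \<in> borel_measurable (pair_space n)"
      if "i < n" for i
      by (rule measurable_compose[OF measurable_fst measurable_component_singleton]) (use that in auto)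
    have [measurable]: "(\<lambda>w. ip n (comb J (snd w) \<theta>) (comb J (snd w) \<theta>)) \<in> borel_measurable (pair_space n)" for \<theta>
      unfolding ip_def comb_def
      by (intro borel_measurable_sum borel_measurable_times borel_measurable_const m1) auto
    have [measurable]: "(\<lambda>w. ip n (fst w) (comb J (snd w) \<theta>)) \<in> borel_measurable (pair_space n)" for \<theta>
      unfolding ip_def comb_def
      by (intro borel_measurable_sum borel_measurable_times borel_measurable_const m1 m2) auto
    show ?thesis
      unfolding Bad_def using T by measurable
  qed
  have ipr: "ip n (\<lambda>i\<in>{..<n}. f i) v = ip n f v" for f v
    by (rule ip_cong) auto
  define B where "B = {D \<in> space (data n). Bad (\<lambda>i\<in>{..<n}. lin p c (D i)) D}"
  have "Measurable.pred (data_space n) (\<lambda>D. Bad (\<lambda>i\<in>{..<n}. lin p c (D i)) D)"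
  proof -
    have "(\<lambda>D. (\<lambda>i\<in>{..<n}. lin p c (D i), D)) \<in> measurable (data_space n) (pair_space n)"
      by measurable
    from measurable_compose[OF this, of "\<lambda>w. Bad (fst w) (snd w)" "count_space UNIV"]
    show ?thesis by simp
  qed
  then have Bsets: "B \<in> sets (data n)"
    unfolding B_def by (simp cong: measurable_cong_sets add: pred_def sets_data sets_eq_imp_space_eq[OF sets_data])
  have "emeasure (data n) B \<le> ennreal (sqrt 2 ^ card J * exp (- \<eta>\<^sup>2 / 4))"
  proof (rule emeasure_data_le[where F = "\<lambda>s D. indicator {s. Bad s D} s" and c = c' and J = J])
    have "(\<lambda>w. if Bad (fst w) (snd w) then 1 else 0 :: ennreal) \<in> borel_measurable (pair_space n)"
      by measurable
    then show "(\<lambda>(s, D). indicator {s. Bad s D} s :: ennreal) \<in> borel_measurable (pair_space n)"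
      by (simp add: case_prod_unfold indicator_def)
    show "bil p S c' c' = 1" by (rule c')
    show "k < p \<and> mv p S c' k = 0" if "k \<in> J" for k
      using c'(2)[OF orth[OF that]] that J by auto
    show "indicator {s. Bad s D} s = (indicator {s. Bad s D'} s :: ennreal)"
      if eq: "\<And>i k. i < n \<Longrightarrow> k \<in> J \<Longrightarrow> D i k = D' i k" for s D D'
    proof -
      have "comb J D \<theta> i = comb J D' \<theta> i" if "i < n" for \<theta> i
        unfolding comb_def using eq that by (intro sum.cong) auto
      then have "ip n s (comb J D \<theta>) = ip n s (comb J D' \<theta>)" "ip n (comb J D \<theta>) (comb J D \<theta>) = ip n (comb J D' \<theta>) (comb J D' \<theta>)" for \<theta>
        by (auto intro!: ip_cong)
      then show ?thesis by (simp add: Bad_def indicator_def)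
    qed
    show "(\<integral>\<^sup>+s. indicator {s. Bad s D} s \<partial>std_normal_vec n) \<le> ennreal (sqrt 2 ^ card J * exp (- \<eta>\<^sup>2 / 4))" for D
      using self_normalized_fixed_design[OF finJ, where D = D and T = T and \<eta> = \<eta> and n = n]
      unfolding Bad_def .
    show "B \<in> sets (data n)" by fact
    show "1 \<le> (indicator {s. Bad s D} (\<lambda>i\<in>{..<n}. lin p c' (D i)) :: ennreal)" if DB: "D \<in> B" for D
    proof -
      obtain \<theta> where \<theta>: "\<theta> \<in> T" "\<eta>\<^sup>2 * ip n (comb J D \<theta>) (comb J D \<theta>) < (ip n (\<lambda>i. lin p c (D i)) (comb J D \<theta>))\<^sup>2"
        using DB unfolding B_def Bad_def ipr by auto
      have "(ip n (\<lambda>i. lin p c (D i)) (comb J D \<theta>))\<^sup>2 = bil p S c c * (ip n (\<lambda>i. lin p c' (D i)) (comb J D \<theta>))\<^sup>2"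
        using pos by (simp only: c'(3) ip_scale_left) (simp add: power_mult_distrib)
      also have "\<dots> \<le> (ip n (\<lambda>i. lin p c' (D i)) (comb J D \<theta>))\<^sup>2"
        using le1 pos by (intro mult_left_le_one_le) auto
      finally have "Bad (\<lambda>i\<in>{..<n}. lin p c' (D i)) D"
        using \<theta> unfolding Bad_def ipr by force
      then show ?thesis by simp
    qed
  qed
  moreover have "(ip n (\<lambda>i. lin p c (D i)) (comb J D \<theta>))\<^sup>2 \<le> \<eta>\<^sup>2 * ip n (comb J D \<theta>) (comb J D \<theta>)" if D: "D \<in> space (data n) - B" for D \<theta>
  proof (rule dense_le[of "\<lambda>\<theta>. (ip n (\<lambda>i. lin p c (D i)) (comb J D \<theta>))\<^sup>2" "\<lambda>\<theta>. \<eta>\<^sup>2 * ip n (comb J D \<theta>) (comb J D \<theta>)"])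
    show "continuous_on UNIV (\<lambda>\<theta>. (ip n (\<lambda>i. lin p c (D i)) (comb J D \<theta>))\<^sup>2)"
      unfolding ip_def comb_def by (intro continuous_intros continuous_on_product_coordinates)
    show "continuous_on UNIV (\<lambda>\<theta>. \<eta>\<^sup>2 * ip n (comb J D \<theta>) (comb J D \<theta>))"
      unfolding ip_def comb_def by (intro continuous_intros continuous_on_product_coordinates)
    show "(ip n (\<lambda>i. lin p c (D i)) (comb J D \<theta>))\<^sup>2 \<le> \<eta>\<^sup>2 * ip n (comb J D \<theta>) (comb J D \<theta>)" if "\<theta> \<in> T" for \<theta>
      using D that unfolding B_def Bad_def ipr by (auto simp: not_less)
  qed
  ultimately show ?thesis
    using Bsets unfolding nearly_orthogonal_def by blast
qed

text \<open>
  Chernoff bounds with \<open>E exp (t \<chi>\<^sup>2) = (1 - 2 t)\<^bsup>-1/2\<^esup>\<close> at \<open>t = 1/4\<close> for the upper tail and at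
  \<open>t = - 1\<close> for the lower one. Both give the rate \<open>1/8\<close> because \<open>2 \<le> exp (3/4) \<le> 3\<close>.
\<close>

lemma norm_events:
  assumes pos: "0 < bil p S c c" and le1: "bil p S c c \<le> 1"
  shows "\<exists>B\<in>sets (data n). emeasure (data n) B \<le> ennreal (exp (- real n / 8)) \<and>
    (\<forall>D\<in>space (data n) - B. ip n (\<lambda>i. lin p c (D i)) (\<lambda>i. lin p c (D i)) \<le> 2 * n)"
    (is ?upper)
    and "\<exists>B\<in>sets (data n). emeasure (data n) B \<le> ennreal (exp (- real n / 8)) \<and>
    (\<forall>D\<in>space (data n) - B. bil p S c c * n / 4 \<le> ip n (\<lambda>i. lin p c (D i)) (\<lambda>i. lin p c (D i)))"
    (is ?lower)
proof -
  define c' where "c' = (\<lambda>k. (1 / sqrt (bil p S c c)) * c k)"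
  note c' = normalize_lin[OF pos, folded c'_def]
  have ipr: "ip n (\<lambda>i\<in>{..<n}. f i) (\<lambda>i\<in>{..<n}. f i) = ip n f f" for f
    by (rule ip_cong) auto
  let ?N = "\<lambda>D. ip n (\<lambda>i. lin p c' (D i)) (\<lambda>i. lin p c' (D i))"
  have N: "ip n (\<lambda>i. lin p c (D i)) (\<lambda>i. lin p c (D i)) = bil p S c c * ?N D" for D
    using pos by (simp only: c'(3) ip_scale_left ip_scale_right) simp
  have [measurable]: "?N \<in> borel_measurable (data n)"
    unfolding ip_def by measurable
  have tail: "emeasure (data n) {D \<in> space (data n). 0 \<le> t * (?N D - r)} \<le> ennreal (exp (- t * r) * (1 / sqrt (1 - 2 * t)) ^ n)"
    if t: "t < 1 / 2" for t r
  proof (rule emeasure_data_le[where F = "\<lambda>s D. ennreal (exp (t * (ip n s s - r)))" and c = c' and J = "{}"])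
    show "(\<lambda>(s, D). ennreal (exp (t * (ip n s s - r)))) \<in> borel_measurable (pair_space n)"
      unfolding ip_def by measurable
    show "(\<integral>\<^sup>+s. ennreal (exp (t * (ip n s s - r))) \<partial>std_normal_vec n) \<le> ennreal (exp (- t * r) * (1 / sqrt (1 - 2 * t)) ^ n)"
    proof -
      have "exp (t * (ip n s s - r)) = exp (- t * r) * exp (t * ip n s s)" for s
        by (simp add: right_diff_distrib mult_exp_exp)
      then have "(\<integral>\<^sup>+s. ennreal (exp (t * (ip n s s - r))) \<partial>std_normal_vec n) = 
          ennreal (exp (- t * r)) * (\<integral>\<^sup>+s. ennreal (exp (t * ip n s s)) \<partial>std_normal_vec n)"
        by (subst nn_integral_cmult[symmetric]) (simp_all add: ennreal_mult'' ip_def)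
      then show ?thesis
        using t by (simp add: nn_integral_exp_norm2_std_normal_vec[OF t] ennreal_mult'')
    qed
    show "{D \<in> space (data n). 0 \<le> t * (?N D - r)} \<in> sets (data n)"
      by measurable
    show "1 \<le> ennreal (exp (t * (ip n (\<lambda>i\<in>{..<n}. lin p c' (D i)) (\<lambda>i\<in>{..<n}. lin p c' (D i)) - r)))"
      if "D \<in> {D \<in> space (data n). 0 \<le> t * (?N D - r)}" for D
      using that unfolding ipr by (simp flip: ennreal_1) 
  qed (use c' in auto)
  \<comment> \<open>numerical bounds that turn both tails into the rate one eighth\<close>
  have e34: "2 \<le> exp (3 / 4 :: real)" "exp (3 / 4 :: real) \<le> 3"
    using exp_lower_Taylor_quadratic[of "3/4 :: real"] exp_bound[of "3/4 :: real"] 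
    by (simp_all add: power2_eq_square)
  have e38: "sqrt 2 \<le> exp (3 / 8 :: real)" "exp (3 / 8 :: real) \<le> sqrt 3"
  proof -
    have "(exp (3 / 8 :: real))\<^sup>2 = exp (3 / 4)"
      by (simp add: power2_eq_square mult_exp_exp)
    then show "sqrt 2 \<le> exp (3 / 8 :: real)" "exp (3 / 8 :: real) \<le> sqrt 3"
      using e34 by (auto intro!: real_le_lsqrt real_le_rsqrt)
  qed
  show ?upper
  proof (intro bexI conjI ballI)
    let ?B = "{D \<in> space (data n). 0 \<le> 1 / 4 * (?N D - 2 * n)}"
    show "?B \<in> sets (data n)" by measurable
    have "1 / sqrt (1 - 2 * (1 / 4)) = sqrt 2" 
      by (simp add: real_sqrt_divide)
    then have "exp (- (1 / 4) * (2 * real n)) * (1 / sqrt (1 - 2 * (1 / 4))) ^ n = exp (- real n / 2) * sqrt 2 ^ n"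
      by simp
    also have "\<dots> \<le> exp (- real n / 2) * exp (3 / 8) ^ n"
      by (intro mult_left_mono power_mono e38) auto
    also have "\<dots> = exp (- real n / 8)"
      by (simp add: exp_of_nat_mult[symmetric] mult_exp_exp)
    finally show "emeasure (data n) ?B \<le> ennreal (exp (- real n / 8))"
      by (intro order_trans[OF tail[of "1 / 4" "2 * n"] ennreal_leI]) simp_all
    fix D assume "D \<in> space (data n) - ?B"
    then have "?N D \<le> 2 * n" by auto
    then have "bil p S c c * ?N D \<le> 1 * (2 * real n)"
      using le1 pos by (intro mult_mono) (auto simp: ip_nonneg)
    then show "ip n (\<lambda>i. lin p c (D i)) (\<lambda>i. lin p c (D i)) \<le> 2 * n"
      unfolding N by simp
  qed
  show ?lower
  proof (intro bexI conjI ballI)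
    let ?B = "{D \<in> space (data n). 0 \<le> - 1 * (?N D - n / 4)}"
    show "?B \<in> sets (data n)" by measurable
    have "exp (- (- 1) * (real n / 4)) * (1 / sqrt (1 - 2 * (- 1))) ^ n = exp (real n / 4) * (1 / sqrt 3) ^ n"
      by simp
    also have "\<dots> \<le> exp (real n / 4) * (exp (- 3 / 8)) ^ n"
    proof -
      have "1 / sqrt 3 \<le> 1 / exp (3 / 8)"
        using e38 by (intro divide_left_mono) auto
      also have "\<dots> = exp (- 3 / 8)" by (simp add: exp_minus inverse_eq_divide)
      finally show ?thesis by (intro mult_left_mono power_mono) auto
    qed
    also have "\<dots> = exp (- real n / 8)"
      by (simp add: exp_of_nat_mult[symmetric] mult_exp_exp)
    finally show "emeasure (data n) ?B \<le> ennreal (exp (- real n / 8))"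
      by (intro order_trans[OF tail[of "- 1" "n / 4"] ennreal_leI]) simp_all
    fix D assume "D \<in> space (data n) - ?B"
    then have "n / 4 \<le> ?N D" by auto
    then have "bil p S c c * (n / 4) \<le> bil p S c c * ?N D"
      using pos by (intro mult_left_mono) auto
    then show "bil p S c c * n / 4 \<le> ip n (\<lambda>i. lin p c (D i)) (\<lambda>i. lin p c (D i))"
      unfolding N by simp
  qed
qed

end

section \<open>Optimal prediction for a Gaussian vector\<close>

context cov_matrix
begin

lemma cov_unit_diag: "a < p \<Longrightarrow> bil p S (unit_v a) (unit_v a) = S a a"
  by (simp add: bil_unit_left mv_unit)

lemma cov_supported_0:
  assumes "A \<subseteq> {..<p}" "\<And>k. k \<notin> A \<Longrightarrow> u k = 0" "\<And>k. k \<in> A \<Longrightarrow> mv p S v k = 0"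
  shows "bil p S u v = 0"
  unfolding bil_mv using assms(2,3) by (intro sum.neutral) (metis mult_eq_0_iff)

lemma cov_eq_0D: "bil p S u u = 0 \<Longrightarrow> k < p \<Longrightarrow> u k = 0"
  using S_pos[of k u] by auto

text \<open>
  Orthogonal projection onto the coordinates in \<open>A\<close>, in the inner product given by \<open>S\<close>. Adding a node \<open>j\<close>
  corrects the projection by a multiple of the residual \<open>r\<close> of \<open>j\<close>, which has positive length as its entry at \<open>j\<close>
  is \<open>1\<close>.
\<close>

lemma normal_equations_solvable:
  assumes "finite A" "A \<subseteq> {..<p}"
  shows "\<exists>\<theta>. (\<forall>k. k \<notin> A \<longrightarrow> \<theta> k = 0) \<and> (\<forall>j\<in>A. mv p S (\<lambda>k. c k - \<theta> k) j = 0)"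
  using assms
proof (induction A arbitrary: c rule: finite_induct)
  case empty
  show ?case by (intro exI[of _ "\<lambda>_. 0"]) simp
next
  case (insert j A)
  then have jp: "j < p" and A: "A \<subseteq> {..<p}" by auto
  obtain \<theta>j where \<theta>j: "\<And>k. k \<notin> A \<Longrightarrow> \<theta>j k = 0" "\<And>i. i \<in> A \<Longrightarrow> mv p S (\<lambda>k. unit_v j k - \<theta>j k) i = 0"
    using insert.IH[OF A, of "unit_v j"] by blast
  obtain \<theta>c where \<theta>c: "\<And>k. k \<notin> A \<Longrightarrow> \<theta>c k = 0" "\<And>i. i \<in> A \<Longrightarrow> mv p S (\<lambda>k. c k - \<theta>c k) i = 0"
    using insert.IH[OF A, of c] by blast
  define r where "r = (\<lambda>k. unit_v j k - \<theta>j k)"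
  have "r j = 1" using \<theta>j(1)[OF insert.hyps(2)] by (simp add: r_def unit_v_def)
  then have rr: "0 < bil p S r r" using S_pos[OF jp, of r] by simp
  have "mv p S r j = bil p S (unit_v j) r"
    using jp by (simp add: bil_unit_left)
  also have "\<dots> = bil p S r r + bil p S \<theta>j r"
    unfolding bil_add_left[symmetric] by (rule bil_cong) (simp_all add: r_def)
  also have "bil p S \<theta>j r = 0"
    by (rule cov_supported_0[OF A \<theta>j(1)]) (simp_all add: \<theta>j(2) r_def)
  finally have rj: "mv p S r j = bil p S r r" by simp
  define \<alpha> where "\<alpha> = mv p S (\<lambda>k. c k - \<theta>c k) j / bil p S r r"
  have mv: "mv p S (\<lambda>k. c k - (\<theta>c k + \<alpha> * r k)) i = mv p S (\<lambda>k. c k - \<theta>c k) i - \<alpha> * mv p S r i" for i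
  proof -
    have "mv p S (\<lambda>k. c k - (\<theta>c k + \<alpha> * r k)) i = mv p S (\<lambda>k. (c k - \<theta>c k) - \<alpha> * r k) i"
      by (simp add: algebra_simps)
    then show ?thesis by (simp only: mv_diff mv_scale)
  qed
  show ?case
  proof (intro exI[of _ "\<lambda>k. \<theta>c k + \<alpha> * r k"] conjI allI impI ballI)
    fix k assume "k \<notin> insert j A"
    then show "\<theta>c k + \<alpha> * r k = 0"
      using \<theta>c(1) \<theta>j(1) by (simp add: r_def unit_v_def)
  next
    fix i assume i: "i \<in> insert j A"
    show "mv p S (\<lambda>k. c k - (\<theta>c k + \<alpha> * r k)) i = 0"
    proof (cases "i = j")
      case True
      then show ?thesis using rr by (simp only: mv) (simp add: rj \<alpha>_def)
    next
      case False
      then show ?thesis using i \<theta>c(2) \<theta>j(2) by (simp add: mv) (simp add: r_def)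
    qed
  qed
qed

lemma residual_cov_pythagoras:
  assumes "A \<subseteq> {..<p}" "\<And>k. k \<notin> A \<Longrightarrow> \<theta> k = 0" "\<And>j. j \<in> A \<Longrightarrow> mv p S (\<lambda>k. c k - \<theta> k) j = 0"
    "\<And>k. k \<notin> A \<Longrightarrow> \<theta>' k = 0"
  shows "bil p S (\<lambda>k. c k - \<theta>' k) (\<lambda>k. c k - \<theta>' k) =
     bil p S (\<lambda>k. c k - \<theta> k) (\<lambda>k. c k - \<theta> k) + bil p S (\<lambda>k. \<theta> k - \<theta>' k) (\<lambda>k. \<theta> k - \<theta>' k)"
proof -
  have 0: "bil p S (\<lambda>k. \<theta> k - \<theta>' k) (\<lambda>k. c k - \<theta> k) = 0"
    by (rule cov_supported_0[OF assms(1)]) (use assms(2-4) in auto)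
  have "bil p S (\<lambda>k. c k - \<theta>' k) (\<lambda>k. c k - \<theta>' k) =
     bil p S (\<lambda>k. (c k - \<theta> k) + (\<theta> k - \<theta>' k)) (\<lambda>k. (c k - \<theta> k) + (\<theta> k - \<theta>' k))"
    by simp
  also have "\<dots> = bil p S (\<lambda>k. c k - \<theta> k) (\<lambda>k. c k - \<theta> k) + bil p S (\<lambda>k. \<theta> k - \<theta>' k) (\<lambda>k. \<theta> k - \<theta>' k)"
    using 0 cov_sym[of "\<lambda>k. c k - \<theta> k" "\<lambda>k. \<theta> k - \<theta>' k"]
    by (simp only: bil_add_left bil_add_right)
  finally show ?thesis .
qed

text \<open>
  \<open>1 / K\<^sub>b\<^sub>b\<close> is the least variance of a functional with coefficient \<open>1\<close> at \<open>b\<close>: subtract from \<open>c\<close> its projection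
  onto column \<open>b\<close> of \<open>K\<close>.
\<close>

lemma cov_ge_inverse_K:
  assumes "b < p" "c b = 1"
  shows "1 / K b b \<le> bil p S c c"
proof -
  have K: "0 < K b b" by (rule K_diag_pos) fact
  let ?k = "\<lambda>k. K k b"
  have "0 \<le> bil p S (\<lambda>k. c k - (1 / K b b) * ?k k) (\<lambda>k. c k - (1 / K b b) * ?k k)"
    by (rule cov_nonneg)
  also have "\<dots> = bil p S c c - 2 * (1 / K b b) * bil p S c ?k + (1 / K b b)\<^sup>2 * bil p S ?k ?k"
    by (simp only: bil_linear cov_sym[of ?k c]) (simp add: power2_eq_square algebra_simps)
  also have "\<dots> = bil p S c c - 1 / K b b"
    using K assms by (simp add: cov_K power2_eq_square field_simps)
  finally show ?thesis by simp
qed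

end

locale gauss_vec = prob_space M for M :: "'w measure" +
  fixes p :: nat and X :: "nat \<Rightarrow> 'w \<Rightarrow> real" and Sg :: "real mat"
  assumes normal: "normal_vec M p X Sg"
begin

abbreviation cov :: "nat \<Rightarrow> nat \<Rightarrow> real" where "cov j k \<equiv> Sg $$ (j, k)"
abbreviation prec :: "nat \<Rightarrow> nat \<Rightarrow> real" where "prec j k \<equiv> precision Sg $$ (j, k)"
abbreviation law :: "(nat \<Rightarrow> real) measure" where
  "law \<equiv> distr M (\<Pi>\<^sub>M k\<in>{..<p}. borel) (rvec {..<p} X)"

lemma Sg_carrier: "Sg \<in> carrier_mat p p" 
  and Sg_transpose: "transpose_mat Sg = Sg"
  and Sg_pos: "v \<in> carrier_vec p \<Longrightarrow> v \<noteq> 0\<^sub>v p \<Longrightarrow> 0 < scalar_prod v (mult_mat_vec Sg v)"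
  and Sg_distributed: "distributed M (\<Pi>\<^sub>M k\<in>{..<p}. lborel) (rvec {..<p} X) (\<lambda>x. ennreal (normal_vec_density p Sg x))"
  using normal unfolding normal_vec_def by blast+

lemma precision_inverse:
  "precision Sg \<in> carrier_mat p p" "Sg * precision Sg = 1\<^sub>m p" "precision Sg * Sg = 1\<^sub>m p"
proof -
  have "Determinant.det Sg \<noteq> 0"
  proof
    assume "Determinant.det Sg = 0"
    then obtain v where v: "v \<in> carrier_vec p" "v \<noteq> 0\<^sub>v p" "Sg *\<^sub>v v = 0\<^sub>v p"
      using det_0_iff_vec_prod_zero_field[OF Sg_carrier] by blast
    from Sg_pos[OF v(1,2)] v show False by simp
  qed
  then have "Sg \<in> Units (ring_mat TYPE(real) p ())"
    by (rule det_non_zero_imp_unit[OF Sg_carrier])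
  then have "mat_inverse Sg \<noteq> None"
    using mat_inverse(1)[OF Sg_carrier, where b = "()"] by blast
  then obtain B where "mat_inverse Sg = Some B"
    by blast
  then show "precision Sg \<in> carrier_mat p p" "Sg * precision Sg = 1\<^sub>m p" "precision Sg * Sg = 1\<^sub>m p"
    using mat_inverse(2)[OF Sg_carrier] by (auto simp: precision_def)
qed

lemma precision_transpose: "transpose_mat (precision Sg) = precision Sg"
proof -
  let ?K = "precision Sg"
  note K = precision_inverse
  have KT: "transpose_mat ?K \<in> carrier_mat p p" using K(1) by simp
  have "transpose_mat ?K * Sg = transpose_mat (Sg * ?K)"
    by (simp add: transpose_mult[OF Sg_carrier K(1)] Sg_transpose)
  then have "transpose_mat ?K * Sg = 1\<^sub>m p" by (simp add: K)
  then have "(transpose_mat ?K * Sg) * ?K = ?K" using K(1) by simp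
  then show ?thesis
    using K KT Sg_carrier by (simp add: assoc_mult_mat[OF KT Sg_carrier K(1)])
qed

lemma X_measurable [measurable]: "k < p \<Longrightarrow> X k \<in> borel_measurable M"
proof -
  assume k: "k < p"
  have "rvec {..<p} X \<in> measurable M (\<Pi>\<^sub>M k\<in>{..<p}. lborel)"
    using Sg_distributed by (simp add: distributed_def)
  then have "(\<lambda>\<omega>. rvec {..<p} X \<omega> k) \<in> measurable M lborel"
    by (rule measurable_compose[OF _ measurable_component_singleton]) (use k in simp)
  then show ?thesis using k by (simp add: rvec_def)
qed

lemma rvec_measurable [measurable]: "J \<subseteq> {..<p} \<Longrightarrow> rvec J X \<in> measurable M (\<Pi>\<^sub>M k\<in>J. borel)"
  unfolding rvec_def by (intro measurable_restrict X_measurable) auto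

lemma gauss_row_law: "gauss_row p cov prec law (sqrt ((2 * pi) ^ p * Determinant.det Sg))"
proof (intro gauss_row.intro cov_matrix.intro gauss_row_axioms.intro)
  show "cov j k = cov k j" if "j < p" "k < p" for j k
    using that Sg_carrier index_transpose_mat(1)[of j Sg k] by (simp add: Sg_transpose)
  show "prec j k = prec k j" if "j < p" "k < p" for j k
    using that precision_inverse(1) index_transpose_mat(1)[of j "precision Sg" k] by (simp add: precision_transpose)
  show "0 < bil p cov u u" if "k < p" "u k \<noteq> 0" for k u
  proof -
    have "0 < scalar_prod (vec p u) (mult_mat_vec Sg (vec p u))"
      by (rule Sg_pos) (use that in \<open>auto simp: vec_eq_iff\<close>)
    also have "\<dots> = bil p cov u u"
      using Sg_carrier by (simp add: scalar_prod_def bil_def sum_distrib_left mult.assoc lessThan_atLeast0)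
    finally show ?thesis .
  qed
  show "(\<Sum>k<p. cov j k * prec k l) = (if j = l then 1 else 0)" if "j < p" "l < p" for j l
  proof -
    have "(Sg * precision Sg) $$ (j, l) = (\<Sum>k<p. cov j k * prec k l)"
      using that Sg_carrier precision_inverse(1) by (simp add: scalar_prod_def lessThan_atLeast0)
    then show ?thesis using that by (simp add: precision_inverse)
  qed
  show "prob_space law"
    by (rule prob_space_distr) simp
  show "sets law = sets (\<Pi>\<^sub>M k\<in>{..<p}. borel)" by simp
  show "(\<integral>\<^sup>+x. f x \<partial>law) = (\<integral>\<^sup>+x. ennreal (exp (- bil p prec x x / 2) / sqrt ((2 * pi) ^ p * Determinant.det Sg)) * f x
      \<partial>(\<Pi>\<^sub>M k\<in>{..<p}. lborel))"
    if f: "f \<in> borel_measurable (\<Pi>\<^sub>M k\<in>{..<p}. borel)" for f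
  proof -
    let ?g = "\<lambda>x. ennreal (normal_vec_density p Sg x)"
    have sets_eq: "sets (\<Pi>\<^sub>M k\<in>{..<p}. lborel) = sets (\<Pi>\<^sub>M k\<in>{..<p}. (borel :: real measure))"
      by (intro sets_PiM_cong) auto
    have "law = distr M (\<Pi>\<^sub>M k\<in>{..<p}. lborel) (rvec {..<p} X)"
      by (rule distr_cong) (simp_all add: sets_eq)
    also have "\<dots> = density (\<Pi>\<^sub>M k\<in>{..<p}. lborel) ?g"
      using Sg_distributed by (simp add: distributed_def)
    finally have "(\<integral>\<^sup>+x. f x \<partial>law) = (\<integral>\<^sup>+x. f x \<partial>density (\<Pi>\<^sub>M k\<in>{..<p}. lborel) ?g)"
      by simp
    also have "\<dots> = (\<integral>\<^sup>+x. ?g x * f x \<partial>(\<Pi>\<^sub>M k\<in>{..<p}. lborel))"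
      using Sg_distributed f by (intro nn_integral_density) (auto simp: distributed_def measurable_cong_sets[OF sets_eq refl])
    finally show ?thesis
      by (simp add: normal_vec_density_def bil_def)
  qed
qed

sublocale gauss_row p cov prec law "sqrt ((2 * pi) ^ p * Determinant.det Sg)"
  by (rule gauss_row_law)

definition L :: "(nat \<Rightarrow> real) \<Rightarrow> 'w \<Rightarrow> real" where
  "L c \<omega> = (\<Sum>k<p. c k * X k \<omega>)"

lemma L_measurable [measurable]: "L c \<in> borel_measurable M"
  unfolding L_def by measurable

lemma lin_rvec: "lin p c (rvec {..<p} X \<omega>) = L c \<omega>"
  by (simp add: lin_def L_def rvec_def)

lemma nn_integral_law:
  "f \<in> borel_measurable (\<Pi>\<^sub>M k\<in>{..<p}. borel) \<Longrightarrow> (\<integral>\<^sup>+x. f x \<partial>law) = (\<integral>\<^sup>+\<omega>. f (rvec {..<p} X \<omega>) \<partial>M)"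
  by (rule nn_integral_distr) auto

lemma nn_integral_exp_L: "(\<integral>\<^sup>+\<omega>. ennreal (exp (L c \<omega>)) \<partial>M) = ennreal (exp (bil p cov c c / 2))"
proof -
  have "(\<integral>\<^sup>+x. ennreal (exp (lin p c x - bil p cov c c / 2)) \<partial>law) = 1"
    using tilt_eq_shift[of "\<lambda>_. 1" 1 c] row.emeasure_space_1 by simp
  then have 1: "(\<integral>\<^sup>+\<omega>. ennreal (exp (L c \<omega> - bil p cov c c / 2)) \<partial>M) = 1"
    by (subst (asm) nn_integral_law) (simp_all add: lin_rvec)
  have "ennreal (exp (L c \<omega>)) = ennreal (exp (bil p cov c c / 2)) * ennreal (exp (L c \<omega> - bil p cov c c / 2))" for \<omega>
    by (simp add: mult_exp_exp flip: ennreal_mult'')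
  then have "(\<integral>\<^sup>+\<omega>. ennreal (exp (L c \<omega>)) \<partial>M) = ennreal (exp (bil p cov c c / 2)) * 
     (\<integral>\<^sup>+\<omega>. ennreal (exp (L c \<omega> - bil p cov c c / 2)) \<partial>M)"
    by (simp add: nn_integral_cmult)
  then show ?thesis by (simp add: 1)
qed

lemma distr_L_unit:
  assumes "bil p cov c c = 1"
  shows "distr M borel (L c) = std_normal"
proof (rule measure_eqI)
  fix A assume "A \<in> sets (distr M borel (L c))"
  then have A [measurable]: "A \<in> sets borel" by simp
  have "emeasure (distr M borel (L c)) A = (\<integral>\<^sup>+\<omega>. indicator A (L c \<omega>) \<partial>M)"
    by (subst nn_integral_distr[symmetric, of _ _ borel]) auto
  also have "\<dots> = (\<integral>\<^sup>+x. indicator A (lin p c x) \<partial>law)"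
    by (subst nn_integral_law) (auto simp: lin_rvec)
  also have "\<dots> = (\<integral>\<^sup>+s. (\<integral>\<^sup>+x. indicator A s \<partial>law) \<partial>std_normal)"
    by (rule row_independence[where J = "{}"]) (use assms in auto)
  also have "\<dots> = emeasure std_normal A"
    using row.emeasure_space_1 by (simp add: sets_std_normal)
  finally show "emeasure (distr M borel (L c)) A = emeasure std_normal A" .
qed (simp add: sets_std_normal)

text \<open>
  Normalize \<open>c\<close> to variance \<open>1\<close> and use the moments of the standard normal law; if \<open>c\<close> has variance \<open>0\<close>, it
  vanishes below \<open>p\<close>.
\<close>

lemma L_moments:
  "integrable M (L c)" "integral\<^sup>L M (L c) = 0"
  "integrable M (\<lambda>\<omega>. (L c \<omega>)\<^sup>2)" "(\<integral>\<omega>. (L c \<omega>)\<^sup>2 \<partial>M) = bil p cov c c"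
proof -
  have unit: "integrable M (L c)" "integral\<^sup>L M (L c) = 0"
    "integrable M (\<lambda>\<omega>. (L c \<omega>)\<^sup>2)" "(\<integral>\<omega>. (L c \<omega>)\<^sup>2 \<partial>M) = 1" if "bil p cov c c = 1" for c
  proof -
    note D = distr_L_unit[OF that]
    have 1: "has_bochner_integral std_normal (\<lambda>s. s) 0"
      using std_normal_moment_odd[of 0] unfolding std_normal_def
      by (intro has_bochner_integral_density) auto
    have 2: "has_bochner_integral std_normal (\<lambda>s. s\<^sup>2) 1"
      using std_normal_moment_even[of 1] unfolding std_normal_def
      by (intro has_bochner_integral_density) auto
    have tr: "integrable M (\<lambda>\<omega>. f (L c \<omega>)) \<and> (\<integral>\<omega>. f (L c \<omega>) \<partial>M) = x"
      if "has_bochner_integral std_normal f x" for f :: "real \<Rightarrow> real" and x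
    proof -
      have f: "integrable std_normal f" "integral\<^sup>L std_normal f = x" 
        using that by (auto simp: has_bochner_integral_iff)
      then have fm: "f \<in> borel_measurable borel"
        using borel_measurable_integrable[of std_normal f] by (simp add: measurable_cong_sets[OF sets_std_normal refl])
      show ?thesis
        using integrable_distr[OF L_measurable[of c], of f] integral_distr[OF L_measurable[of c] fm] f
        unfolding D by auto
    qed
    show "integrable M (L c)" "integral\<^sup>L M (L c) = 0"
      using tr[OF 1] by auto
    show "integrable M (\<lambda>\<omega>. (L c \<omega>)\<^sup>2)" "(\<integral>\<omega>. (L c \<omega>)\<^sup>2 \<partial>M) = 1"
      using tr[OF 2] by auto
  qed
  have "integrable M (L c) \<and> integral\<^sup>L M (L c) = 0 \<and>
     integrable M (\<lambda>\<omega>. (L c \<omega>)\<^sup>2) \<and> (\<integral>\<omega>. (L c \<omega>)\<^sup>2 \<partial>M) = bil p cov c c"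
  proof (cases "bil p cov c c = 0")
    case True
    then have "L c = (\<lambda>\<omega>. 0)"
      using cov_eq_0D[of c] by (auto simp: L_def)
    then show ?thesis using True by simp
  next
    case False
    then have pos: "0 < bil p cov c c" using cov_nonneg[of c] by linarith
    define c' where "c' = (\<lambda>k. (1 / sqrt (bil p cov c c)) * c k)"
    note c' = normalize_lin[OF pos, folded c'_def]
    have "L c = (\<lambda>\<omega>. sqrt (bil p cov c c) * L c' \<omega>)"
      using c'(3) by (simp add: lin_rvec[symmetric] fun_eq_iff)
    then show ?thesis
      using unit[OF c'(1)] pos by (simp add: power_mult_distrib)
  qed
  then show "integrable M (L c)" "integral\<^sup>L M (L c) = 0"
    "integrable M (\<lambda>\<omega>. (L c \<omega>)\<^sup>2)" "(\<integral>\<omega>. (L c \<omega>)\<^sup>2 \<partial>M) = bil p cov c c"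
    by blast+
qed

lemma L_unit: "a < p \<Longrightarrow> L (unit_v a) \<omega> = X a \<omega>"
  using lin_unit[of a p "rvec {..<p} X \<omega>"] by (simp add: lin_rvec) (simp add: rvec_def)

lemma variance_X: "a < p \<Longrightarrow> variance (X a) = cov a a"
  using L_moments[of "unit_v a"] by (simp add: L_unit cov_unit_diag cong: Bochner_Integration.integral_cong)

lemma prediction_error:
  "a < p \<Longrightarrow> (\<integral>\<omega>. (X a \<omega> - (\<Sum>k<p. \<theta> k * X k \<omega>))\<^sup>2 \<partial>M) =
     bil p cov (\<lambda>k. unit_v a k - \<theta> k) (\<lambda>k. unit_v a k - \<theta> k)"
proof -
  assume a: "a < p"
  have "X a \<omega> - (\<Sum>k<p. \<theta> k * X k \<omega>) = L (\<lambda>k. unit_v a k - \<theta> k) \<omega>" for \<omega>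
    using lin_diff[of p "unit_v a" \<theta> "rvec {..<p} X \<omega>"] a
    by (simp add: lin_rvec L_unit) (simp add: L_def)
  then show ?thesis by (simp add: L_moments)
qed

text \<open>
  The normal equations determine the minimizer: by Pythagoras every other vector supported in \<open>A\<close> has a strictly larger
  prediction error.
\<close>

lemma opt_pred_eqI:
  assumes "a < p" "A \<subseteq> {..<p}"
    and supp: "\<And>k. k \<notin> A \<Longrightarrow> \<theta> k = 0" and ne: "\<And>j. j \<in> A \<Longrightarrow> mv p cov (\<lambda>k. unit_v a k - \<theta> k) j = 0"
  shows "opt_pred M p X a A = \<theta>"
proof -
  let ?f = "\<lambda>\<theta>. bil p cov (\<lambda>k. unit_v a k - \<theta> k) (\<lambda>k. unit_v a k - \<theta> k)"
  let ?P = "\<lambda>\<theta> :: nat \<Rightarrow> real. \<forall>k. k \<notin> A \<longrightarrow> \<theta> k = 0"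
  have f: "?f \<theta>' = ?f \<theta> + bil p cov (\<lambda>k. \<theta> k - \<theta>' k) (\<lambda>k. \<theta> k - \<theta>' k)" if "?P \<theta>'" for \<theta>'
    by (rule residual_cov_pythagoras[OF assms(2) supp ne]) (use that in auto)
  have min: "is_arg_min ?f ?P \<theta>"
    unfolding is_arg_min_linorder
  proof (intro conjI allI impI)
    show "\<theta> k = 0" if "k \<notin> A" for k by (rule supp[OF that])
    show "?f \<theta> \<le> ?f \<theta>'" if "?P \<theta>'" for \<theta>'
      using f[OF that] cov_nonneg[of "\<lambda>k. \<theta> k - \<theta>' k"] by linarith
  qed
  have uniq: "\<theta>' = \<theta>" if "is_arg_min ?f ?P \<theta>'" for \<theta>'
  proof
    fix k
    have P: "?P \<theta>'" and "?f \<theta>' \<le> ?f \<theta>"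
      using that supp unfolding is_arg_min_linorder by auto
    then have "bil p cov (\<lambda>k. \<theta> k - \<theta>' k) (\<lambda>k. \<theta> k - \<theta>' k) = 0"
      using f[OF P] cov_nonneg[of "\<lambda>k. \<theta> k - \<theta>' k"] by linarith
    from cov_eq_0D[OF this, of k] show "\<theta>' k = \<theta> k"
      using P supp assms(2) by (cases "k \<in> A") auto
  qed
  have "opt_pred M p X a A = arg_min ?f ?P"
    unfolding opt_pred_def using prediction_error[OF assms(1)] by (simp only:)
  also have "\<dots> = \<theta>"
    unfolding arg_min_def using min uniq by (rule some_equality)
  finally show ?thesis .
qed

lemma opt_pred_normal_equations:
  assumes "a < p" "A \<subseteq> {..<p}"
  shows "k \<notin> A \<Longrightarrow> opt_pred M p X a A k = 0"
    and "j \<in> A \<Longrightarrow> mv p cov (\<lambda>k. unit_v a k - opt_pred M p X a A k) j = 0"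
proof -
  obtain \<theta> where \<theta>: "\<And>k. k \<notin> A \<Longrightarrow> \<theta> k = 0" "\<And>j. j \<in> A \<Longrightarrow> mv p cov (\<lambda>k. unit_v a k - \<theta> k) j = 0"
    using normal_equations_solvable[OF finite_subset[OF assms(2)] assms(2), of "unit_v a"] by auto
  then have "opt_pred M p X a A = \<theta>" by (rule opt_pred_eqI[OF assms])
  then show "k \<notin> A \<Longrightarrow> opt_pred M p X a A k = 0"
    "j \<in> A \<Longrightarrow> mv p cov (\<lambda>k. unit_v a k - opt_pred M p X a A k) j = 0"
    using \<theta> by auto
qed

end

section \<open>Conditional independence and conditional variance\<close>

text \<open>
  Identities tested on events \<open>Y \<in> B\<close> extend to functions of \<open>Y\<close>. This passes from the indicators in the definition
  of conditional independence to exponentials.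
\<close>

lemma nn_integral_eq_of_level_sets:
  assumes [measurable]: "u \<in> borel_measurable M" "v \<in> borel_measurable M" "Y \<in> borel_measurable M"
    and eq: "\<And>B. B \<in> sets borel \<Longrightarrow>
      (\<integral>\<^sup>+\<omega>. u \<omega> * indicator B (Y \<omega> :: real) \<partial>M) = (\<integral>\<^sup>+\<omega>. v \<omega> * indicator B (Y \<omega>) \<partial>M)"
    and [measurable]: "f \<in> borel_measurable borel"
  shows "(\<integral>\<^sup>+\<omega>. u \<omega> * f (Y \<omega>) \<partial>M) = (\<integral>\<^sup>+\<omega>. v \<omega> * f (Y \<omega>) \<partial>M)"
proof -
  have *: "(\<integral>\<^sup>+y. g y \<partial>distr (density M w) borel Y) = (\<integral>\<^sup>+\<omega>. w \<omega> * g (Y \<omega>) \<partial>M)"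
    if [measurable]: "w \<in> borel_measurable M" "g \<in> borel_measurable borel" for w g
    by (simp add: nn_integral_distr nn_integral_density)
  have "distr (density M u) borel Y = distr (density M v) borel Y"
  proof (rule measure_eqI)
    fix B assume "B \<in> sets (distr (density M u) borel Y)"
    then have B [measurable]: "B \<in> sets borel" by simp
    show "emeasure (distr (density M u) borel Y) B = emeasure (distr (density M v) borel Y) B"
      using eq[OF B] *[of u "indicator B"] *[of v "indicator B"] by simp
  qed simp
  then show ?thesis
    using *[of u f] *[of v f] by simp
qed

context gauss_vec
begin

abbreviation F :: "nat set \<Rightarrow> 'w measure" where "F J \<equiv> sigma_gen_by M X J"

lemma space_F [simp]: "space (F J) = space M"
  by (simp add: sigma_gen_by_def)

lemma rvec_in_space: "rvec J X \<in> space M \<rightarrow> space (\<Pi>\<^sub>M k\<in>J. (borel :: real measure))"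
  by (auto simp: rvec_def space_PiM)

lemma sets_F: "sets (F J) = {rvec J X -` B \<inter> space M | B. B \<in> sets (\<Pi>\<^sub>M k\<in>J. borel)}"
  unfolding sigma_gen_by_def by (rule sets_vimage_algebra2[OF rvec_in_space])

lemma subalgebra_F: "J \<subseteq> {..<p} \<Longrightarrow> subalgebra M (F J)"
  unfolding subalgebra_def using measurable_sets[OF rvec_measurable] by (auto simp: sets_F)

lemma sigma_finite_F: "J \<subseteq> {..<p} \<Longrightarrow> sigma_finite_subalgebra M (F J)"
  by (intro finite_measure_subalgebra_is_sigma_finite finite_measure_subalgebra.intro
    finite_measure_subalgebra_axioms.intro subalgebra_F finite_measure_axioms)

lemma X_measurable_F: 
  assumes "k \<in> J" 
  shows "X k \<in> borel_measurable (F J)"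
proof -
  have "(\<lambda>\<omega>. rvec J X \<omega> k) \<in> borel_measurable (F J)"
    unfolding sigma_gen_by_def
    by (rule measurable_compose[OF measurable_vimage_algebra1[OF rvec_in_space] measurable_component_singleton]) fact
  then show ?thesis using assms by (simp add: rvec_def)
qed

lemma L_measurable_F:
  assumes "J \<subseteq> {..<p}" "\<And>k. k \<notin> J \<Longrightarrow> m k = 0"
  shows "L m \<in> borel_measurable (F J)"
proof -
  have "L m \<omega> = (\<Sum>k\<in>J. m k * X k \<omega>)" for \<omega>
    unfolding L_def using assms by (intro sum.mono_neutral_right) auto
  moreover have "(\<lambda>\<omega>. \<Sum>k\<in>J. m k * X k \<omega>) \<in> borel_measurable (F J)"
    by (intro borel_measurable_sum borel_measurable_times borel_measurable_const X_measurable_F)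
  ultimately show ?thesis by (simp cong: measurable_cong)
qed

lemma indicator_F:
  assumes J: "J \<subseteq> {..<p}" and H: "H \<in> sets (F J)"
  shows "\<exists>B. (\<lambda>x. indicator B (restrict x J) :: ennreal) \<in> borel_measurable (\<Pi>\<^sub>M k\<in>{..<p}. borel) \<and>
    (\<forall>\<omega>\<in>space M. indicator H \<omega> = (indicator B (restrict (rvec {..<p} X \<omega>) J) :: ennreal))"
proof -
  obtain B where B: "B \<in> sets (\<Pi>\<^sub>M k\<in>J. borel)" "H = rvec J X -` B \<inter> space M"
    using H unfolding sets_F by auto
  show ?thesis
  proof (intro exI[of _ B] conjI ballI)
    show "(\<lambda>x. indicator B (restrict x J) :: ennreal) \<in> borel_measurable (\<Pi>\<^sub>M k\<in>{..<p}. borel)"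
      by (rule measurable_compose[OF measurable_restrict_subset[OF J]]) (use B(1) in simp)
    fix \<omega> assume "\<omega> \<in> space M"
    moreover have "restrict (rvec {..<p} X \<omega>) J = rvec J X \<omega>"
      using J by (auto simp: rvec_def fun_eq_iff)
    ultimately show "indicator H \<omega> = (indicator B (restrict (rvec {..<p} X \<omega>) J) :: ennreal)"
      by (simp add: B(2) indicator_def)
  qed
qed

text \<open>
  This says \<open>E (exp ((c + m) \<bullet> X) | X\<^sub>J) = exp (m \<bullet> X + c\<^sup>T S c / 2)\<close> when \<open>m\<close> is supported in \<open>J\<close> and \<open>c \<bullet> X\<close> is
  uncorrelated with \<open>X\<^sub>J\<close>: tilting by \<open>c\<close> is a translation that leaves \<open>X\<^sub>J\<close> alone.
\<close>

lemma exp_orthogonal_to_F: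
  assumes J: "J \<subseteq> {..<p}" and H: "H \<in> sets (F J)"
    and m: "\<And>k. k \<notin> J \<Longrightarrow> m k = 0" and orth: "\<And>k. k \<in> J \<Longrightarrow> mv p cov c k = 0"
  shows "(\<integral>\<^sup>+\<omega>. indicator H \<omega> * ennreal (exp (L (\<lambda>k. c k + m k) \<omega>)) \<partial>M) =
    (\<integral>\<^sup>+\<omega>. indicator H \<omega> * ennreal (exp (L m \<omega> + bil p cov c c / 2)) \<partial>M)"
proof -
  obtain B where B [measurable]: "(\<lambda>x. indicator B (restrict x J) :: ennreal) \<in> borel_measurable (\<Pi>\<^sub>M k\<in>{..<p}. borel)"
    and HB: "\<And>\<omega>. \<omega> \<in> space M \<Longrightarrow> indicator H \<omega> = (indicator B (restrict (rvec {..<p} X \<omega>) J) :: ennreal)"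
    using indicator_F[OF J H] by blast
  let ?f = "\<lambda>x. indicator B (restrict x J) * ennreal (exp (lin p m x + bil p cov c c / 2))"
  have inv: "?f (\<lambda>k\<in>{..<p}. x k + 1 * mv p cov c k) = ?f x" for x
  proof -
    have "restrict (\<lambda>k\<in>{..<p}. x k + 1 * mv p cov c k) J = restrict x J"
      using J orth by (auto simp: fun_eq_iff)
    moreover have "lin p m (\<lambda>k\<in>{..<p}. x k + 1 * mv p cov c k) = lin p m x"
      unfolding lin_def
    proof (rule sum.cong)
      show "m k * (\<lambda>k\<in>{..<p}. x k + 1 * mv p cov c k) k = m k * x k" if "k \<in> {..<p}" for k
        using m[of k] orth[of k] that by (cases "k \<in> J") auto
    qed simp
    ultimately show ?thesis by (simp only:)
  qed
  have "(\<integral>\<^sup>+\<omega>. indicator H \<omega> * ennreal (exp (L (\<lambda>k. c k + m k) \<omega>)) \<partial>M) =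
      (\<integral>\<^sup>+\<omega>. indicator B (restrict (rvec {..<p} X \<omega>) J) * ennreal (exp (lin p (\<lambda>k. c k + m k) (rvec {..<p} X \<omega>))) \<partial>M)"
    by (rule nn_integral_cong) (simp add: HB lin_rvec)
  also have "\<dots> = (\<integral>\<^sup>+x. indicator B (restrict x J) * ennreal (exp (lin p (\<lambda>k. c k + m k) x)) \<partial>law)"
    by (rule nn_integral_law[symmetric]) measurable
  also have "\<dots> = (\<integral>\<^sup>+x. ?f x * ennreal (exp (1 * lin p c x - 1\<^sup>2 * bil p cov c c / 2)) \<partial>law)"
    by (rule nn_integral_cong) (simp add: lin_add mult.assoc mult_exp_exp add.commute flip: ennreal_mult'')
  also have "\<dots> = (\<integral>\<^sup>+x. ?f (\<lambda>k\<in>{..<p}. x k + 1 * mv p cov c k) \<partial>law)"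
    by (rule tilt_eq_shift) measurable
  also have "\<dots> = (\<integral>\<^sup>+x. ?f x \<partial>law)"
    by (simp only: inv)
  also have "\<dots> = (\<integral>\<^sup>+\<omega>. ?f (rvec {..<p} X \<omega>) \<partial>M)"
    by (rule nn_integral_law) measurable
  also have "\<dots> = (\<integral>\<^sup>+\<omega>. indicator H \<omega> * ennreal (exp (L m \<omega> + bil p cov c c / 2)) \<partial>M)"
    by (rule nn_integral_cong) (simp add: HB lin_rvec)
  finally show ?thesis .
qed

text \<open>
  By independence the positive and the negative part of \<open>L c\<close> have the same integral over \<open>H\<close>, since \<open>- c\<close>
  satisfies the same hypotheses as \<open>c\<close>.
\<close>

lemma mean_orthogonal_to_F:
  assumes J: "J \<subseteq> {..<p}" and H: "H \<in> sets (F J)"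
    and orth: "\<And>k. k \<in> J \<Longrightarrow> mv p cov c k = 0"
  shows "(\<integral>\<omega>. indicator H \<omega> * L c \<omega> \<partial>M) = 0"
proof -
  obtain B where B [measurable]: "(\<lambda>x. indicator B (restrict x J) :: ennreal) \<in> borel_measurable (\<Pi>\<^sub>M k\<in>{..<p}. borel)"
    and HB: "\<And>\<omega>. \<omega> \<in> space M \<Longrightarrow> indicator H \<omega> = (indicator B (restrict (rvec {..<p} X \<omega>) J) :: ennreal)"
    using indicator_F[OF J H] by blast
  have HM [measurable]: "H \<in> sets M"
    using H subalgebra_F[OF J] by (auto simp: subalgebra_def)
  have unit: "(\<integral>\<^sup>+\<omega>. ennreal (indicator H \<omega> * L c \<omega>) \<partial>M) =
      (\<integral>\<^sup>+s. (\<integral>\<^sup>+x. indicator B (restrict x J) * ennreal s \<partial>law) \<partial>std_normal)"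
    if c1: "bil p cov c c = 1" and orth: "\<And>k. k \<in> J \<Longrightarrow> mv p cov c k = 0" for c
  proof -
    have "(\<integral>\<^sup>+\<omega>. ennreal (indicator H \<omega> * L c \<omega>) \<partial>M) = 
       (\<integral>\<^sup>+\<omega>. indicator B (restrict (rvec {..<p} X \<omega>) J) * ennreal (lin p c (rvec {..<p} X \<omega>)) \<partial>M)"
    proof (rule nn_integral_cong)
      fix \<omega> assume \<omega>: "\<omega> \<in> space M"
      have "ennreal (indicator H \<omega> * L c \<omega>) = indicator H \<omega> * ennreal (L c \<omega>)"
        by (simp add: indicator_def)
      then show "ennreal (indicator H \<omega> * L c \<omega>) =
          indicator B (restrict (rvec {..<p} X \<omega>) J) * ennreal (lin p c (rvec {..<p} X \<omega>))"
        by (simp only: HB[OF \<omega>] lin_rvec)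
    qed
    also have "\<dots> = (\<integral>\<^sup>+x. indicator B (restrict x J) * ennreal (lin p c x) \<partial>law)"
      by (rule nn_integral_law[symmetric]) measurable
    also have "\<dots> = (\<integral>\<^sup>+s. (\<integral>\<^sup>+x. indicator B (restrict x J) * ennreal s \<partial>law) \<partial>std_normal)"
    proof (rule row_independence[where F = "\<lambda>s x. indicator B (restrict x J) * ennreal s" and J = J, OF _ c1])
      show "(\<lambda>(s, x). indicator B (restrict x J) * ennreal s) \<in> borel_measurable (borel \<Otimes>\<^sub>M row_space)"
        by measurable
      show "k < p \<and> mv p cov c k = 0" if "k \<in> J" for k
        using that J orth by auto
      show "indicator B (restrict x J) * ennreal s = indicator B (restrict y J) * ennreal s"
        if "\<And>k. k \<in> J \<Longrightarrow> x k = y k" for s x y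
        using restrict_ext[of J x y] that by simp
    qed
    finally show ?thesis .
  qed
  show ?thesis
  proof (cases "bil p cov c c = 0")
    case True
    then have "L c = (\<lambda>\<omega>. 0)"
      using cov_eq_0D[of c] by (auto simp: L_def)
    then show ?thesis by simp
  next
    case False
    then have pos: "0 < bil p cov c c" using cov_nonneg[of c] by linarith
    define c' where "c' = (\<lambda>k. (1 / sqrt (bil p cov c c)) * c k)"
    note c' = normalize_lin[OF pos, folded c'_def]
    define nc where "nc = (\<lambda>k. (- 1) * c' k)"
    have nc: "bil p cov nc nc = 1" "\<And>k. mv p cov nc k = - mv p cov c' k" "\<And>\<omega>. L nc \<omega> = - L c' \<omega>"
      unfolding nc_def bil_scale_left bil_scale_right mv_scale lin_rvec[symmetric] lin_scale
      by (simp_all add: c')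
    have int: "integrable M (\<lambda>\<omega>. indicator H \<omega> * L c' \<omega>)"
      using integrable_mult_indicator[OF HM L_moments(1)] by simp
    have "(\<integral>\<^sup>+\<omega>. ennreal (indicator H \<omega> * L c' \<omega>) \<partial>M) = (\<integral>\<^sup>+\<omega>. ennreal (- (indicator H \<omega> * L c' \<omega>)) \<partial>M)"
      using unit[OF c'(1)] unit[OF nc(1)] c'(2)[OF orth] by (simp add: nc(2,3))
    then have "(\<integral>\<omega>. indicator H \<omega> * L c' \<omega> \<partial>M) = 0"
      by (simp add: real_lebesgue_integral_def[OF int])
    moreover have "L c \<omega> = sqrt (bil p cov c c) * L c' \<omega>" for \<omega>
      using c'(3) by (simp add: lin_rvec[symmetric])
    then have "(\<integral>\<omega>. indicator H \<omega> * L c \<omega> \<partial>M) = (\<integral>\<omega>. sqrt (bil p cov c c) * (indicator H \<omega> * L c' \<omega>) \<partial>M)"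
      by (simp add: ac_simps)
    ultimately show ?thesis by simp
  qed
qed

text \<open>
  With \<open>c = K e\<^sub>a / K\<^sub>a\<^sub>a\<close> the variable \<open>X\<^sub>a\<close> is a linear function of the other variables plus \<open>c \<bullet> X\<close>, which
  has mean zero given them. So the expected conditional variance is the variance \<open>1 / K\<^sub>a\<^sub>a\<close> of \<open>c \<bullet> X\<close>.
\<close>

lemma cond_variance_bound:
  assumes a: "a < p" and v: "AE \<omega> in M. v2 \<le> cond_variance M (F ({..<p} - {a})) (X a) \<omega>"
  shows "v2 \<le> 1 / prec a a"
proof -
  let ?J = "{..<p} - {a}"
  have J: "?J \<subseteq> {..<p}" by auto
  interpret F: sigma_finite_subalgebra M "F ?J" by (rule sigma_finite_F[OF J])
  have K: "0 < prec a a" by (rule K_diag_pos[OF a])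
  define c where "c = (\<lambda>k. (1 / prec a a) * prec k a)"
  define m where "m = (\<lambda>k. if k < p then unit_v a k - c k else 0)"
  have ca: "c a = 1" using K by (simp add: c_def)
  have m0: "m k = 0" if "k \<notin> ?J" for k
    using that ca by (auto simp: m_def unit_v_def)
  have mvc: "mv p cov c j = unit_v a j / prec a a" if "j < p" for j
    unfolding c_def mv_scale using mv_S_K[OF that a] by simp
  have orth: "mv p cov c k = 0" if "k \<in> ?J" for k
    using that mvc[of k] by (simp add: unit_v_def)
  have cc: "bil p cov c c = 1 / prec a a"
    using cov_K[OF a, of c] ca unfolding c_def bil_scale_right by simp
  have X: "X a \<omega> = L m \<omega> + L c \<omega>" for \<omega>
  proof -
    have "X a \<omega> = L (unit_v a) \<omega>" using L_unit[OF a] by simp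
    also have "\<dots> = L (\<lambda>k. m k + c k) \<omega>"
      unfolding L_def by (intro sum.cong) (auto simp: m_def)
    also have "\<dots> = L m \<omega> + L c \<omega>"
      unfolding lin_rvec[symmetric] by (rule lin_add)
    finally show ?thesis .
  qed
  have intX: "integrable M (X a)" using L_moments(1)[of "unit_v a"] L_unit[OF a] by (simp cong: Bochner_Integration.integrable_cong)
  have ce: "AE \<omega> in M. real_cond_exp M (F ?J) (X a) \<omega> = L m \<omega>"
  proof (rule F.real_cond_exp_charact)
    fix H assume H: "H \<in> sets (F ?J)"
    have HM: "H \<in> sets M" using H subalgebra_F[OF J] by (auto simp: subalgebra_def)
    have int: "integrable M (\<lambda>\<omega>. indicator H \<omega> * L c \<omega>)" for c
      using integrable_mult_indicator[OF HM L_moments(1)] by simp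
    have "(\<integral>\<omega>. indicator H \<omega> * L c \<omega> \<partial>M) = 0"
      by (rule mean_orthogonal_to_F[OF J H]) (rule orth)
    then show "(\<integral>\<omega>\<in>H. X a \<omega> \<partial>M) = (\<integral>\<omega>\<in>H. L m \<omega> \<partial>M)"
      unfolding set_lebesgue_integral_def X real_scaleR_def distrib_left
      by (simp add: int)
  qed (use intX L_moments(1) L_measurable_F[OF J m0] in auto)
  have meas: "(\<lambda>\<omega>. (X a \<omega> - real_cond_exp M (F ?J) (X a) \<omega>)\<^sup>2) \<in> borel_measurable M"
    using a by (intro borel_measurable_power borel_measurable_diff X_measurable borel_measurable_cond_exp2)
  have ae: "AE \<omega> in M. (X a \<omega> - real_cond_exp M (F ?J) (X a) \<omega>)\<^sup>2 = (L c \<omega>)\<^sup>2"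
    using ce by eventually_elim (simp add: X)
  have int: "integrable M (\<lambda>\<omega>. (X a \<omega> - real_cond_exp M (F ?J) (X a) \<omega>)\<^sup>2)"
    by (subst integrable_cong_AE[OF meas _ ae]) (simp_all add: L_moments)
  have "v2 = (\<integral>\<omega>. v2 \<partial>M)" by (simp add: prob_space)
  also have "\<dots> \<le> (\<integral>\<omega>. cond_variance M (F ?J) (X a) \<omega> \<partial>M)"
    unfolding cond_variance_def
    by (rule integral_mono_AE) (use v F.real_cond_exp_int(1)[OF int] in \<open>auto simp: cond_variance_def\<close>)
  also have "\<dots> = (\<integral>\<omega>. (X a \<omega> - real_cond_exp M (F ?J) (X a) \<omega>)\<^sup>2 \<partial>M)"
    unfolding cond_variance_def by (rule F.real_cond_exp_int(2)[OF int])
  also have "\<dots> = (\<integral>\<omega>. (L c \<omega>)\<^sup>2 \<partial>M)"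
    by (rule integral_cong_AE[OF meas _ ae]) simp
  also have "\<dots> = 1 / prec a a"
    by (simp add: L_moments cc)
  finally show ?thesis .
qed

text \<open>
  Under conditional independence, \<open>exp X\<^sub>b\<close> may be replaced by its conditional expectation \<open>G\<close> in an integral against
  a function of \<open>X\<^sub>a\<close>. For an indicator of \<open>X\<^sub>a\<close>, replace it first by its conditional probability \<open>P\<close>, which is
  allowed against every function of \<open>X\<^sub>b\<close>; then use that \<open>P\<close> is measurable with respect to the conditioning.
\<close>

lemma cond_indep_transfer:
  assumes ab: "a < p" "b < p" and J: "J \<subseteq> {..<p}"
    and ci: "cond_indep M (F J) (X a) (X b)"
    and G: "G \<in> borel_measurable (F J)" "\<And>\<omega>. 0 \<le> G \<omega>"
    and intG: "integrable M G" and intY: "integrable M (\<lambda>\<omega>. exp (X b \<omega>))"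
    and GY: "\<And>H. H \<in> sets (F J) \<Longrightarrow>
       (\<integral>\<^sup>+\<omega>. indicator H \<omega> * ennreal (exp (X b \<omega>)) \<partial>M) = (\<integral>\<^sup>+\<omega>. indicator H \<omega> * ennreal (G \<omega>) \<partial>M)"
  shows "(\<integral>\<^sup>+\<omega>. ennreal (exp (X b \<omega>)) * ennreal (exp (X a \<omega>)) \<partial>M) = (\<integral>\<^sup>+\<omega>. ennreal (G \<omega>) * ennreal (exp (X a \<omega>)) \<partial>M)"
proof -
  interpret F: sigma_finite_subalgebra M "F J" by (rule sigma_finite_F[OF J])
  note [measurable] = X_measurable[OF ab(1)] X_measurable[OF ab(2)]
  have GM [measurable]: "G \<in> borel_measurable M"
    using measurable_from_subalg[OF subalgebra_F[OF J] G(1)] .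
  have int_bd: "integrable M (\<lambda>\<omega>. q \<omega> * f \<omega>)" 
    if "q \<in> borel_measurable M" "AE \<omega> in M. 0 \<le> q \<omega> \<and> q \<omega> \<le> 1" "integrable M f" for q f :: "'w \<Rightarrow> real"
  proof (rule Bochner_Integration.integrable_bound[OF that(3)])
    show "AE \<omega> in M. norm (q \<omega> * f \<omega>) \<le> norm (f \<omega>)"
      using that(2) by eventually_elim (simp add: abs_mult mult_left_le_one_le)
  qed (use that in measurable)
  have ind_int: "integrable M (\<lambda>\<omega>. indicator A (X k \<omega>) :: real)" if "A \<in> sets borel" "k < p" for A k
    by (rule integrable_const_bound[of _ 1]) (use that in \<open>auto simp: indicator_def intro!: measurable_compose[OF X_measurable]\<close>)
  have ceY: "AE \<omega> in M. real_cond_exp M (F J) (\<lambda>\<omega>. exp (X b \<omega>)) \<omega> = G \<omega>"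
  proof (rule F.real_cond_exp_charact)
    fix H assume H: "H \<in> sets (F J)"
    have HM [measurable]: "H \<in> sets M" using H subalgebra_F[OF J] by (auto simp: subalgebra_def)
    have "(\<integral>\<omega>. indicator H \<omega> * f \<omega> \<partial>M) = enn2real (\<integral>\<^sup>+\<omega>. indicator H \<omega> * ennreal (f \<omega>) \<partial>M)"
      if [measurable]: "f \<in> borel_measurable M" and "\<And>\<omega>. 0 \<le> f \<omega>" for f
    proof -
      have "ennreal (indicator H \<omega> * f \<omega>) = indicator H \<omega> * ennreal (f \<omega>)" for \<omega>
        by (simp add: indicator_def)
      then show ?thesis
        using that by (subst integral_eq_nn_integral) auto
    qed
    then show "(\<integral>\<omega>\<in>H. exp (X b \<omega>) \<partial>M) = (\<integral>\<omega>\<in>H. G \<omega> \<partial>M)"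
      unfolding set_lebesgue_integral_def using GY[OF H] G(2) by simp
  qed (use intY intG G(1) in auto)
  have "(\<integral>\<^sup>+\<omega>. ennreal (exp (X b \<omega>)) * indicator A (X a \<omega>) \<partial>M) = (\<integral>\<^sup>+\<omega>. ennreal (G \<omega>) * indicator A (X a \<omega>) \<partial>M)"
    if A [measurable]: "A \<in> sets borel" for A
  proof -
    define P where "P = real_cond_exp M (F J) (\<lambda>\<omega>. indicator A (X a \<omega>))"
    have PF: "P \<in> borel_measurable (F J)" unfolding P_def by simp
    have PM [measurable]: "P \<in> borel_measurable M" unfolding P_def by simp
    have P01: "AE \<omega> in M. 0 \<le> P \<omega> \<and> P \<omega> \<le> 1"
      using F.real_cond_exp_pos[of "\<lambda>\<omega>. indicator A (X a \<omega>)"]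
        F.real_cond_exp_le_c[OF ind_int[OF A ab(1)], of 1]
      unfolding P_def by (auto simp: indicator_le_1)
    have PB: "(\<integral>\<omega>. indicator A (X a \<omega>) * indicator B (X b \<omega>) \<partial>M) = (\<integral>\<omega>. P \<omega> * indicator B (X b \<omega>) \<partial>M)"
      if B [measurable]: "B \<in> sets borel" for B
    proof -
      have i1: "integrable M (\<lambda>\<omega>. indicator A (X a \<omega>) * indicator B (X b \<omega>) :: real)"
        by (rule integrable_const_bound[of _ 1]) (auto simp: indicator_def)
      have "(\<integral>\<omega>. indicator A (X a \<omega>) * indicator B (X b \<omega>) \<partial>M) =
         (\<integral>\<omega>. real_cond_exp M (F J) (\<lambda>\<omega>. indicator A (X a \<omega>) * indicator B (X b \<omega>)) \<omega> \<partial>M)"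
        by (rule F.real_cond_exp_int(2)[OF i1, symmetric])
      also have "\<dots> = (\<integral>\<omega>. P \<omega> * real_cond_exp M (F J) (\<lambda>\<omega>. indicator B (X b \<omega>)) \<omega> \<partial>M)"
        by (rule integral_cong_AE) (use ci A B in \<open>auto simp: cond_indep_def P_def\<close>)
      also have "\<dots> = (\<integral>\<omega>. P \<omega> * indicator B (X b \<omega>) \<partial>M)"
        by (rule F.real_cond_exp_intg(2)[OF int_bd[OF PM P01 ind_int[OF B ab(2)]] PF]) measurable
      finally show ?thesis .
    qed
    have nnP: "(\<integral>\<^sup>+\<omega>. ennreal (P \<omega>) * ennreal (f \<omega>) \<partial>M) = ennreal (\<integral>\<omega>. P \<omega> * f \<omega> \<partial>M)"
      if "integrable M f" "\<And>\<omega>. 0 \<le> f \<omega>" for f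
    proof -
      have "(\<integral>\<^sup>+\<omega>. ennreal (P \<omega>) * ennreal (f \<omega>) \<partial>M) = (\<integral>\<^sup>+\<omega>. ennreal (P \<omega> * f \<omega>) \<partial>M)"
        using that(2) by (simp add: ennreal_mult'')
      also have "\<dots> = ennreal (\<integral>\<omega>. P \<omega> * f \<omega> \<partial>M)"
      proof (rule nn_integral_eq_integral[OF int_bd[OF PM P01 that(1)]])
        show "AE \<omega> in M. 0 \<le> P \<omega> * f \<omega>"
          using P01 by eventually_elim (simp add: that(2))
      qed
      finally show ?thesis .
    qed
    have nnA: "(\<integral>\<^sup>+\<omega>. ennreal (f \<omega>) * indicator A (X a \<omega>) \<partial>M) = ennreal (\<integral>\<omega>. indicator A (X a \<omega>) * f \<omega> \<partial>M)"
      if "integrable M f" "\<And>\<omega>. 0 \<le> f \<omega>" for f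
    proof -
      have "(\<integral>\<^sup>+\<omega>. ennreal (f \<omega>) * indicator A (X a \<omega>) \<partial>M) = (\<integral>\<^sup>+\<omega>. ennreal (indicator A (X a \<omega>) * f \<omega>) \<partial>M)"
        by (intro nn_integral_cong) (simp add: indicator_def)
      also have "\<dots> = ennreal (\<integral>\<omega>. indicator A (X a \<omega>) * f \<omega> \<partial>M)"
        by (rule nn_integral_eq_integral[OF int_bd[OF _ _ that(1)]]) (use that(2) in \<open>auto simp: indicator_def\<close>)
      finally show ?thesis .
    qed
    have "(\<integral>\<^sup>+\<omega>. indicator A (X a \<omega>) * ennreal (exp (X b \<omega>)) \<partial>M) = (\<integral>\<^sup>+\<omega>. ennreal (P \<omega>) * ennreal (exp (X b \<omega>)) \<partial>M)"
    proof (rule nn_integral_eq_of_level_sets[where Y = "X b" and f = "\<lambda>y. ennreal (exp y)"])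
      fix B :: "real set" assume B [measurable]: "B \<in> sets borel"
      show "(\<integral>\<^sup>+\<omega>. indicator A (X a \<omega>) * indicator B (X b \<omega>) \<partial>M) = (\<integral>\<^sup>+\<omega>. ennreal (P \<omega>) * indicator B (X b \<omega>) \<partial>M)"
        using nnP[OF ind_int[OF B ab(2)]] nnA[OF ind_int[OF B ab(2)]] PB[OF B]
        by (simp add: ennreal_indicator mult.commute)
    qed measurable
    also have "\<dots> = ennreal (\<integral>\<omega>. P \<omega> * exp (X b \<omega>) \<partial>M)"
      by (rule nnP[OF intY]) simp
    also have "(\<integral>\<omega>. P \<omega> * exp (X b \<omega>) \<partial>M) = (\<integral>\<omega>. P \<omega> * real_cond_exp M (F J) (\<lambda>\<omega>. exp (X b \<omega>)) \<omega> \<partial>M)"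
      by (rule F.real_cond_exp_intg(2)[OF int_bd[OF PM P01 intY] PF, symmetric]) measurable
    also have "\<dots> = (\<integral>\<omega>. G \<omega> * P \<omega> \<partial>M)"
      by (rule integral_cong_AE) (use ceY in \<open>auto elim: eventually_mono\<close>)
    also have "\<dots> = (\<integral>\<omega>. G \<omega> * indicator A (X a \<omega>) \<partial>M)"
      unfolding P_def
    proof (rule F.real_cond_exp_intg(2)[OF _ G(1)])
      show "integrable M (\<lambda>\<omega>. G \<omega> * indicator A (X a \<omega>))"
        using int_bd[of "\<lambda>\<omega>. indicator A (X a \<omega>)" G] intG by (simp add: mult.commute indicator_le_1)
    qed measurable
    also have "ennreal \<dots> = (\<integral>\<^sup>+\<omega>. ennreal (G \<omega>) * indicator A (X a \<omega>) \<partial>M)"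
      using nnA[OF intG G(2)] by (simp add: mult.commute)
    finally show ?thesis by (simp add: mult.commute)
  qed
  then show ?thesis
    by (intro nn_integral_eq_of_level_sets[where Y = "X a" and f = "\<lambda>y. ennreal (exp y)"]) measurable
qed

text \<open>
  Let \<open>c \<bullet> X\<close> be the residual of \<open>X\<^sub>b\<close> predicted from the conditioning variables. Comparing the two sides of the
  preceding lemma, which are explicit Gaussian exponential moments, the cross term shows that \<open>X\<^sub>a\<close> is
  uncorrelated with \<open>c \<bullet> X\<close>. Then \<open>S c\<close> is a multiple of \<open>e\<^sub>b\<close>, so \<open>c\<close> is a multiple of column \<open>b\<close> of \<open>K\<close>, and \<open>c\<close>
  vanishes at \<open>a\<close>.
\<close>

lemma cond_indep_imp_precision_0:
  assumes ab: "a < p" "b < p" "a \<noteq> b"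
    and ci: "cond_indep M (F ({..<p} - {a, b})) (X a) (X b)"
  shows "prec a b = 0"
proof -
  let ?J = "{..<p} - {a, b}"
  have J: "?J \<subseteq> {..<p}" by auto
  obtain m where m: "\<And>k. k \<notin> ?J \<Longrightarrow> m k = 0" "\<And>j. j \<in> ?J \<Longrightarrow> mv p cov (\<lambda>k. unit_v b k - m k) j = 0"
    using normal_equations_solvable[OF finite_subset[OF J] J, of "unit_v b"] by auto
  define c where "c = (\<lambda>k. unit_v b k - m k)"
  have ca: "c a = 0" and cb: "c b = 1"
    using m(1)[of a] m(1)[of b] ab by (auto simp: c_def unit_v_def)
  let ?\<tau> = "bil p cov c c"
  let ?G = "\<lambda>\<omega>. exp (L m \<omega> + ?\<tau> / 2)"
  have cm: "(\<lambda>k. c k + m k) = unit_v b" by (simp add: c_def)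
  have intE: "integrable M (\<lambda>\<omega>. exp (L u \<omega>))" for u
    by (rule integrableI_nonneg) (simp_all add: nn_integral_exp_L)
  have "(\<integral>\<^sup>+\<omega>. ennreal (exp (X b \<omega>)) * ennreal (exp (X a \<omega>)) \<partial>M) = (\<integral>\<^sup>+\<omega>. ennreal (?G \<omega>) * ennreal (exp (X a \<omega>)) \<partial>M)"
  proof (rule cond_indep_transfer[OF ab(1,2) J ci])
    show "?G \<in> borel_measurable (F ?J)"
      using L_measurable_F[OF J m(1)] by measurable
    show "integrable M ?G"
      using intE[of m] by (simp add: exp_add)
    show "integrable M (\<lambda>\<omega>. exp (X b \<omega>))"
      using intE[of "unit_v b"] by (simp add: L_unit ab)
    show "(\<integral>\<^sup>+\<omega>. indicator H \<omega> * ennreal (exp (X b \<omega>)) \<partial>M) = (\<integral>\<^sup>+\<omega>. indicator H \<omega> * ennreal (?G \<omega>) \<partial>M)"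
      if "H \<in> sets (F ?J)" for H
    proof -
      have "(\<integral>\<^sup>+\<omega>. indicator H \<omega> * ennreal (exp (L (\<lambda>k. c k + m k) \<omega>)) \<partial>M) = 
          (\<integral>\<^sup>+\<omega>. indicator H \<omega> * ennreal (?G \<omega>) \<partial>M)"
        by (rule exp_orthogonal_to_F[OF J that m(1)]) (simp_all add: m(2) c_def)
      then show ?thesis
        by (simp only: cm L_unit[OF ab(2)])
    qed
  qed simp
  moreover have "(\<integral>\<^sup>+\<omega>. ennreal (exp (X b \<omega>)) * ennreal (exp (X a \<omega>)) \<partial>M) = 
     ennreal (exp (bil p cov (\<lambda>k. unit_v b k + unit_v a k) (\<lambda>k. unit_v b k + unit_v a k) / 2))"
    unfolding nn_integral_exp_L[symmetric]
    by (simp add: lin_rvec[symmetric] lin_add mult_exp_exp flip: ennreal_mult'') (simp add: lin_rvec L_unit ab)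
  moreover have "(\<integral>\<^sup>+\<omega>. ennreal (?G \<omega>) * ennreal (exp (X a \<omega>)) \<partial>M) = 
     ennreal (exp (?\<tau> / 2)) * ennreal (exp (bil p cov (\<lambda>k. m k + unit_v a k) (\<lambda>k. m k + unit_v a k) / 2))"
  proof -
    have "L (\<lambda>k. m k + unit_v a k) \<omega> = L m \<omega> + X a \<omega>" for \<omega>
      using L_unit[OF ab(1)] by (simp add: lin_rvec[symmetric] lin_add)
    then have "ennreal (?G \<omega>) * ennreal (exp (X a \<omega>)) =
        ennreal (exp (?\<tau> / 2)) * ennreal (exp (L (\<lambda>k. m k + unit_v a k) \<omega>))" for \<omega>
      by (simp add: mult_exp_exp ac_simps flip: ennreal_mult'')
    then show ?thesis
      by (simp add: nn_integral_cmult nn_integral_exp_L)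
  qed
  ultimately have eq: "bil p cov (\<lambda>k. unit_v b k + unit_v a k) (\<lambda>k. unit_v b k + unit_v a k) = 
      ?\<tau> + bil p cov (\<lambda>k. m k + unit_v a k) (\<lambda>k. m k + unit_v a k)"
    by (simp add: mult_exp_exp flip: ennreal_mult'')
  have "(\<lambda>k. unit_v b k + unit_v a k) = (\<lambda>k. c k + (m k + unit_v a k))"
    by (simp add: c_def)
  then have "bil p cov (\<lambda>k. unit_v b k + unit_v a k) (\<lambda>k. unit_v b k + unit_v a k) =
     ?\<tau> + 2 * bil p cov (\<lambda>k. m k + unit_v a k) c + bil p cov (\<lambda>k. m k + unit_v a k) (\<lambda>k. m k + unit_v a k)"
    by (simp only: bil_add_left[of _ _ c] bil_add_right[of _ _ _ c] cov_sym[of c "\<lambda>k. m k + unit_v a k"])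
  with eq have "bil p cov (\<lambda>k. m k + unit_v a k) c = 0" by linarith
  moreover have "bil p cov m c = 0"
    by (rule cov_supported_0[OF J m(1)]) (simp_all add: m(2) c_def)
  ultimately have mva: "mv p cov c a = 0"
    using ab(1) by (simp add: bil_add_left bil_unit_left)
  have "mv p cov c k = 0" if "k < p" "k \<noteq> b" for k
    using mva m(2)[of k] that unfolding c_def by (cases "k = a") auto
  then have "mv p prec (mv p cov c) j = prec j b * mv p cov c b" if "j < p" for j
    using ab(2) unfolding mv_def[of p prec]
    by (subst sum.mono_neutral_right[of "{..<p}" "{b}"]) auto
  then have "c a = prec a b * mv p cov c b" "c b = prec b b * mv p cov c b"
    using mv_K_mv_S[of a c] mv_K_mv_S[of b c] ab by auto
  then show "prec a b = 0" using ca cb by auto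
qed

end

section \<open>Support of lasso solutions\<close>

definition residual :: "nat \<Rightarrow> (nat \<Rightarrow> nat \<Rightarrow> real) \<Rightarrow> nat \<Rightarrow> (nat \<Rightarrow> real) \<Rightarrow> nat \<Rightarrow> real" where
  "residual p D a \<theta> i = D i a - (\<Sum>k<p. D i k * \<theta> k)"

text \<open>
  The negative of the partial derivative of the quadratic part of the lasso objective.
\<close>

definition score :: "nat \<Rightarrow> nat \<Rightarrow> (nat \<Rightarrow> nat \<Rightarrow> real) \<Rightarrow> nat \<Rightarrow> (nat \<Rightarrow> real) \<Rightarrow> nat \<Rightarrow> real" where
  "score n p D a \<theta> k = 2 * ip n (residual p D a \<theta>) (\<lambda>i. D i k) / n"

lemma lasso_objective_residual:
  "lasso_objective n p D a lam \<theta> = ip n (residual p D a \<theta>) (residual p D a \<theta>) / n + lam * (\<Sum>k<p. \<bar>\<theta> k\<bar>)"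
  by (simp add: lasso_objective_def ip_def residual_def l1_norm_def power2_eq_square)

text \<open>
  The expansion of the objective around \<open>\<theta>\<close> is exact: the quadratic remainder is nonnegative, and the rest is a sum
  over coordinates, so optimality can be discussed one coordinate at a time.
\<close>

lemma lasso_objective_difference:
  "lasso_objective n p D a lam \<theta>' - lasso_objective n p D a lam \<theta> =
     ip n (\<lambda>i. \<Sum>k<p. (\<theta>' k - \<theta> k) * D i k) (\<lambda>i. \<Sum>k<p. (\<theta>' k - \<theta> k) * D i k) / n +
     (\<Sum>k<p. lam * (\<bar>\<theta>' k\<bar> - \<bar>\<theta> k\<bar>) - score n p D a \<theta> k * (\<theta>' k - \<theta> k))"
proof -
  let ?r = "residual p D a \<theta>" and ?h = "\<lambda>i. \<Sum>k<p. (\<theta>' k - \<theta> k) * D i k"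
  have "residual p D a \<theta>' = (\<lambda>i. ?r i - ?h i)"
    by (simp add: residual_def fun_eq_iff algebra_simps sum_subtractf)
  then have "ip n (residual p D a \<theta>') (residual p D a \<theta>') = ip n ?r ?r - 2 * ip n ?r ?h + ip n ?h ?h"
    by (simp only: ip_diff_left ip_diff_right ip_commute[of n ?h ?r])
  moreover have "2 * ip n ?r ?h / n = (\<Sum>k<p. score n p D a \<theta> k * (\<theta>' k - \<theta> k))"
    unfolding ip_sum_right ip_scale_right score_def
    by (simp add: sum_distrib_left sum_divide_distrib ac_simps)
  ultimately show ?thesis
    unfolding lasso_objective_residual
    by (simp add: sum_subtractf sum_distrib_left right_diff_distrib diff_divide_distrib add_divide_distrib)
qed

text \<open>
  The objective is continuous, and outside the compact box of radius \<open>R\<close> the penalty alone exceeds its value at \<open>0\<close>.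
\<close>

lemma lasso_restricted_minimizer_exists:
  assumes J: "J \<subseteq> {..<p}" and lam: "0 < lam"
  shows "\<exists>\<theta>. (\<forall>k. k \<notin> J \<longrightarrow> \<theta> k = 0) \<and>
    (\<forall>\<theta>'. (\<forall>k. k \<notin> J \<longrightarrow> \<theta>' k = 0) \<longrightarrow> lasso_objective n p D a lam \<theta> \<le> lasso_objective n p D a lam \<theta>')"
proof -
  let ?f = "lasso_objective n p D a lam"
  \<comment> \<open>at radius \<open>R\<close> the penalty of a single coordinate equals the value at \<open>0\<close>\<close>
  define R where "R = ?f (\<lambda>_. 0) / lam"
  have f_ge: "lam * \<bar>\<theta> k\<bar> \<le> ?f \<theta>" if "k < p" for \<theta> k
  proof -
    have "\<bar>\<theta> k\<bar> \<le> (\<Sum>k<p. \<bar>\<theta> k\<bar>)"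
      using that by (intro member_le_sum) auto
    then have "lam * \<bar>\<theta> k\<bar> \<le> lam * (\<Sum>k<p. \<bar>\<theta> k\<bar>)"
      using lam by simp
    also have "\<dots> \<le> ?f \<theta>"
      unfolding lasso_objective_residual by (simp add: ip_nonneg)
    finally show ?thesis .
  qed
  have R0: "0 \<le> R"
    unfolding R_def lasso_objective_residual using lam by (simp add: ip_nonneg)
  let ?C = "PiE UNIV (\<lambda>k. if k \<in> J then {- R..R} else {0})"
  have "compactin (product_topology (\<lambda>_. euclidean) UNIV) ?C"
    unfolding compactin_PiE by auto
  then have "compact ?C"
    unfolding euclidean_product_topology compactin_euclidean_iff .
  moreover have "(\<lambda>_. 0) \<in> ?C"
    using R0 by auto
  moreover have "continuous_on ?C ?f"
    unfolding lasso_objective_def l1_norm_def divide_inverse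
    by (rule continuous_on_subset[of UNIV]) (intro continuous_intros continuous_on_product_coordinates, simp)
  ultimately obtain \<theta> where \<theta>: "\<theta> \<in> ?C" "\<And>\<theta>'. \<theta>' \<in> ?C \<Longrightarrow> ?f \<theta> \<le> ?f \<theta>'"
    using continuous_attains_inf[of ?C ?f] by blast
  show ?thesis
  proof (intro exI[of _ \<theta>] conjI allI impI)
    show "\<theta> k = 0" if "k \<notin> J" for k
      using \<theta>(1) that by (auto simp: PiE_iff split: if_splits)
    fix \<theta>' :: "nat \<Rightarrow> real" assume supp: "\<forall>k. k \<notin> J \<longrightarrow> \<theta>' k = 0"
    show "?f \<theta> \<le> ?f \<theta>'"
    proof (cases "\<theta>' \<in> ?C")
      case False
      then obtain k where k: "k \<in> J" "\<theta>' k \<notin> {- R..R}"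
        using supp by (auto simp: PiE_iff split: if_splits)
      then have "R < \<bar>\<theta>' k\<bar>" by auto
      then have "?f (\<lambda>_. 0) < lam * \<bar>\<theta>' k\<bar>"
        unfolding R_def using lam by (simp add: field_simps)
      also have "\<dots> \<le> ?f \<theta>'"
        using k J by (intro f_ge) auto
      finally show ?thesis
        using \<theta>(2)[of "\<lambda>_. 0"] \<open>(\<lambda>_. 0) \<in> ?C\<close> by linarith
    qed (rule \<theta>(2))
  qed
qed

lemma linear_coeff_nonneg:
  fixes c q \<delta> :: real
  assumes "0 < \<delta>" "0 \<le> q" and nn: "\<And>u. 0 < u \<Longrightarrow> u < \<delta> \<Longrightarrow> 0 \<le> c * u + q * u\<^sup>2"
  shows "0 \<le> c"
proof (rule ccontr)
  assume "\<not> 0 \<le> c"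
  then have c: "c < 0" by simp
  define u where "u = min (\<delta> / 2) (- c / (2 * (q + 1)))"
  have u: "0 < u" "u < \<delta>" "u \<le> - c / (2 * (q + 1))"
    using assms(1,2) c by (auto simp: u_def divide_neg_pos)
  have "q * u \<le> (q + 1) * (- c / (2 * (q + 1)))"
    using u assms(2) by (intro mult_mono) auto
  also have "\<dots> = - c / 2" using assms(2) by (simp add: field_simps)
  finally have "c + q * u < 0" using c by linarith
  then have "u * (c + q * u) < 0" using u(1) by (simp add: mult_less_0_iff)
  moreover have "0 \<le> u * (c + q * u)"
    using nn[OF u(1,2)] by (simp add: power2_eq_square algebra_simps)
  ultimately show False by simp
qed

text \<open>
  The first-order condition at \<open>t = 0\<close>. The penalty is differentiable in \<open>t\<close> unless \<open>x = 0\<close>, where moving to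
  either side costs \<open>lam\<close> per unit.
\<close>

lemma abs_subgradient:
  fixes g q x lam :: real
  assumes q: "0 \<le> q" and lam: "0 < lam"
    and min: "\<And>t. 0 \<le> q * t\<^sup>2 + (lam * (\<bar>x + t\<bar> - \<bar>x\<bar>) - g * t)"
  shows "\<bar>g\<bar> \<le> lam" "x \<noteq> 0 \<Longrightarrow> g = lam * sgn x"
proof -
  have bd: "lam * (\<bar>x + t\<bar> - \<bar>x\<bar>) \<le> lam * \<bar>t\<bar>" for t
    using lam by (intro mult_left_mono) auto
  have 1: "0 \<le> lam - g"
  proof (rule linear_coeff_nonneg[of 1 q])
    fix u :: real assume "0 < u" "u < 1"
    then show "0 \<le> (lam - g) * u + q * u\<^sup>2"
      using min[of u] bd[of u] by (simp add: algebra_simps)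
  qed (use q in auto)
  have 2: "0 \<le> lam + g"
  proof (rule linear_coeff_nonneg[of 1 q])
    fix u :: real assume "0 < u" "u < 1"
    then show "0 \<le> (lam + g) * u + q * u\<^sup>2"
      using min[of "- u"] bd[of "- u"] by (simp add: algebra_simps)
  qed (use q in auto)
  show "\<bar>g\<bar> \<le> lam" using 1 2 by auto
  show "g = lam * sgn x" if "x \<noteq> 0"
  proof (cases "0 < x")
    case True
    have "0 \<le> g - lam"
    proof (rule linear_coeff_nonneg[of x q])
      fix u :: real assume "0 < u" "u < x"
      then show "0 \<le> (g - lam) * u + q * u\<^sup>2"
        using min[of "- u"] by (simp add: algebra_simps)
    qed (use q True in auto)
    then show ?thesis using 1 True by simp
  next
    case False
    then have x: "x < 0" using that by simp
    have "0 \<le> - lam - g"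
    proof (rule linear_coeff_nonneg[of "- x" q])
      fix u :: real assume "0 < u" "u < - x"
      then show "0 \<le> (- lam - g) * u + q * u\<^sup>2"
        using min[of u] by (simp add: algebra_simps)
    qed (use q x in auto)
    then show ?thesis using 2 x by simp
  qed
qed

lemma lasso_stationarity:
  assumes J: "J \<subseteq> {..<p}" and lam: "0 < lam" and supp: "\<And>k. k \<notin> J \<Longrightarrow> \<theta> k = 0"
    and min: "\<And>\<theta>'. (\<And>k. k \<notin> J \<Longrightarrow> \<theta>' k = 0) \<Longrightarrow> lasso_objective n p D a lam \<theta> \<le> lasso_objective n p D a lam \<theta>'"
    and k: "k \<in> J"
  shows "\<bar>score n p D a \<theta> k\<bar> \<le> lam" "\<theta> k \<noteq> 0 \<Longrightarrow> score n p D a \<theta> k = lam * sgn (\<theta> k)"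
proof -
  let ?q = "ip n (\<lambda>i. D i k) (\<lambda>i. D i k) / n"
  have kp: "k < p" using k J by auto
  have "0 \<le> ?q * t\<^sup>2 + (lam * (\<bar>\<theta> k + t\<bar> - \<bar>\<theta> k\<bar>) - score n p D a \<theta> k * t)" for t
  proof -
    define \<theta>' where "\<theta>' = \<theta>(k := \<theta> k + t)"
    have d: "\<theta>' j - \<theta> j = (if j = k then t else 0)" for j
      by (simp add: \<theta>'_def)
    have "(\<Sum>j<p. (\<theta>' j - \<theta> j) * D i j) = t * D i k" for i
      using kp by (simp add: d if_distrib[of "\<lambda>x. x * _"] cong: if_cong)
    then have 1: "ip n (\<lambda>i. \<Sum>j<p. (\<theta>' j - \<theta> j) * D i j) (\<lambda>i. \<Sum>j<p. (\<theta>' j - \<theta> j) * D i j) / n = ?q * t\<^sup>2"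
      by (simp only: ip_scale_left ip_scale_right) (simp add: power2_eq_square)
    have "(\<Sum>j<p. lam * (\<bar>\<theta>' j\<bar> - \<bar>\<theta> j\<bar>) - score n p D a \<theta> j * (\<theta>' j - \<theta> j)) =
        (\<Sum>j<p. if j = k then lam * (\<bar>\<theta> k + t\<bar> - \<bar>\<theta> k\<bar>) - score n p D a \<theta> k * t else 0)"
      by (intro sum.cong) (auto simp: \<theta>'_def)
    also have "\<dots> = lam * (\<bar>\<theta> k + t\<bar> - \<bar>\<theta> k\<bar>) - score n p D a \<theta> k * t"
      using kp by simp
    finally have 2: "(\<Sum>j<p. lam * (\<bar>\<theta>' j\<bar> - \<bar>\<theta> j\<bar>) - score n p D a \<theta> j * (\<theta>' j - \<theta> j)) =
        lam * (\<bar>\<theta> k + t\<bar> - \<bar>\<theta> k\<bar>) - score n p D a \<theta> k * t" .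
    have "lasso_objective n p D a lam \<theta> \<le> lasso_objective n p D a lam \<theta>'"
      by (rule min) (use supp k in \<open>auto simp: \<theta>'_def\<close>)
    then have "0 \<le> lasso_objective n p D a lam \<theta>' - lasso_objective n p D a lam \<theta>"
      by simp
    then show ?thesis
      unfolding lasso_objective_difference 1 2 .
  qed
  note abs_subgradient[of ?q lam "\<theta> k" "score n p D a \<theta> k", OF _ lam this]
  then show "\<bar>score n p D a \<theta> k\<bar> \<le> lam" "\<theta> k \<noteq> 0 \<Longrightarrow> score n p D a \<theta> k = lam * sgn (\<theta> k)"
    by (auto simp: ip_nonneg)
qed

text \<open>
  Each coordinate of the exact expansion around \<open>\<theta>\<close> contributes a nonnegative amount, and a strictly positive one at a
  coordinate off \<open>J\<close> where \<open>\<theta>'\<close> does not vanish. So such a \<open>\<theta>'\<close> has a larger objective than \<open>\<theta>\<close>.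
\<close>

lemma dual_certificate:
  assumes sol: "lasso_solution n p D a lam \<theta>'" and a: "a \<notin> J" and J: "J \<subseteq> {..<p}"
    and supp: "\<And>k. k \<notin> J \<Longrightarrow> \<theta> k = 0"
    and on: "\<And>k. k \<in> J \<Longrightarrow> \<bar>score n p D a \<theta> k\<bar> \<le> lam"
      "\<And>k. k \<in> J \<Longrightarrow> \<theta> k \<noteq> 0 \<Longrightarrow> score n p D a \<theta> k = lam * sgn (\<theta> k)"
    and off: "\<And>k. k < p \<Longrightarrow> k \<notin> J \<Longrightarrow> k \<noteq> a \<Longrightarrow> \<bar>score n p D a \<theta> k\<bar> < lam"
  shows "ne_hat p \<theta>' \<subseteq> J"
proof
  fix b assume "b \<in> ne_hat p \<theta>'"
  then have b: "b < p" "\<theta>' b \<noteq> 0" by (auto simp: ne_hat_def)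
  have \<theta>0: "\<theta> k = 0" if "p \<le> k" for k
    using J that by (intro supp) auto
  have \<theta>'a: "\<theta>' a = 0" and min: "lasso_objective n p D a lam \<theta>' \<le> lasso_objective n p D a lam \<theta>"
    using sol supp[OF a] \<theta>0 unfolding lasso_solution_def is_arg_min_linorder by auto
  let ?g = "score n p D a \<theta>"
  let ?t = "\<lambda>k. lam * (\<bar>\<theta>' k\<bar> - \<bar>\<theta> k\<bar>) - ?g k * (\<theta>' k - \<theta> k)"
  have le: "?g k * \<theta>' k \<le> \<bar>?g k\<bar> * \<bar>\<theta>' k\<bar>" for k
    by (metis abs_ge_self abs_mult)
  have t0: "0 \<le> ?t k" if "k < p" for k
  proof (cases "k \<in> J")
    case True
    have "?g k * \<theta> k = lam * \<bar>\<theta> k\<bar>"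
      using on(2)[OF True] by (cases "\<theta> k = 0") (auto simp: mult.assoc abs_sgn mult.commute)
    moreover have "\<bar>?g k\<bar> * \<bar>\<theta>' k\<bar> \<le> lam * \<bar>\<theta>' k\<bar>"
      using on(1)[OF True] by (intro mult_right_mono) auto
    ultimately show ?thesis using le[of k] by (simp add: algebra_simps)
  next
    case False
    show ?thesis
    proof (cases "k = a")
      case True
      then show ?thesis using \<theta>'a supp[OF False] by simp
    next
      case ka: False
      have "\<bar>?g k\<bar> * \<bar>\<theta>' k\<bar> \<le> lam * \<bar>\<theta>' k\<bar>"
        using off[OF that False ka] by (intro mult_right_mono) auto
      then show ?thesis using le[of k] supp[OF False] by (simp add: algebra_simps)
    qed
  qed
  show "b \<in> J"
  proof (rule ccontr)
    assume bJ: "b \<notin> J"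
    then have ba: "b \<noteq> a" using \<theta>'a b by auto
    have "\<bar>?g b\<bar> * \<bar>\<theta>' b\<bar> < lam * \<bar>\<theta>' b\<bar>"
      using off[OF b(1) bJ ba] b by (intro mult_strict_right_mono) auto
    then have "0 < ?t b" using le[of b] supp[OF bJ] by (simp add: algebra_simps)
    then have "0 < (\<Sum>k<p. ?t k)"
      using t0 b by (intro sum_pos2[of _ b]) auto
    then have "lasso_objective n p D a lam \<theta> < lasso_objective n p D a lam \<theta>'"
      using lasso_objective_difference[of n p D a lam \<theta>' \<theta>]
        ip_nonneg[of n "\<lambda>i. \<Sum>k<p. (\<theta>' k - \<theta> k) * D i k"] divide_nonneg_nonneg[of _ "real n"]
      by (smt (verit) of_nat_0_le_iff)
    then show False using min by simp
  qed
qed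

definition nrm :: "nat \<Rightarrow> (nat \<Rightarrow> real) \<Rightarrow> real" where
  "nrm n u = sqrt (ip n u u)"

lemma nrm_L2: "nrm n u = L2_set u {..<n}"
  by (simp add: nrm_def ip_def L2_set_def power2_eq_square)

lemma nrm_nonneg: "0 \<le> nrm n u"
  by (simp add: nrm_def ip_nonneg)

lemma nrm_sq: "(nrm n u)\<^sup>2 = ip n u u"
  by (simp add: nrm_def ip_nonneg)

lemma nrm_diff_le: "nrm n (\<lambda>i. u i - v i) \<le> nrm n u + nrm n v"
proof -
  have "L2_set (\<lambda>i. u i + (- v i)) {..<n} \<le> L2_set u {..<n} + L2_set (\<lambda>i. - v i) {..<n}"
    by (rule L2_set_triangle_ineq)
  then show ?thesis by (simp add: nrm_L2) (simp add: L2_set_def)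
qed

lemma nrm_scale: "nrm n (\<lambda>i. r * u i) = \<bar>r\<bar> * nrm n u"
  by (simp add: nrm_def ip_scale_left ip_scale_right real_sqrt_mult mult.assoc[symmetric])

lemma nearly_orthogonalD:
  assumes "nearly_orthogonal n \<eta> A D w" "0 \<le> \<eta>"
  shows "\<bar>ip n w (comb A D \<gamma>)\<bar> \<le> \<eta> * nrm n (comb A D \<gamma>)"
proof -
  have "\<bar>ip n w (comb A D \<gamma>)\<bar>\<^sup>2 \<le> (\<eta> * nrm n (comb A D \<gamma>))\<^sup>2"
    using assms(1) by (simp add: power_mult_distrib nrm_sq nearly_orthogonal_def)
  then show ?thesis
    by (rule power2_le_imp_le) (simp add: assms(2) nrm_nonneg)
qed

definition pred_resid :: "nat \<Rightarrow> nat set \<Rightarrow> (nat \<Rightarrow> nat \<Rightarrow> real) \<Rightarrow> (nat \<Rightarrow> real) \<Rightarrow> nat \<Rightarrow> real" where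
  "pred_resid b A D \<beta> i = D i b - comb A D \<beta> i"

lemma residual_restrict:
  assumes "J \<subseteq> {..<p}" "\<And>k. k \<notin> J \<Longrightarrow> \<theta> k = 0"
  shows "residual p D a \<theta> i = D i a - comb J D \<theta> i"
  unfolding residual_def comb_def using assms
  by (subst sum.mono_neutral_right[of "{..<p}" J]) (auto simp: mult.commute)

text \<open>
  Here \<open>\<alpha>\<close> are the optimal coefficients of \<open>a\<close>, and \<open>\<beta>\<close> those of the neighbor \<open>b\<close> in terms of the other neighbors.
  With \<open>\<Delta> = \<alpha>\<^sub>b - \<theta>\<^sub>b\<close> the lasso residual is \<open>R = Wa + \<Delta> Wb + u\<close> with \<open>u\<close> in the span of the columns in \<open>J - {b}\<close>.
  In \<open>\<langle>R, Wb\<rangle>\<close>, which stationarity bounds through the \<open>\<ell>\<^sub>1\<close> norm of \<open>\<beta>\<close>, the term \<open>\<Delta> \<bar>Wb\<bar>\<^sup>2\<close> dominates: \<open>Wb\<close> is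
  nearly orthogonal to \<open>u\<close>, and \<open>Wa\<close> to \<open>Wb\<close>, which lies in the span of the columns in \<open>J\<close>.
\<close>

lemma coefficient_deviation:
  fixes D :: "nat \<Rightarrow> nat \<Rightarrow> real" and \<alpha> \<beta> :: "nat \<Rightarrow> real"
  assumes J: "J \<subseteq> {..<p}" and b: "b \<in> J" and n: "0 < n" and eta: "0 \<le> \<eta>" and lam: "0 < lam"
    and supp: "\<And>k. k \<notin> J \<Longrightarrow> \<theta> k = 0"
    and stat: "\<And>k. k \<in> J \<Longrightarrow> \<bar>score n p D a \<theta> k\<bar> \<le> lam"
  defines "R \<equiv> residual p D a \<theta>"
  defines "Wa \<equiv> pred_resid a J D \<alpha>" and "Wb \<equiv> pred_resid b (J - {b}) D \<beta>"
  assumes beta: "(\<Sum>k\<in>J-{b}. \<bar>\<beta> k\<bar>) \<le> T"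
    and R: "ip n R R \<le> 2 * real n" and Wa: "ip n Wa Wa \<le> 2 * real n"
    and Wb: "ip n Wb Wb \<le> 2 * real n" "v * real n / 4 \<le> ip n Wb Wb" and v: "16 * \<eta>\<^sup>2 \<le> v * real n"
    and proj_a: "nearly_orthogonal n \<eta> J D Wa" and proj_b: "nearly_orthogonal n \<eta> (J - {b}) D Wb"
  shows "\<bar>\<alpha> b - \<theta> b\<bar> * (v * real n / 8) \<le> (1 + T) * lam * real n / 2 + 3 * \<eta> * sqrt (2 * real n)"
proof -
  have finJ: "finite J" using J finite_subset by blast
  have Jb: "J = insert b (J - {b})" using b by auto
  have sumJ: "(\<Sum>k\<in>J. f k) = f b + (\<Sum>k\<in>J-{b}. f k)" for f :: "nat \<Rightarrow> real"
    using sum.remove[OF finJ b] .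
  define \<Delta> where "\<Delta> = \<alpha> b - \<theta> b"
  define N where "N = nrm n Wb"
  define u where "u = comb (J - {b}) D (\<lambda>k. (\<alpha> k - \<theta> k) + \<Delta> * \<beta> k)"
  let ?s = "sqrt (2 * real n)"
  have N0: "0 \<le> N" by (simp add: N_def nrm_nonneg)
  have N2: "N\<^sup>2 = ip n Wb Wb" by (simp add: N_def nrm_sq)
  have Ns: "N \<le> ?s" and Rs: "nrm n R \<le> ?s" and Ws: "nrm n Wa \<le> ?s"
    using R Wa Wb by (auto simp: N_def nrm_def)
  \<comment> \<open>absorbs the part of the noise term that is proportional to \<open>\<Delta>\<close>\<close>
  have etaN: "\<eta> \<le> N / 2"
  proof (rule power2_le_imp_le)
    show "\<eta>\<^sup>2 \<le> (N / 2)\<^sup>2" using v Wb(2) by (simp add: power_divide N2)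
  qed (use N0 in simp)
  \<comment> \<open>substituting for column \<open>b\<close> its prediction plus \<open>Wb\<close> produces the coefficients of \<open>u\<close>\<close>
  have R_eq: "R i = Wa i + \<Delta> * Wb i + u i" for i
  proof -
    have "u i = (\<Sum>k\<in>J-{b}. (\<alpha> k - \<theta> k) * D i k) + \<Delta> * (\<Sum>k\<in>J-{b}. \<beta> k * D i k)"
      by (simp add: u_def comb_def algebra_simps sum.distrib sum_distrib_left sum_subtractf)
    moreover have "R i = D i a - comb J D \<theta> i"
      unfolding R_def by (rule residual_restrict[OF J supp])
    ultimately show ?thesis
      by (simp add: Wa_def Wb_def pred_resid_def comb_def sumJ \<Delta>_def algebra_simps sum_subtractf)
  qed
  have "ip n R Wb = ip n (\<lambda>i. Wa i + \<Delta> * Wb i + u i) Wb"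
    by (rule ip_cong) (auto simp: R_eq)
  then have 1: "ip n R Wb = ip n Wa Wb + \<Delta> * N\<^sup>2 + ip n u Wb"
    by (simp only: ip_add_left ip_scale_left N2)
  have 2: "\<bar>ip n R Wb\<bar> \<le> (1 + T) * lam * real n / 2"
  proof -
    have gr: "\<bar>ip n R (\<lambda>i. D i k)\<bar> \<le> lam * real n / 2" if "k \<in> J" for k
      using stat[OF that] n unfolding score_def R_def by (simp add: abs_mult field_simps)
    have "ip n R Wb = ip n R (\<lambda>i. D i b) - (\<Sum>k\<in>J-{b}. \<beta> k * ip n R (\<lambda>i. D i k))"
      unfolding Wb_def pred_resid_def[abs_def] comb_def by (simp only: ip_diff_right ip_sum_right ip_scale_right)
    then have "\<bar>ip n R Wb\<bar> \<le> \<bar>ip n R (\<lambda>i. D i b)\<bar> + (\<Sum>k\<in>J-{b}. \<bar>\<beta> k * ip n R (\<lambda>i. D i k)\<bar>)"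
      using sum_abs[of "\<lambda>k. \<beta> k * ip n R (\<lambda>i. D i k)" "J - {b}"] by linarith
    also have "\<dots> \<le> lam * real n / 2 + (\<Sum>k\<in>J-{b}. \<bar>\<beta> k\<bar> * (lam * real n / 2))"
      unfolding abs_mult using gr b by (intro add_mono sum_mono mult_left_mono) auto
    also have "\<dots> \<le> lam * real n / 2 + T * (lam * real n / 2)"
      unfolding sum_distrib_right[symmetric] using beta lam by (intro add_left_mono mult_right_mono) auto
    finally show ?thesis by (simp add: field_simps)
  qed
  have 3: "\<bar>ip n Wa Wb\<bar> \<le> \<eta> * ?s"
  proof -
    have "(\<Sum>k\<in>J-{b}. (if k = b then 1 else - \<beta> k) * D i k) = (\<Sum>k\<in>J-{b}. - (\<beta> k * D i k))" for i
      by (intro sum.cong) auto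
    then have Wb_eq: "comb J D (\<lambda>k. if k = b then 1 else - \<beta> k) = Wb"
      by (simp add: sumJ Wb_def pred_resid_def comb_def sum_negf fun_eq_iff)
    have "\<bar>ip n Wa Wb\<bar> \<le> \<eta> * N"
      using nearly_orthogonalD[OF proj_a eta, of "\<lambda>k. if k = b then 1 else - \<beta> k"]
      unfolding Wb_eq N_def .
    then show ?thesis using mult_left_mono[OF Ns eta] by linarith
  qed
  have 4: "\<bar>ip n u Wb\<bar> \<le> \<eta> * (2 * ?s + \<bar>\<Delta>\<bar> * N)"
  proof -
    have "\<bar>ip n Wb u\<bar> \<le> \<eta> * nrm n u"
      unfolding u_def by (rule nearly_orthogonalD[OF proj_b eta])
    moreover have "nrm n u \<le> 2 * ?s + \<bar>\<Delta>\<bar> * N"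
    proof -
      have "u = (\<lambda>i. (R i - Wa i) - \<Delta> * Wb i)"
        by (simp add: R_eq)
      then have "nrm n u \<le> nrm n (\<lambda>i. R i - Wa i) + nrm n (\<lambda>i. \<Delta> * Wb i)"
        by (simp only: nrm_diff_le)
      also have "\<dots> \<le> (nrm n R + nrm n Wa) + \<bar>\<Delta>\<bar> * N"
        unfolding nrm_scale N_def by (intro add_right_mono nrm_diff_le)
      finally show ?thesis using Rs Ws by linarith
    qed
    ultimately show ?thesis
      using mult_left_mono[OF _ eta, of "nrm n u"] unfolding ip_commute[of n u] by fastforce
  qed
  have "\<bar>\<Delta>\<bar> * N\<^sup>2 = \<bar>ip n R Wb - ip n Wa Wb - ip n u Wb\<bar>"
    unfolding 1 by (simp add: abs_mult)
  also have "\<dots> \<le> (1 + T) * lam * real n / 2 + \<eta> * ?s + \<eta> * (2 * ?s + \<bar>\<Delta>\<bar> * N)"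
    using 2 3 4 by linarith
  also have "\<eta> * (2 * ?s + \<bar>\<Delta>\<bar> * N) = 2 * \<eta> * ?s + \<eta> * (\<bar>\<Delta>\<bar> * N)"
    by (simp add: algebra_simps)
  also have "\<eta> * (\<bar>\<Delta>\<bar> * N) \<le> N / 2 * (\<bar>\<Delta>\<bar> * N)"
    using etaN N0 by (intro mult_right_mono) auto
  also have "N / 2 * (\<bar>\<Delta>\<bar> * N) = \<bar>\<Delta>\<bar> * N\<^sup>2 / 2"
    by (simp add: power2_eq_square)
  finally have 5: "\<bar>\<Delta>\<bar> * N\<^sup>2 / 2 \<le> (1 + T) * lam * real n / 2 + 3 * \<eta> * ?s"
    by linarith
  have "\<bar>\<Delta>\<bar> * (v * real n / 8) \<le> \<bar>\<Delta>\<bar> * (N\<^sup>2 / 2)"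
    using Wb(2) by (intro mult_left_mono) (auto simp: N2)
  also have "\<dots> = \<bar>\<Delta>\<bar> * N\<^sup>2 / 2" by simp
  finally show ?thesis using 5 unfolding \<Delta>_def by linarith
qed

text \<open>
  Replace \<open>b\<close> by its prediction from \<open>J\<close>. The scores on \<open>J\<close> are \<open>\<lambda> sgn \<alpha>\<^sub>k\<close>, so the prediction contributes at
  most \<open>\<delta>' \<lambda>\<close>. The prediction error \<open>V\<close> is nearly orthogonal to the lasso residual, a combination of the
  columns in \<open>J\<close> and of column \<open>a\<close>.
\<close>

lemma score_off_neighborhood:
  fixes b :: nat and D :: "nat \<Rightarrow> nat \<Rightarrow> real" and \<alpha> \<beta> :: "nat \<Rightarrow> real"
  assumes J: "J \<subseteq> {..<p}" and a: "a \<notin> J" and n: "0 < n" and eta: "0 \<le> \<eta>" and lam: "0 < lam"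
    and supp: "\<And>k. k \<notin> J \<Longrightarrow> \<theta> k = 0"
    and stat: "\<And>k. k \<in> J \<Longrightarrow> score n p D a \<theta> k = lam * sgn (\<alpha> k)"
  defines "R \<equiv> residual p D a \<theta>"
  defines "V \<equiv> pred_resid b J D \<beta>"
  assumes beta: "\<bar>\<Sum>k\<in>J. sgn (\<alpha> k) * \<beta> k\<bar> \<le> \<delta>'"
    and R: "ip n R R \<le> 2 * real n"
    and small: "2 * \<eta> * sqrt (2 * real n) < (1 - \<delta>') * lam * real n"
    and proj: "nearly_orthogonal n \<eta> (insert a J) D V"
  shows "\<bar>score n p D a \<theta> b\<bar> < lam"
proof -
  have finJ: "finite J" using J finite_subset by blast
  have R_eq: "comb (insert a J) D (\<lambda>k. if k = a then 1 else - \<theta> k) = R"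
  proof
    fix i
    have "comb (insert a J) D (\<lambda>k. if k = a then 1 else - \<theta> k) i = D i a + (\<Sum>k\<in>J. (if k = a then 1 else - \<theta> k) * D i k)"
      unfolding comb_def using finJ a by simp
    also have "(\<Sum>k\<in>J. (if k = a then 1 else - \<theta> k) * D i k) = (\<Sum>k\<in>J. - (\<theta> k * D i k))"
      using a by (intro sum.cong) auto
    also have "D i a + \<dots> = D i a - comb J D \<theta> i"
      by (simp add: sum_negf comb_def)
    also have "\<dots> = R i"
      unfolding R_def by (rule residual_restrict[OF J supp, symmetric])
    finally show "comb (insert a J) D (\<lambda>k. if k = a then 1 else - \<theta> k) i = R i" .
  qed
  have "\<bar>ip n V R\<bar> \<le> \<eta> * nrm n R"
    using nearly_orthogonalD[OF proj eta, of "\<lambda>k. if k = a then 1 else - \<theta> k"]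
    unfolding R_eq .
  moreover have "nrm n R \<le> sqrt (2 * real n)"
    using R by (simp add: nrm_def)
  ultimately have RV: "\<bar>ip n R V\<bar> \<le> \<eta> * sqrt (2 * real n)"
    using mult_left_mono[OF _ eta, of "nrm n R" "sqrt (2 * real n)"] ip_commute[of n R V] by linarith
  have "ip n R V = ip n R (\<lambda>i. D i b) - (\<Sum>k\<in>J. \<beta> k * ip n R (\<lambda>i. D i k))"
    unfolding V_def pred_resid_def[abs_def] comb_def by (simp only: ip_diff_right ip_sum_right ip_scale_right)
  then have "score n p D a \<theta> b = 2 * ip n R V / n + (\<Sum>k\<in>J. \<beta> k * score n p D a \<theta> k)"
    unfolding score_def R_def[symmetric]
    by (simp add: diff_divide_distrib right_diff_distrib sum_distrib_left sum_divide_distrib ac_simps)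
  also have "(\<Sum>k\<in>J. \<beta> k * score n p D a \<theta> k) = lam * (\<Sum>k\<in>J. sgn (\<alpha> k) * \<beta> k)"
    by (simp add: stat sum_distrib_left ac_simps)
  finally have "\<bar>score n p D a \<theta> b\<bar> \<le> \<bar>2 * ip n R V / n\<bar> + \<bar>lam * (\<Sum>k\<in>J. sgn (\<alpha> k) * \<beta> k)\<bar>"
    by (simp only: abs_triangle_ineq)
  also have "\<bar>2 * ip n R V / n\<bar> \<le> 2 * \<eta> * sqrt (2 * real n) / n"
    using RV n by (simp add: abs_mult field_simps)
  also have "\<dots> < (1 - \<delta>') * lam"
    using small n by (simp add: field_simps)
  also have "\<bar>lam * (\<Sum>k\<in>J. sgn (\<alpha> k) * \<beta> k)\<bar> \<le> lam * \<delta>'"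
    unfolding abs_mult using beta lam by (intro mult_mono) auto
  finally show ?thesis by (simp add: algebra_simps)
qed

text \<open>
  The deterministic core. The inequalities \<open>v\<close>, \<open>small\<close> and \<open>signal\<close> relate the noise level \<open>\<eta>\<close>, the
  penalty and the optimal coefficients; the bounds on lengths and the near-orthogonality of the prediction errors are what
  probability has to provide.
\<close>

lemma lasso_support_in_neighborhood:
  fixes D :: "nat \<Rightarrow> nat \<Rightarrow> real" and \<alpha> :: "nat \<Rightarrow> real" and \<beta> \<beta>' :: "nat \<Rightarrow> nat \<Rightarrow> real"
  assumes J: "J \<subseteq> {..<p}" and a: "a \<notin> J" and n: "0 < n" and eta: "0 \<le> \<eta>" and lam: "0 < lam"
    and v: "16 * \<eta>\<^sup>2 \<le> v * real n"
    and small: "2 * \<eta> * sqrt (2 * real n) < (1 - \<delta>') * lam * real n"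
    and signal: "\<And>b. b \<in> J \<Longrightarrow> (1 + T) * lam * real n / 2 + 3 * \<eta> * sqrt (2 * real n) < \<bar>\<alpha> b\<bar> * (v * real n / 8)"
    and Xa: "ip n (\<lambda>i. D i a) (\<lambda>i. D i a) \<le> 2 * real n"
    and Wa: "ip n (pred_resid a J D \<alpha>) (pred_resid a J D \<alpha>) \<le> 2 * real n"
    and proj_a: "nearly_orthogonal n \<eta> J D (pred_resid a J D \<alpha>)"
    and beta: "\<And>b. b \<in> J \<Longrightarrow> (\<Sum>k\<in>J-{b}. \<bar>\<beta> b k\<bar>) \<le> T"
    and Wb: "\<And>b. b \<in> J \<Longrightarrow> ip n (pred_resid b (J - {b}) D (\<beta> b)) (pred_resid b (J - {b}) D (\<beta> b)) \<le> 2 * real n"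
      "\<And>b. b \<in> J \<Longrightarrow> v * real n / 4 \<le> ip n (pred_resid b (J - {b}) D (\<beta> b)) (pred_resid b (J - {b}) D (\<beta> b))"
    and proj_b: "\<And>b. b \<in> J \<Longrightarrow> nearly_orthogonal n \<eta> (J - {b}) D (pred_resid b (J - {b}) D (\<beta> b))"
    and beta': "\<And>b. b < p \<Longrightarrow> b \<notin> J \<Longrightarrow> b \<noteq> a \<Longrightarrow> \<bar>\<Sum>k\<in>J. sgn (\<alpha> k) * \<beta>' b k\<bar> \<le> \<delta>'"
    and proj_V: "\<And>b. b < p \<Longrightarrow> b \<notin> J \<Longrightarrow> b \<noteq> a \<Longrightarrow> nearly_orthogonal n \<eta> (insert a J) D (pred_resid b J D (\<beta>' b))"
    and sol: "lasso_solution n p D a lam \<theta>hat"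
  shows "ne_hat p \<theta>hat \<subseteq> J"
proof -
  let ?f = "lasso_objective n p D a lam"
  obtain \<theta> where supp: "\<And>k. k \<notin> J \<Longrightarrow> \<theta> k = 0"
    and min: "\<And>\<theta>'. (\<And>k. k \<notin> J \<Longrightarrow> \<theta>' k = 0) \<Longrightarrow> ?f \<theta> \<le> ?f \<theta>'"
    using lasso_restricted_minimizer_exists[OF J lam, of n D a] by blast
  have stat: "\<bar>score n p D a \<theta> k\<bar> \<le> lam" "\<theta> k \<noteq> 0 \<Longrightarrow> score n p D a \<theta> k = lam * sgn (\<theta> k)" if "k \<in> J" for k
    using lasso_stationarity[of J p lam \<theta> n D a k, OF J lam _ _ that] supp min by auto
  let ?R = "residual p D a \<theta>"
  have R: "ip n ?R ?R \<le> 2 * real n"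
  proof -
    have "ip n ?R ?R / n \<le> ?f \<theta>"
      unfolding lasso_objective_residual using lam by (simp add: sum_nonneg)
    also have "\<dots> \<le> ?f (\<lambda>_. 0)" by (rule min) simp
    also have "\<dots> = ip n (\<lambda>i. D i a) (\<lambda>i. D i a) / n"
      unfolding lasso_objective_residual by (simp add: residual_def[abs_def])
    finally show ?thesis using Xa n by (simp add: field_simps)
  qed
  have sgn_eq: "sgn (\<theta> b) = sgn (\<alpha> b) \<and> \<theta> b \<noteq> 0" if b: "b \<in> J" for b
  proof -
    have "\<bar>\<alpha> b - \<theta> b\<bar> * (v * real n / 8) \<le> (1 + T) * lam * real n / 2 + 3 * \<eta> * sqrt (2 * real n)"
    proof (rule coefficient_deviation[OF J b n eta lam, where D = D and a = a and \<beta> = "\<beta> b"])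
      show "(\<Sum>k\<in>J-{b}. \<bar>\<beta> b k\<bar>) \<le> T" by (rule beta[OF b])
    qed (fact supp stat(1) R v Wa Wb(1)[OF b] Wb(2)[OF b] proj_a proj_b[OF b])+
    also have "\<dots> < \<bar>\<alpha> b\<bar> * (v * real n / 8)" by (rule signal[OF b])
    finally have lt: "\<bar>\<alpha> b - \<theta> b\<bar> * (v * real n / 8) < \<bar>\<alpha> b\<bar> * (v * real n / 8)" .
    have "0 \<le> v * real n / 8" using v zero_le_power2[of \<eta>] by linarith
    with lt have "\<bar>\<alpha> b - \<theta> b\<bar> < \<bar>\<alpha> b\<bar>"
      by (meson mult_right_mono not_le)
    then show ?thesis by (auto simp: sgn_if)
  qed
  have stat_eq: "score n p D a \<theta> k = lam * sgn (\<alpha> k)" if "k \<in> J" for k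
    using stat(2)[OF that] sgn_eq[OF that] by simp
  show ?thesis
  proof (rule dual_certificate[OF sol a J, where \<theta> = \<theta>])
    show "\<bar>score n p D a \<theta> k\<bar> < lam" if "k < p" "k \<notin> J" "k \<noteq> a" for k
      by (rule score_off_neighborhood[OF J a n eta lam, where D = D and b = k and \<beta> = "\<beta>' k"]) (fact supp stat_eq beta'[OF that] R small proj_V[OF that])+
    show "\<bar>score n p D a \<theta> k\<bar> \<le> lam" if "k \<in> J" for k by (rule stat(1)[OF that])
    show "score n p D a \<theta> k = lam * sgn (\<theta> k)" if "k \<in> J" "\<theta> k \<noteq> 0" for k by (rule stat(2)[OF that])
    show "\<theta> k = 0" if "k \<notin> J" for k by (rule supp[OF that])
  qed
qed

section \<open>Probability of a false neighbor\<close>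

lemma cond_indep_sym:
  assumes "cond_indep M F f g"
  shows "cond_indep M F g f"
  unfolding cond_indep_def
proof (intro ballI)
  fix A B :: "real set" assume "A \<in> sets borel" "B \<in> sets borel"
  then have "AE \<omega> in M. real_cond_exp M F (\<lambda>\<omega>. indicator B (f \<omega>) * indicator A (g \<omega>)) \<omega> =
      real_cond_exp M F (\<lambda>\<omega>. indicator B (f \<omega>)) \<omega> * real_cond_exp M F (\<lambda>\<omega>. indicator A (g \<omega>)) \<omega>"
    using assms by (simp add: cond_indep_def)
  moreover have "(\<lambda>\<omega>. indicator B (f \<omega>) * indicator A (g \<omega>) :: real) = (\<lambda>\<omega>. indicator A (g \<omega>) * indicator B (f \<omega>))"
    by (simp add: mult.commute)
  ultimately show "AE \<omega> in M. real_cond_exp M F (\<lambda>\<omega>. indicator A (g \<omega>) * indicator B (f \<omega>)) \<omega> =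
      real_cond_exp M F (\<lambda>\<omega>. indicator A (g \<omega>)) \<omega> * real_cond_exp M F (\<lambda>\<omega>. indicator B (f \<omega>)) \<omega>"
    by (simp only: mult.commute)
qed

lemma ne_sym: "b \<in> ne M p X a \<Longrightarrow> a < p \<Longrightarrow> a \<in> ne M p X b"
  unfolding ne_def edges_def using cond_indep_sym by (fastforce simp: insert_commute)

lemma ne_subset: "ne M p X a \<subseteq> {..<p} - {a}"
  by (auto simp: ne_def)

context gauss_vec
begin

abbreviation nbr :: "nat \<Rightarrow> nat set" where "nbr a \<equiv> ne M p X a"

text \<open>
  The coefficients of the error of the optimal prediction of \<open>X\<^sub>b\<close> from the variables in \<open>A\<close>.
\<close>

definition resid_v :: "nat \<Rightarrow> nat set \<Rightarrow> nat \<Rightarrow> real" where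
  "resid_v b A k = unit_v b k - opt_pred M p X b A k"

lemma lin_resid_v:
  assumes "b < p" "A \<subseteq> {..<p}"
  shows "lin p (resid_v b A) x = x b - (\<Sum>k\<in>A. opt_pred M p X b A k * x k)"
proof -
  have "lin p (resid_v b A) x = x b - (\<Sum>k<p. opt_pred M p X b A k * x k)"
    unfolding resid_v_def[abs_def] lin_diff lin_unit[OF assms(1)] by (simp add: lin_def)
  also have "(\<Sum>k<p. opt_pred M p X b A k * x k) = (\<Sum>k\<in>A. opt_pred M p X b A k * x k)"
    using assms opt_pred_normal_equations(1)[OF assms] by (intro sum.mono_neutral_right) auto
  finally show ?thesis .
qed

text \<open>
  The prediction error has coefficient \<open>1\<close> at \<open>b\<close>, so its variance is at least \<open>1 / K\<^sub>b\<^sub>b\<close>; the prediction by \<open>0\<close> shows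
  that it is at most the variance of \<open>X\<^sub>b\<close>.
\<close>

lemma resid_v_variance:
  assumes b: "b < p" and A: "A \<subseteq> {..<p}" "b \<notin> A" and var: "cov b b = 1" and v: "v \<le> 1 / prec b b"
  shows "resid_v b A b = 1" "bil p cov (resid_v b A) (resid_v b A) \<le> 1"
    "v \<le> bil p cov (resid_v b A) (resid_v b A)" "0 < bil p cov (resid_v b A) (resid_v b A)"
proof -
  note opt = opt_pred_normal_equations[OF b A(1)]
  show 1: "resid_v b A b = 1"
    using opt(1)[OF A(2)] by (simp add: resid_v_def unit_v_def)
  show "v \<le> bil p cov (resid_v b A) (resid_v b A)"
    using cov_ge_inverse_K[OF b, of "resid_v b A"] 1 v by simp
  show "0 < bil p cov (resid_v b A) (resid_v b A)"
    using S_pos[OF b, of "resid_v b A"] 1 by simp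
  have "bil p cov (\<lambda>k. unit_v b k - 0) (\<lambda>k. unit_v b k - 0) =
     bil p cov (\<lambda>k. unit_v b k - opt_pred M p X b A k) (\<lambda>k. unit_v b k - opt_pred M p X b A k) +
     bil p cov (\<lambda>k. opt_pred M p X b A k - 0) (\<lambda>k. opt_pred M p X b A k - 0)"
    by (rule residual_cov_pythagoras[OF A(1)]) (use opt in auto)
  then show "bil p cov (resid_v b A) (resid_v b A) \<le> 1"
    using cov_nonneg[of "opt_pred M p X b A"] cov_unit_diag[OF b] var
    by (simp add: resid_v_def[abs_def])
qed

lemma not_edge_precision_0:
  assumes "a < p" "k < p" "k \<noteq> a" "k \<notin> nbr a"
  shows "prec k a = 0"
proof -
  have "cond_indep M (F ({..<p} - {a, k})) (X a) (X k)"
    using assms by (auto simp: ne_def edges_def)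
  then have "prec a k = 0"
    using assms by (intro cond_indep_imp_precision_0) auto
  then show ?thesis using K_sym assms by metis
qed

text \<open>
  Predicting \<open>X\<^sub>a\<close> from its neighborhood is as good as predicting it from all other variables: the coefficients
  \<open>- K\<^sub>k\<^sub>a / K\<^sub>a\<^sub>a\<close> of the latter vanish off the neighborhood.
\<close>

lemma opt_pred_nbr:
  assumes a: "a < p"
  shows "opt_pred M p X a (nbr a) = (\<lambda>k. if k \<in> nbr a then - prec k a / prec a a else 0)"
    and "resid_v a (nbr a) k = (if k < p then prec k a / prec a a else 0)"
proof -
  let ?\<theta> = "\<lambda>k. if k \<in> nbr a then - prec k a / prec a a else 0"
  have K: "0 < prec a a" by (rule K_diag_pos[OF a])
  have eq: "unit_v a k - ?\<theta> k = (1 / prec a a) * prec k a" if "k < p" for k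
    using not_edge_precision_0[OF a that] ne_subset[of M p X a] K
    by (cases "k = a") (auto simp: unit_v_def)
  show 1: "opt_pred M p X a (nbr a) = ?\<theta>"
  proof (rule opt_pred_eqI[OF a])
    fix j assume j: "j \<in> nbr a"
    then have jp: "j < p" "j \<noteq> a" using ne_subset[of M p X a] by auto
    have "mv p cov (\<lambda>k. unit_v a k - ?\<theta> k) j = mv p cov (\<lambda>k. (1 / prec a a) * prec k a) j"
      unfolding mv_def by (intro sum.cong) (simp_all add: eq)
    also have "\<dots> = 0"
      unfolding mv_scale using mv_S_K[OF jp(1) a] jp by (simp add: unit_v_def)
    finally show "mv p cov (\<lambda>k. unit_v a k - ?\<theta> k) j = 0" .
  qed (use ne_subset[of M p X a] in auto)
  show "resid_v a (nbr a) k = (if k < p then prec k a / prec a a else 0)"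
  proof (cases "k < p")
    case True
    then show ?thesis using eq[of k] by (simp add: resid_v_def 1)
  next
    case False
    then show ?thesis using a ne_subset[of M p X a] by (auto simp: resid_v_def 1 unit_v_def)
  qed
qed

text \<open>
  If \<open>b\<close> is not a neighbor of \<open>a\<close>, its prediction error given the neighborhood of \<open>a\<close> is uncorrelated with \<open>X\<^sub>a\<close> too.
  Indeed \<open>X\<^sub>a\<close> is a combination of its neighbors plus a multiple of \<open>(K e\<^sub>a) \<bullet> X\<close>, and the covariance of the latter
  with \<open>c \<bullet> X\<close> is \<open>c\<^sub>a = 0\<close>.
\<close>

lemma resid_v_orthogonal_target:
  assumes a: "a < p" and b: "b < p" "b \<noteq> a" "b \<notin> nbr a"
  shows "mv p cov (resid_v b (nbr a)) a = 0"
proof -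
  have J: "nbr a \<subseteq> {..<p}" "a \<notin> nbr a" using ne_subset[of M p X a] by auto
  let ?c = "resid_v b (nbr a)"
  have ca: "?c a = 0"
    using b opt_pred_normal_equations(1)[OF b(1) J(1) J(2)] by (simp add: resid_v_def unit_v_def)
  have "bil p cov (resid_v a (nbr a)) ?c = bil p cov (\<lambda>k. (1 / prec a a) * prec k a) ?c"
    by (rule bil_cong) (simp_all add: opt_pred_nbr(2)[OF a])
  also have "\<dots> = 0"
    unfolding bil_scale_left cov_sym[of "\<lambda>k. prec k a"] cov_K[OF a] ca by simp
  finally have 1: "bil p cov (resid_v a (nbr a)) ?c = 0" .
  have "bil p cov (opt_pred M p X a (nbr a)) ?c = 0"
    by (rule cov_supported_0[OF J(1)])
      (use opt_pred_normal_equations(1)[OF a J(1)] opt_pred_normal_equations(2)[OF b(1) J(1)] in \<open>auto simp: resid_v_def[abs_def]\<close>)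
  then show ?thesis
    using 1 unfolding resid_v_def[of a, abs_def] bil_diff_left bil_unit_left[OF a] by simp
qed

text \<open>
  The coefficient is \<open>\<bar>\<pi>\<^sub>a\<^sub>b\<bar> (K\<^sub>b\<^sub>b / K\<^sub>a\<^sub>a)\<^bsup>1/2\<^esup>\<close> in absolute value, and \<open>1 \<le> K\<^sub>b\<^sub>b\<close> and \<open>K\<^sub>a\<^sub>a \<le> 1 / v\<close>.
\<close>

lemma optimal_coefficient_ge_partial_corr:
  assumes a: "a < p" and b: "b \<in> nbr a" and v: "v \<le> 1 / prec a a" "0 \<le> v" and var: "cov b b = 1"
  shows "sqrt v * \<bar>partial_corr Sg a b\<bar> \<le> \<bar>opt_pred M p X a (nbr a) b\<bar>"
proof -
  have bp: "b < p" using b ne_subset[of M p X a] by auto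
  have Ka: "0 < prec a a" and Kb: "0 < prec b b" using K_diag_pos a bp by auto
  have "1 / prec b b \<le> 1"
    using cov_ge_inverse_K[OF bp, of "unit_v b"] cov_unit_diag[OF bp] var by (simp add: unit_v_def)
  then have Kb1: "1 \<le> prec b b" using Kb by (simp add: field_simps)
  have "v * prec a a \<le> 1" using v Ka by (simp add: field_simps)
  then have "v * prec a a * prec a a \<le> prec b b * 1 * prec a a"
    using Kb1 Ka by (intro mult_right_mono) auto
  then have "v * (prec a a)\<^sup>2 \<le> prec a a * prec b b"
    by (simp add: power2_eq_square ac_simps)
  then have "sqrt (v * (prec a a)\<^sup>2) \<le> sqrt (prec a a * prec b b)" by simp
  then have sq: "sqrt v * prec a a \<le> sqrt (prec a a * prec b b)"
    using Ka by (simp add: real_sqrt_mult)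
  have s0: "0 < sqrt (prec a a * prec b b)" using Ka Kb by simp
  have "sqrt v * \<bar>partial_corr Sg a b\<bar> = sqrt v * \<bar>prec a b\<bar> / sqrt (prec a a * prec b b)"
    unfolding partial_corr_def using s0 by (simp add: abs_divide)
  also have "\<dots> \<le> \<bar>prec a b\<bar> / prec a a"
    using s0 Ka mult_right_mono[OF sq, of "\<bar>prec a b\<bar>"] by (simp add: field_simps)
  also have "\<dots> = \<bar>opt_pred M p X a (nbr a) b\<bar>"
    using b Ka K_sym[OF a bp] by (simp add: opt_pred_nbr(1)[OF a] abs_divide)
  finally show ?thesis .
qed

text \<open>
  The three properties of one prediction error that the deterministic argument uses. The set \<open>A'\<close> is larger than \<open>A\<close>
  when a node outside the neighborhood \<open>A\<close> is predicted, since then the target column is added.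
\<close>

lemma regression_event:
  assumes b: "b < p" and A: "A \<subseteq> {..<p}" "b \<notin> A" and var: "cov b b = 1" and v: "v \<le> 1 / prec b b"
    and A': "A' \<subseteq> {..<p}" "\<And>k. k \<in> A' \<Longrightarrow> mv p cov (resid_v b A) k = 0" "card A' \<le> q"
  defines "W \<equiv> \<lambda>D. pred_resid b A D (opt_pred M p X b A)"
  shows "\<exists>B\<in>sets (data n). emeasure (data n) B \<le> ennreal (2 * (exp (- real n / 8) + sqrt 2 ^ q * exp (- \<eta>\<^sup>2 / 4))) \<and>
    (\<forall>D\<in>space (data n) - B. ip n (W D) (W D) \<le> 2 * real n \<and> v * real n / 4 \<le> ip n (W D) (W D) \<and>
      nearly_orthogonal n \<eta> A' D (W D))"
proof -
  let ?c = "resid_v b A"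
  note c = resid_v_variance[OF b A var v]
  have W: "W D i = lin p ?c (D i)" for D i
    unfolding W_def pred_resid_def comb_def by (rule lin_resid_v[OF b A(1), symmetric])
  have W': "W D = (\<lambda>i. lin p ?c (D i))" for D
    by (simp add: W fun_eq_iff)
  obtain B1 where B1: "B1 \<in> sets (data n)" "emeasure (data n) B1 \<le> ennreal (exp (- real n / 8))"
    "\<forall>D\<in>space (data n) - B1. ip n (W D) (W D) \<le> 2 * n"
    using norm_events(1)[OF c(4,2), of n] unfolding W' by blast
  obtain B2 where B2: "B2 \<in> sets (data n)" "emeasure (data n) B2 \<le> ennreal (exp (- real n / 8))"
    "\<forall>D\<in>space (data n) - B2. bil p cov ?c ?c * n / 4 \<le> ip n (W D) (W D)"
    using norm_events(2)[OF c(4,2), of n] unfolding W' by blast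
  obtain B3 where B3: "B3 \<in> sets (data n)" "emeasure (data n) B3 \<le> ennreal (sqrt 2 ^ card A' * exp (- \<eta>\<^sup>2 / 4))"
    "\<forall>D\<in>space (data n) - B3. nearly_orthogonal n \<eta> A' D (W D)"
    using projection_event[OF A'(1,2) c(4,2), of n \<eta>] unfolding W' by blast
  have q: "sqrt 2 ^ card A' * exp (- \<eta>\<^sup>2 / 4) \<le> sqrt 2 ^ q * exp (- \<eta>\<^sup>2 / 4)"
    using power_increasing[OF A'(3), of "sqrt 2"] by (intro mult_right_mono) auto
  have "emeasure (data n) (B1 \<union> B2 \<union> B3) \<le> emeasure (data n) B1 + emeasure (data n) B2 + emeasure (data n) B3"
    using B1(1) B2(1) B3(1)
    by (meson add_right_mono emeasure_subadditive order_trans sets.Un)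
  also have "\<dots> \<le> ennreal (exp (- real n / 8)) + ennreal (exp (- real n / 8)) + ennreal (sqrt 2 ^ q * exp (- \<eta>\<^sup>2 / 4))"
    by (intro add_mono B1(2) B2(2) order_trans[OF B3(2) ennreal_leI[OF q]])
  also have "\<dots> = ennreal (exp (- real n / 8) + exp (- real n / 8) + sqrt 2 ^ q * exp (- \<eta>\<^sup>2 / 4))"
    by (simp only: ennreal_plus add_nonneg_nonneg exp_ge_zero zero_le_power mult_nonneg_nonneg
      real_sqrt_ge_zero zero_le_numeral)
  also have "\<dots> \<le> ennreal (2 * (exp (- real n / 8) + sqrt 2 ^ q * exp (- \<eta>\<^sup>2 / 4)))"
    by (intro ennreal_leI) simp
  finally have "emeasure (data n) (B1 \<union> B2 \<union> B3) \<le> ennreal (2 * (exp (- real n / 8) + sqrt 2 ^ q * exp (- \<eta>\<^sup>2 / 4)))" .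
  moreover have "v * real n / 4 \<le> bil p cov ?c ?c * n / 4"
    using c(3) by (intro divide_right_mono mult_right_mono) auto
  ultimately show ?thesis
    using B1 B2 B3 by (intro bexI[of _ "B1 \<union> B2 \<union> B3"]) (auto intro: order_trans)
qed

text \<open>
  A union bound over one event for each node and one for the length of the target column. Every node \<open>b\<close> is predicted
  from \<open>J - {b}\<close>, where \<open>J\<close> is the neighborhood of \<open>a\<close>; this covers the target, its neighbors and
  the remaining nodes at once.
\<close>

lemma lasso_failure_probability:
  fixes D :: "nat \<Rightarrow> nat \<Rightarrow> 'w \<Rightarrow> real"
  assumes n: "0 < n"
    and rows_indep: "indep_vars (\<lambda>_. \<Pi>\<^sub>M k\<in>{..<p}. borel) (\<lambda>i. rvec {..<p} (D i)) {..<n}"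
    and rows_law: "\<And>i. i < n \<Longrightarrow> distr M (\<Pi>\<^sub>M k\<in>{..<p}. borel) (rvec {..<p} (D i)) = law"
    and var: "\<And>b. b < p \<Longrightarrow> variance (X b) = 1"
    and cvar: "\<And>b. b < p \<Longrightarrow> AE \<omega> in M. v \<le> cond_variance M (F ({..<p} - {b})) (X b) \<omega>" and v0: "0 \<le> v"
    and a: "a < p"
    and l1: "\<And>b. b \<in> nbr a \<Longrightarrow> l1_norm p (opt_pred M p X b (nbr a - {b})) \<le> T"
    and S: "\<And>b. b < p \<Longrightarrow> b \<noteq> a \<Longrightarrow> b \<notin> nbr a \<Longrightarrow> \<bar>S_stat M p X a b\<bar> \<le> \<delta>'"
    and q: "card (nbr a) \<le> q"
    and eta: "0 \<le> \<eta>" and lam: "0 < lam"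
    and v: "16 * \<eta>\<^sup>2 \<le> v * real n"
    and small: "2 * \<eta> * sqrt (2 * real n) < (1 - \<delta>') * lam * real n"
    and signal: "\<And>b. b \<in> nbr a \<Longrightarrow> (1 + T) * lam * real n / 2 + 3 * \<eta> * sqrt (2 * real n) <
        sqrt v * \<bar>partial_corr Sg a b\<bar> * (v * real n / 8)"
  shows "\<exists>B\<in>sets M. measure M B \<le> 3 * real p * (exp (- real n / 8) + sqrt 2 ^ Suc q * exp (- \<eta>\<^sup>2 / 4)) \<and>
    (\<forall>\<omega>\<in>space M - B. \<forall>\<theta>. lasso_solution n p (\<lambda>i k. D i k \<omega>) a lam \<theta> \<longrightarrow> ne_hat p \<theta> \<subseteq> nbr a)"
proof -
  let ?J = "nbr a"
  let ?e = "exp (- real n / 8) + sqrt 2 ^ Suc q * exp (- \<eta>\<^sup>2 / 4)"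
  have J: "?J \<subseteq> {..<p}" "a \<notin> ?J" using ne_subset[of M p X a] by auto
  have cv1: "cov b b = 1" if "b < p" for b
    using var[OF that] variance_X[OF that] by simp
  have vK: "v \<le> 1 / prec b b" if "b < p" for b
    by (rule cond_variance_bound[OF that cvar[OF that]])
  \<comment> \<open>the columns that must be nearly orthogonal to the prediction error of \<open>b\<close>;
    for \<open>b\<close> outside the neighborhood, column \<open>a\<close> is among them, as it occurs in the lasso residual\<close>
  define A' where "A' b = (if b \<in> insert a ?J then ?J - {b} else insert a ?J)" for b
  define W where "W b = (\<lambda>D. pred_resid b (?J - {b}) D (opt_pred M p X b (?J - {b})))" for b
  define good where "good b D \<longleftrightarrow> ip n (W b D) (W b D) \<le> 2 * real n \<and>
      v * real n / 4 \<le> ip n (W b D) (W b D) \<and> nearly_orthogonal n \<eta> (A' b) D (W b D)" for b D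
  have "\<exists>B. B \<in> sets (data n) \<and> emeasure (data n) B \<le> ennreal (2 * ?e) \<and> (\<forall>D\<in>space (data n) - B. good b D)"
    if b: "b \<in> {..<p}" for b
  proof -
    have bp: "b < p" using b by simp
    have A: "?J - {b} \<subseteq> {..<p}" "b \<notin> ?J - {b}" using J by auto
    have orth: "mv p cov (resid_v b (?J - {b})) k = 0" if k: "k \<in> A' b" for k
    proof (cases "k \<in> ?J - {b}")
      case True
      then show ?thesis
        using opt_pred_normal_equations(2)[OF bp A(1)] by (simp add: resid_v_def[abs_def])
    next
      case False
      then have "k = a" "b \<noteq> a" "b \<notin> ?J" using k by (auto simp: A'_def split: if_splits)
      then show ?thesis using resid_v_orthogonal_target[OF a bp] by simp
    qed
    have fJ: "finite ?J" using J finite_subset by blast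
    have "card (A' b) \<le> Suc q"
      using q card_Diff1_le[of ?J b] card_insert_if[OF fJ, of a] J(2) by (auto simp: A'_def)
    moreover have "A' b \<subseteq> {..<p}" using J a by (auto simp: A'_def)
    ultimately show ?thesis
      using regression_event[OF bp A cv1[OF bp] vK[OF bp] _ orth, where q = "Suc q" and n = n and \<eta> = \<eta>]
      unfolding good_def W_def by blast
  qed
  then obtain B where B: "\<And>b. b \<in> {..<p} \<Longrightarrow> B b \<in> sets (data n)"
    "\<And>b. b \<in> {..<p} \<Longrightarrow> emeasure (data n) (B b) \<le> ennreal (2 * ?e)"
    "\<And>b D. b \<in> {..<p} \<Longrightarrow> D \<in> space (data n) - B b \<Longrightarrow> good b D"
    using bchoice[of "{..<p}" "\<lambda>b B. B \<in> sets (data n) \<and> emeasure (data n) B \<le> ennreal (2 * ?e) \<and> (\<forall>D\<in>space (data n) - B. good b D)"]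
    by blast
  obtain B0 where B0: "B0 \<in> sets (data n)" "emeasure (data n) B0 \<le> ennreal (exp (- real n / 8))"
    "\<forall>D\<in>space (data n) - B0. ip n (\<lambda>i. D i a) (\<lambda>i. D i a) \<le> 2 * n"
    using norm_events(1)[of "unit_v a" n] cv1[OF a] by (auto simp: cov_unit_diag[OF a] lin_unit[OF a])
  define Bad where "Bad = B0 \<union> (\<Union>b<p. B b)"
  have Bad: "Bad \<in> sets (data n)"
    unfolding Bad_def using B(1) B0(1) by auto
  have "emeasure (data n) Bad \<le> emeasure (data n) B0 + emeasure (data n) (\<Union>b<p. B b)"
    unfolding Bad_def using B(1) B0(1) by (intro emeasure_subadditive) auto
  also have "\<dots> \<le> ennreal (exp (- real n / 8)) + (\<Sum>b<p. emeasure (data n) (B b))"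
    using B(1) by (intro add_mono B0(2) emeasure_subadditive_finite) auto
  also have "\<dots> \<le> ennreal ?e + (\<Sum>b<p. ennreal (2 * ?e))"
    using B(2) by (intro add_mono sum_mono ennreal_leI) auto
  also have "\<dots> = ennreal (?e + real p * (2 * ?e))"
    by (subst ennreal_plus) (auto simp: ennreal_mult'' ennreal_of_nat_eq_real_of_nat intro!: add_nonneg_nonneg)
  also have "\<dots> \<le> ennreal (3 * real p * ?e)"
  proof (rule ennreal_leI)
    have le: "x + real p * (2 * x) \<le> 3 * real p * x" if "0 \<le> x" for x
    proof -
      have "1 * x \<le> real p * x" using a that by (intro mult_right_mono) auto
      then show ?thesis by linarith
    qed
    show "?e + real p * (2 * ?e) \<le> 3 * real p * ?e"
      by (rule le) simp
  qed
  finally have Bad_le: "emeasure (data n) Bad \<le> ennreal (3 * real p * ?e)" .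
  \<comment> \<open>the rows as one random element; by independence and equality of laws it is distributed as \<open>data n\<close>\<close>
  define Z where "Z \<omega> = (\<lambda>i\<in>{..<n}. rvec {..<p} (D i) \<omega>)" for \<omega>
  have rv: "rvec {..<p} (D i) \<in> measurable M row_space" if "i \<in> {..<n}" for i
    using rows_indep that by (auto simp: indep_vars_def)
  have Zm: "Z \<in> measurable M (data_space n)"
    unfolding Z_def[abs_def] by (rule measurable_restrict) (rule rv)
  have "distr M (data_space n) Z = (\<Pi>\<^sub>M i\<in>{..<n}. distr M row_space (rvec {..<p} (D i)))"
    unfolding Z_def[abs_def]
    using indep_vars_iff_distr_eq_PiM'[of "{..<n}" "\<lambda>i. rvec {..<p} (D i)" "\<lambda>_. row_space", THEN iffD1] n rv rows_indep
    by auto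
  also have "\<dots> = data n"
    using rows_law by (intro PiM_cong) auto
  finally have distrZ: "distr M (data_space n) Z = data n" .
  have Zspace: "Z \<omega> \<in> space (data n)" if "\<omega> \<in> space M" for \<omega>
    using measurable_space[OF Zm that] by (simp add: sets_eq_imp_space_eq[OF sets_data])
  have BadR: "Bad \<in> sets (data_space n)" using Bad by (simp add: sets_data)
  show ?thesis
  proof (intro bexI conjI ballI allI impI)
    let ?B = "Z -` Bad \<inter> space M"
    show "?B \<in> sets M" by (rule measurable_sets[OF Zm BadR])
    have "emeasure M ?B = emeasure (data n) Bad"
      unfolding distrZ[symmetric] by (rule emeasure_distr[OF Zm BadR, symmetric])
    then have "ennreal (measure M ?B) \<le> ennreal (3 * real p * ?e)"
      using Bad_le by (simp add: emeasure_eq_measure)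
    then show "measure M ?B \<le> 3 * real p * ?e"
      by (subst (asm) ennreal_le_iff) (auto intro!: mult_nonneg_nonneg add_nonneg_nonneg)
    fix \<omega> \<theta> assume \<omega>: "\<omega> \<in> space M - ?B" and sol: "lasso_solution n p (\<lambda>i k. D i k \<omega>) a lam \<theta>"
    define E where "E = Z \<omega>"
    have E: "E \<in> space (data n)" "E \<notin> Bad" using \<omega> Zspace by (auto simp: E_def)
    have E_eq: "E i k = D i k \<omega>" if "i < n" "k < p" for i k
      using that by (simp add: E_def Z_def rvec_def)
    have gd: "good b E" if "b < p" for b
      using E that by (intro B(3)) (auto simp: Bad_def)
    have obj: "lasso_objective n p (\<lambda>i k. D i k \<omega>) a lam = lasso_objective n p E a lam"
      unfolding lasso_objective_def fun_eq_iff using E_eq a by (auto intro!: sum.cong)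
    have solE: "lasso_solution n p E a lam \<theta>"
      using sol unfolding lasso_solution_def obj .
    have Ja: "?J - {a} = ?J" using J(2) by auto
    have A'a: "A' a = ?J" using Ja by (simp add: A'_def)
    have A'J: "A' b = ?J - {b}" if "b \<in> ?J" for b using that by (simp add: A'_def)
    have A'V: "A' b = insert a ?J" "?J - {b} = ?J" if "b \<notin> ?J" "b \<noteq> a" for b using that by (auto simp: A'_def)
    note ga = gd[OF a, unfolded good_def W_def A'a Ja]
    show "ne_hat p \<theta> \<subseteq> ?J"
    proof (rule lasso_support_in_neighborhood[OF J n eta lam v small, where D = E and \<theta>hat = \<theta> and T = T
        and \<alpha> = "opt_pred M p X a ?J" and \<beta> = "\<lambda>b. opt_pred M p X b (?J - {b})" and \<beta>' = "\<lambda>b. opt_pred M p X b ?J"])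
      fix b assume b: "b \<in> ?J"
      then have bp: "b < p" using J by auto
      have "sqrt v * \<bar>partial_corr Sg a b\<bar> * (v * real n / 8) \<le> \<bar>opt_pred M p X a ?J b\<bar> * (v * real n / 8)"
        using optimal_coefficient_ge_partial_corr[OF a b vK[OF a] v0 cv1[OF bp]] v0 by (intro mult_right_mono) auto
      then show "(1 + T) * lam * real n / 2 + 3 * \<eta> * sqrt (2 * real n) < \<bar>opt_pred M p X a ?J b\<bar> * (v * real n / 8)"
        using signal[OF b] by linarith
      have "(\<Sum>k\<in>?J-{b}. \<bar>opt_pred M p X b (?J - {b}) k\<bar>) \<le> l1_norm p (opt_pred M p X b (?J - {b}))"
        unfolding l1_norm_def using J by (intro sum_mono2) auto
      then show "(\<Sum>k\<in>?J-{b}. \<bar>opt_pred M p X b (?J - {b}) k\<bar>) \<le> T"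
        using l1[OF b] by linarith
      note gb = gd[OF bp, unfolded good_def W_def A'J[OF b]]
      let ?W = "pred_resid b (?J - {b}) E (opt_pred M p X b (?J - {b}))"
      show "ip n ?W ?W \<le> 2 * real n" "v * real n / 4 \<le> ip n ?W ?W" "nearly_orthogonal n \<eta> (?J - {b}) E ?W"
        using gb by auto
    next
      fix b assume b: "b < p" "b \<notin> ?J" "b \<noteq> a"
      show "\<bar>\<Sum>k\<in>?J. sgn (opt_pred M p X a ?J k) * opt_pred M p X b ?J k\<bar> \<le> \<delta>'"
        using S[OF b(1,3,2)] by (simp add: S_stat_def)
      note gb = gd[OF b(1), unfolded good_def W_def A'V[OF b(2,3)]]
      show "nearly_orthogonal n \<eta> (insert a ?J) E (pred_resid b ?J E (opt_pred M p X b ?J))"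
        using gb by blast
    next
      show "ip n (\<lambda>i. E i a) (\<lambda>i. E i a) \<le> 2 * real n"
        using B0(3) E by (auto simp: Bad_def)
      show "lasso_solution n p E a lam \<theta>" by (rule solE)
    qed (use ga in blast)+
  qed
qed

end

lemma eventually_powr_le_exp:
  fixes c \<epsilon> \<gamma> :: real
  assumes "0 < c" "0 < \<epsilon>"
  shows "\<forall>\<^sub>F n in sequentially. real n powr \<gamma> \<le> exp (c * real n powr \<epsilon>)"
  using assms by real_asymp

lemma eventually_powr_dominates:
  fixes A B s t :: real
  assumes "0 < B" "s < t"
  shows "\<forall>\<^sub>F n in sequentially. A * real n powr s < B * real n powr t"
proof -
  have "((\<lambda>x. x powr (s - t)) \<longlongrightarrow> 0) at_top"
    using assms(2) by (intro tendsto_neg_powr filterlim_ident) auto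
  then have "(\<lambda>n. A * real n powr (s - t)) \<longlonglongrightarrow> A * 0"
    by (intro tendsto_mult tendsto_const filterlim_compose[OF _ filterlim_real_sequentially])
  then have "\<forall>\<^sub>F n in sequentially. A * real n powr (s - t) < B"
    using assms(1) by (intro order_tendstoD) auto
  then show ?thesis
    using eventually_gt_at_top[of 0]
  proof eventually_elim
    case (elim n)
    then have "A * real n powr (s - t) * real n powr t < B * real n powr t"
      by (intro mult_strict_right_mono) auto
    also have "A * real n powr (s - t) * real n powr t = A * real n powr s"
      by (simp add: mult.assoc powr_add[symmetric])
    finally show ?case .
  qed
qed

lemma asymp_equiv_eventually_between:
  fixes f g :: "nat \<Rightarrow> real"
  assumes "f \<sim>[sequentially] g" "\<forall>\<^sub>F n in sequentially. 0 < g n"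
  shows "\<forall>\<^sub>F n in sequentially. g n / 2 < f n \<and> f n < 2 * g n"
proof -
  have lim: "((\<lambda>n. if f n = 0 \<and> g n = 0 then 1 else f n / g n) \<longlongrightarrow> 1) sequentially"
    using assms(1) by (simp add: asymp_equiv_def)
  have "\<forall>\<^sub>F n in sequentially. 1 / 2 < (if f n = 0 \<and> g n = 0 then 1 else f n / g n)"
    "\<forall>\<^sub>F n in sequentially. (if f n = 0 \<and> g n = 0 then 1 else f n / g n) < 2"
    by (rule order_tendstoD[OF lim], simp)+
  then show ?thesis
    using assms(2) by eventually_elim (auto simp: field_simps)
qed

theorem theorem1:
  fixes M :: "nat \<Rightarrow> 'w measure"
    and p :: "nat \<Rightarrow> nat"
    and \<Sigma> :: "nat \<Rightarrow> real mat"
    and X :: "nat \<Rightarrow> nat \<Rightarrow> 'w \<Rightarrow> real"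
    and D :: "nat \<Rightarrow> nat \<Rightarrow> nat \<Rightarrow> 'w \<Rightarrow> real"
    and lam :: "nat \<Rightarrow> real"
    and \<kappa> \<xi> \<epsilon> d :: real
  assumes prob: "\<forall>n\<ge>1. prob_space (M n)"
    and nodes: "\<forall>n\<ge>1. 1 \<le> p n"
    and normal: "\<forall>n\<ge>1. normal_vec (M n) (p n) (X n) (\<Sigma> n)"
    and rows_indep: "\<forall>n\<ge>1. prob_space.indep_vars (M n) (\<lambda>_. \<Pi>\<^sub>M k\<in>{..<p n}. borel)
          (\<lambda>i. rvec {..<p n} (D n i)) {..<n}"
    and rows_law: "\<forall>n\<ge>1. \<forall>i<n.
          distr (M n) (\<Pi>\<^sub>M k\<in>{..<p n}. borel) (rvec {..<p n} (D n i)) =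
          distr (M n) (\<Pi>\<^sub>M k\<in>{..<p n}. borel) (rvec {..<p n} (X n))"
    and A1: "\<exists>\<gamma>>0. (\<lambda>n. real (p n)) \<in> O(\<lambda>n. real n powr \<gamma>)"
    and A2_var: "\<forall>n\<ge>1. \<forall>a<p n. prob_space.variance (M n) (X n a) = 1"
    and A2_cond_var: "\<exists>v2>0. \<forall>n\<ge>1. \<forall>a<p n. AE \<omega> in M n.
          v2 \<le> cond_variance (M n) (sigma_gen_by (M n) (X n) ({..<p n} - {a})) (X n a) \<omega>"
    and A3_kappa: "0 \<le> \<kappa>" "\<kappa> < 1"
    and A3: "(\<lambda>n. real (MAX a\<in>{..<p n}. card (ne (M n) (p n) (X n) a))) \<in> O(\<lambda>n. real n powr \<kappa>)"
    and A4: "\<exists>\<theta>max. \<forall>n\<ge>1. \<forall>a<p n. \<forall>b \<in> ne (M n) (p n) (X n) a.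
          l1_norm (p n) (opt_pred (M n) (p n) (X n) a (ne (M n) (p n) (X n) b - {a})) \<le> \<theta>max"
    and A5_xi: "\<kappa> < \<xi>"
    and A5: "\<exists>\<delta>>0. \<forall>n\<ge>1. \<forall>(a, b) \<in> edges (M n) (p n) (X n).
          \<delta> * real n powr (- (1 - \<xi>) / 2) \<le> \<bar>partial_corr (\<Sigma> n) a b\<bar>"
    and A6: "\<exists>\<delta>'<1. \<forall>n\<ge>1. \<forall>a<p n. \<forall>b<p n. b \<noteq> a \<longrightarrow> b \<notin> ne (M n) (p n) (X n) a \<longrightarrow>
          \<bar>S_stat (M n) (p n) (X n) a b\<bar> < \<delta>'"
    and eps: "\<kappa> < \<epsilon>" "\<epsilon> < \<xi>" "\<epsilon> \<le> 1"
    and d: "0 < d"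
    and lam: "lam \<sim>[sequentially] (\<lambda>n. d * real n powr (- (1 - \<epsilon>) / 2))"
  shows "\<exists>c>0. \<exists>C. \<forall>\<^sub>F n in sequentially. \<forall>a<p n. \<forall>\<theta>hat :: 'w \<Rightarrow> nat \<Rightarrow> real.
          (\<forall>\<omega> \<in> space (M n).
             lasso_solution n (p n) (\<lambda>i k. D n i k \<omega>) a (lam n) (\<theta>hat \<omega>)) \<longrightarrow>
          {\<omega> \<in> space (M n). ne_hat (p n) (\<theta>hat \<omega>) \<subseteq> ne (M n) (p n) (X n) a} \<in> sets (M n) \<longrightarrow>
          \<bar>1 - measure (M n)
             {\<omega> \<in> space (M n). ne_hat (p n) (\<theta>hat \<omega>) \<subseteq> ne (M n) (p n) (X n) a}\<bar>
            \<le> C * exp (- c * real n powr \<epsilon>)"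
proof -
  obtain \<gamma> where "(\<lambda>n. real (p n)) \<in> O(\<lambda>n. real n powr \<gamma>)" using A1 by blast
  then obtain Cp where Cp: "0 < Cp" "\<forall>\<^sub>F n in sequentially. real (p n) \<le> Cp * real n powr \<gamma>"
    by (elim landau_o.bigE) auto
  obtain Cq where Cq: "0 < Cq"
    "\<forall>\<^sub>F n in sequentially. real (MAX a\<in>{..<p n}. card (ne (M n) (p n) (X n) a)) \<le> Cq * real n powr \<kappa>"
    using A3 by (elim landau_o.bigE) auto
  obtain v where v: "0 < v" "\<And>n a. 1 \<le> n \<Longrightarrow> a < p n \<Longrightarrow> AE \<omega> in M n.
      v \<le> cond_variance (M n) (sigma_gen_by (M n) (X n) ({..<p n} - {a})) (X n a) \<omega>"
    using A2_cond_var by blast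
  obtain T0 where T0: "\<And>n a b. 1 \<le> n \<Longrightarrow> a < p n \<Longrightarrow> b \<in> ne (M n) (p n) (X n) a \<Longrightarrow>
      l1_norm (p n) (opt_pred (M n) (p n) (X n) a (ne (M n) (p n) (X n) b - {a})) \<le> T0"
    using A4 by blast
  obtain \<delta> where \<delta>: "0 < \<delta>" "\<And>n a b. 1 \<le> n \<Longrightarrow> (a, b) \<in> edges (M n) (p n) (X n) \<Longrightarrow>
      \<delta> * real n powr (- (1 - \<xi>) / 2) \<le> \<bar>partial_corr (\<Sigma> n) a b\<bar>"
    using A5 by blast
  obtain \<delta>' where \<delta>': "\<delta>' < 1" "\<And>n a b. 1 \<le> n \<Longrightarrow> a < p n \<Longrightarrow> b < p n \<Longrightarrow> b \<noteq> a \<Longrightarrow> b \<notin> ne (M n) (p n) (X n) a \<Longrightarrow>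
      \<bar>S_stat (M n) (p n) (X n) a b\<bar> < \<delta>'"
    using A6 by blast
  have eps0: "0 < \<epsilon>" using eps(1) A3_kappa(1) by linarith
  \<comment> \<open>\<open>T0\<close> may be negative when there are no edges\<close>
  define T where "T = max 0 T0"
  define g where "g n = real n powr (- (1 - \<epsilon>) / 2)" for n :: nat
  define h where "h n = real n powr ((1 + \<epsilon>) / 2)" for n :: nat
  \<comment> \<open>the first bound makes noise small against the length of a prediction error,
    the second makes it small against the slack \<open>(1 - \<delta>') \<lambda>\<close> off the neighborhood\<close>
  define \<eta>0 where "\<eta>0 = min (sqrt v / 4) ((1 - \<delta>') * d / 8)"
  define \<eta> where "\<eta> n = \<eta>0 * real n powr (\<epsilon> / 2)" for n :: nat
  \<comment> \<open>half of the rate \<open>min (1/8) (\<eta>0\<^sup>2 / 8)\<close> of a single event; the other half absorbs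
    the number of nodes\<close>
  define c where "c = min (1 / 16) (\<eta>0\<^sup>2 / 16)"
  have \<eta>0: "0 < \<eta>0" "\<eta>0 \<le> sqrt v / 4" "\<eta>0 \<le> (1 - \<delta>') * d / 8"
    using v(1) \<delta>'(1) d by (auto simp: \<eta>0_def)
  have \<eta>0v: "16 * \<eta>0\<^sup>2 \<le> v"
    using power_mono[OF \<eta>0(2), of 2] \<eta>0(1) v(1) by (simp add: power_divide)
  have c: "0 < c" "2 * c \<le> 1 / 8" "2 * c \<le> \<eta>0\<^sup>2 / 8"
    using \<eta>0(1) by (auto simp: c_def)
  have gn: "real n * g n = h n" if "0 < n" for n
  proof -
    have "real n * g n = real n powr 1 * real n powr (- (1 - \<epsilon>) / 2)" using that by (simp add: g_def)
    also have "\<dots> = h n" unfolding powr_add[symmetric] h_def by (simp add: field_simps)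
    finally show ?thesis .
  qed
  have \<eta>n: "\<eta> n * sqrt (2 * real n) = sqrt 2 * \<eta>0 * h n" if "0 < n" for n
  proof -
    have "sqrt (2 * real n) = sqrt 2 * real n powr (1 / 2)"
      using that by (simp add: real_sqrt_mult powr_half_sqrt)
    moreover have "real n powr (\<epsilon> / 2) * real n powr (1 / 2) = h n"
      unfolding powr_add[symmetric] h_def by (simp add: field_simps)
    ultimately show ?thesis
      unfolding \<eta>_def by (simp add: ac_simps)
  qed
  have \<eta>2: "(\<eta> n)\<^sup>2 = \<eta>0\<^sup>2 * real n powr \<epsilon>" for n
    unfolding \<eta>_def power_mult_distrib by (simp add: power2_eq_square powr_add[symmetric])
  have "\<forall>\<^sub>F n in sequentially. 0 < d * g n"
    using eventually_gt_at_top[of 0] by eventually_elim (use d in \<open>simp add: g_def\<close>)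
  then have lam_ev: "\<forall>\<^sub>F n in sequentially. d * g n / 2 < lam n \<and> lam n < 2 * (d * g n)"
    by (rule asymp_equiv_eventually_between[OF lam[folded g_def]])
  have signal_ev: "\<forall>\<^sub>F n in sequentially. ((1 + T) * d + 3 * (sqrt 2 * \<eta>0)) * real n powr ((1 + \<epsilon>) / 2) <
      (sqrt v * \<delta> * v / 8) * real n powr ((1 + \<xi>) / 2)"
    by (rule eventually_powr_dominates) (use v(1) \<delta>(1) eps in auto)
  have poly_ev: "\<forall>\<^sub>F n in sequentially. real n powr \<gamma> \<le> exp (c * real n powr \<epsilon>)"
    by (rule eventually_powr_le_exp[OF c(1) eps0])
  have card_ev: "\<forall>\<^sub>F n in sequentially. Cq * real n powr \<kappa> < (\<eta>0\<^sup>2 / 16) * real n powr \<epsilon>"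
    "\<forall>\<^sub>F n in sequentially. 1 * real n powr 0 < (\<eta>0\<^sup>2 / 16) * real n powr \<epsilon>"
    by (rule eventually_powr_dominates; use \<eta>0(1) eps eps0 in auto)+
  let ?Q = "\<lambda>n a C. \<exists>B\<in>sets (M n). measure (M n) B \<le> C \<and>
    (\<forall>\<omega>\<in>space (M n) - B. \<forall>\<theta>. lasso_solution n (p n) (\<lambda>i k. D n i k \<omega>) a (lam n) \<theta> \<longrightarrow>
       ne_hat (p n) \<theta> \<subseteq> ne (M n) (p n) (X n) a)"
  have main: "\<forall>\<^sub>F n in sequentially. \<forall>a<p n. ?Q n a (6 * Cp * exp (- c * real n powr \<epsilon>))"
    using eventually_gt_at_top[of 0] Cp(2) Cq(2) lam_ev signal_ev poly_ev card_ev
  proof eventually_elim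
    case (elim n)
    then have n: "1 \<le> n" by simp
    interpret gauss_vec "M n" "p n" "X n" "\<Sigma> n"
      using prob normal n by (simp add: gauss_vec_def gauss_vec_axioms_def)
    have g0: "0 < g n" and h0: "0 < h n" using n by (auto simp: g_def h_def)
    have lam0: "0 < lam n" using elim(4) d g0 by (smt (verit) divide_pos_pos mult_pos_pos)
    have lam_le: "lam n * real n \<le> 2 * d * h n"
    proof -
      have "lam n * real n \<le> 2 * (d * g n) * real n" using elim(4) by (intro mult_right_mono) auto
      also have "\<dots> = 2 * d * (real n * g n)" by simp
      finally show ?thesis using gn n by simp
    qed
    have lam_ge: "d * h n / 2 \<le> lam n * real n"
    proof -
      have "d * (real n * g n) / 2 = d * g n / 2 * real n" by simp
      also have "\<dots> \<le> lam n * real n" using elim(4) by (intro mult_right_mono) auto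
      finally show ?thesis using gn n by simp
    qed
    show ?case
    proof (intro allI impI)
      fix a assume a: "a < p n"
      let ?q = "card (nbr a)"
      have q: "real ?q \<le> Cq * real n powr \<kappa>"
      proof -
        have "?q \<le> (MAX a\<in>{..<p n}. card (nbr a))" using a by (intro Max_ge) auto
        then show ?thesis using elim(3) by linarith
      qed
      have "?Q n a (3 * real (p n) * (exp (- real n / 8) + sqrt 2 ^ Suc ?q * exp (- (\<eta> n)\<^sup>2 / 4)))"
      proof (rule lasso_failure_probability[where v = v and T = T and \<delta>' = \<delta>'])
        show "indep_vars (\<lambda>_. row_space) (\<lambda>i. rvec {..<p n} (D n i)) {..<n}" using rows_indep n by simp
        show "distr (M n) row_space (rvec {..<p n} (D n i)) = law" if "i < n" for i using rows_law n that by simp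
        show "variance (X n b) = 1" if "b < p n" for b using A2_var n that by simp
        show "AE \<omega> in M n. v \<le> cond_variance (M n) (F ({..<p n} - {b})) (X n b) \<omega>" if "b < p n" for b
          using v(2)[OF n that] .
        show "l1_norm (p n) (opt_pred (M n) (p n) (X n) b (nbr a - {b})) \<le> T" if "b \<in> nbr a" for b
          using T0[OF n _ ne_sym[OF that a]] that ne_subset[of "M n" "p n" "X n" a] unfolding T_def by fastforce
        show "\<bar>S_stat (M n) (p n) (X n) a b\<bar> \<le> \<delta>'" if "b < p n" "b \<noteq> a" "b \<notin> nbr a" for b
          using \<delta>'(2)[OF n a that] by simp
        show "16 * (\<eta> n)\<^sup>2 \<le> v * real n"
        proof -
          have "real n powr \<epsilon> \<le> real n powr 1" using n eps(3) by (intro powr_mono) auto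
          then have "16 * \<eta>0\<^sup>2 * real n powr \<epsilon> \<le> v * real n"
            using \<eta>0v n v(1) by (intro mult_mono) auto
          then show ?thesis by (simp add: \<eta>2)
        qed
        show "2 * \<eta> n * sqrt (2 * real n) < (1 - \<delta>') * lam n * real n"
        proof -
          have s2: "sqrt 2 < 2" by (rule real_less_lsqrt) auto
          have "2 * \<eta> n * sqrt (2 * real n) = sqrt 2 * (2 * \<eta>0 * h n)"
            using \<eta>n[of n] n by simp
          also have "\<dots> < 2 * (2 * \<eta>0 * h n)"
            using s2 \<eta>0(1) h0 by (intro mult_strict_right_mono) auto
          also have "\<dots> = 4 * \<eta>0 * h n" by simp
          also have "\<dots> \<le> 4 * ((1 - \<delta>') * d / 8) * h n"
            by (intro mult_right_mono mult_left_mono \<eta>0(3)) (use h0 in auto)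
          also have "\<dots> = (1 - \<delta>') * (d * h n / 2)" by simp
          also have "\<dots> \<le> (1 - \<delta>') * (lam n * real n)"
            using lam_ge \<delta>'(1) by (intro mult_left_mono) auto
          finally show ?thesis by simp
        qed
        show "(1 + T) * lam n * real n / 2 + 3 * \<eta> n * sqrt (2 * real n) <
            sqrt v * \<bar>partial_corr (\<Sigma> n) a b\<bar> * (v * real n / 8)" if b: "b \<in> nbr a" for b
        proof -
          have "(1 + T) * (lam n * real n) \<le> (1 + T) * (2 * d * h n)"
            using lam_le by (intro mult_left_mono) (auto simp: T_def)
          moreover have "(1 + T) * lam n * real n / 2 + 3 * \<eta> n * sqrt (2 * real n) =
              (1 + T) * (lam n * real n) / 2 + 3 * (\<eta> n * sqrt (2 * real n))" by simp
          moreover have "((1 + T) * d + 3 * (sqrt 2 * \<eta>0)) * h n = (1 + T) * (2 * d * h n) / 2 + 3 * (sqrt 2 * \<eta>0 * h n)"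
            by (simp add: algebra_simps)
          ultimately have "(1 + T) * lam n * real n / 2 + 3 * \<eta> n * sqrt (2 * real n) \<le>
              ((1 + T) * d + 3 * (sqrt 2 * \<eta>0)) * h n"
            using \<eta>n[of n] n by linarith
          also have "\<dots> < (sqrt v * \<delta> * v / 8) * real n powr ((1 + \<xi>) / 2)"
            using elim(5) by (simp add: h_def)
          also have "real n powr ((1 + \<xi>) / 2) = real n powr 1 * real n powr (- (1 - \<xi>) / 2)"
            unfolding powr_add[symmetric] by (simp add: field_simps)
          also have "(sqrt v * \<delta> * v / 8) * (real n powr 1 * real n powr (- (1 - \<xi>) / 2)) =
              sqrt v * (\<delta> * real n powr (- (1 - \<xi>) / 2)) * (v * real n / 8)"
            using n by simp
          also have "\<dots> \<le> sqrt v * \<bar>partial_corr (\<Sigma> n) a b\<bar> * (v * real n / 8)"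
            using \<delta>(2)[OF n, of a b] b v(1) by (intro mult_right_mono mult_left_mono) (auto simp: ne_def)
          finally show ?thesis .
        qed
      qed (use n a v(1) \<eta>0(1) lam0 in \<open>auto simp: \<eta>_def\<close>)
      moreover have "3 * real (p n) * (exp (- real n / 8) + sqrt 2 ^ Suc ?q * exp (- (\<eta> n)\<^sup>2 / 4)) \<le>
          6 * Cp * exp (- c * real n powr \<epsilon>)"
      proof -
        let ?r = "real n powr \<epsilon>"
        have r0: "0 \<le> ?r" by simp
        have "?r \<le> real n powr 1" using n eps(3) by (intro powr_mono) auto
        then have "2 * c * ?r \<le> 1 / 8 * real n" using c n by (intro mult_mono) auto
        then have 1: "exp (- real n / 8) \<le> exp (- 2 * c * ?r)" by simp
        have "sqrt 2 \<le> exp (1 :: real)"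
          using exp_ge_add_one_self[of 1] sqrt2_less_2 by linarith
        then have "sqrt 2 ^ Suc ?q \<le> exp 1 ^ Suc ?q" by (intro power_mono) auto
        also have "\<dots> = exp (real (Suc ?q))" by (simp only: exp_of_nat_mult[symmetric]) simp
        also have "\<dots> \<le> exp (\<eta>0\<^sup>2 / 8 * ?r)"
          using q elim(7,8) n by simp
        finally have "sqrt 2 ^ Suc ?q * exp (- (\<eta> n)\<^sup>2 / 4) \<le> exp (\<eta>0\<^sup>2 / 8 * ?r) * exp (- (\<eta>0\<^sup>2 * ?r) / 4)"
          unfolding \<eta>2 by (intro mult_right_mono) auto
        also have "\<dots> = exp (- (\<eta>0\<^sup>2 / 8) * ?r)" by (simp add: mult_exp_exp)
        also have "\<dots> \<le> exp (- 2 * c * ?r)"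
          using mult_right_mono[OF c(3) r0] by simp
        finally have 2: "sqrt 2 ^ Suc ?q * exp (- (\<eta> n)\<^sup>2 / 4) \<le> exp (- 2 * c * ?r)" .
        have "real (p n) \<le> Cp * exp (c * ?r)"
          using elim(2) mult_left_mono[OF elim(6), of Cp] Cp(1) by linarith
        then have "3 * real (p n) * (exp (- real n / 8) + sqrt 2 ^ Suc ?q * exp (- (\<eta> n)\<^sup>2 / 4)) \<le>
           3 * (Cp * exp (c * ?r)) * (exp (- 2 * c * ?r) + exp (- 2 * c * ?r))"
          using 1 2 by (intro mult_mono add_mono) auto
        also have "\<dots> = 6 * Cp * (exp (c * ?r) * exp (- 2 * c * ?r))" by simp
        also have "exp (c * ?r) * exp (- 2 * c * ?r) = exp (- c * ?r)" by (simp add: mult_exp_exp)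
        finally show ?thesis .
      qed
      ultimately show "?Q n a (6 * Cp * exp (- c * real n powr \<epsilon>))"
        by (meson order_trans)
    qed
  qed
  have "\<forall>\<^sub>F n in sequentially. \<forall>a<p n. \<forall>\<theta>hat :: 'w \<Rightarrow> nat \<Rightarrow> real.
      (\<forall>\<omega>\<in>space (M n). lasso_solution n (p n) (\<lambda>i k. D n i k \<omega>) a (lam n) (\<theta>hat \<omega>)) \<longrightarrow>
      {\<omega>\<in>space (M n). ne_hat (p n) (\<theta>hat \<omega>) \<subseteq> ne (M n) (p n) (X n) a} \<in> sets (M n) \<longrightarrow>
      \<bar>1 - measure (M n) {\<omega>\<in>space (M n). ne_hat (p n) (\<theta>hat \<omega>) \<subseteq> ne (M n) (p n) (X n) a}\<bar>
        \<le> 6 * Cp * exp (- c * real n powr \<epsilon>)"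
    using main eventually_gt_at_top[of 0]
  proof eventually_elim
    case (elim n)
    show ?case
    proof (intro allI impI)
      fix a and \<theta>hat :: "'w \<Rightarrow> nat \<Rightarrow> real"
      let ?G = "{\<omega>\<in>space (M n). ne_hat (p n) (\<theta>hat \<omega>) \<subseteq> ne (M n) (p n) (X n) a}"
      assume a: "a < p n" and G: "?G \<in> sets (M n)"
        and sol: "\<forall>\<omega>\<in>space (M n). lasso_solution n (p n) (\<lambda>i k. D n i k \<omega>) a (lam n) (\<theta>hat \<omega>)"
      interpret prob_space "M n" using prob elim(2) by simp
      from elim(1) a have "?Q n a (6 * Cp * exp (- c * real n powr \<epsilon>))" by simp
      then obtain B where B: "B \<in> sets (M n)" "prob B \<le> 6 * Cp * exp (- c * real n powr \<epsilon>)"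
        "space (M n) - B \<subseteq> ?G"
        using sol by blast
      have "1 - prob B \<le> prob ?G"
        using finite_measure_mono[OF B(3) G] unfolding prob_compl[OF B(1)] .
      then show "\<bar>1 - prob ?G\<bar> \<le> 6 * Cp * exp (- c * real n powr \<epsilon>)"
        using B(2) prob_le_1[of ?G] by linarith
    qed
  qed
  then show ?thesis using c(1) by blast
qed

end
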